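(* Let $(E,e,T)$ be a $T$-universally complete conditional Riesz triple. (a) For every $\mu\in\mathrm{ba}(T)$, one has $\int\cdot\,\mathrm d\mu\in\widehat{L^\infty(T)}$. (b) For every $\varphi\in\widehat{L^\infty(T)}$, one has $\varphi|_{C_e}\in\mathrm{ba}(T)$. (c) The maps $$\Phi\colon\mathrm{ba}(T)\to\widehat{L^\infty(T)},\quad \mu\mapsto\Bigl(f\mapsto\int f\,\mathrm d\mu\Bigr),\qquad \Psi\colon\widehat{L^\infty(T)}\to\mathrm{ba}(T),\quad\varphi\mapsto\varphi|_{C_e},$$ are mutually inverse $R(T)$-linear isometric Riesz isomorphisms.
   Context: All Riesz spaces are real. A conditional Riesz triple is a triple $(E,e,T)$ where $E$ is a Dedekind complete Riesz space, $e\in E_+$ is a weak order unit (the band generated by $e$ is $E$), and $T\colon E\to E$ is an order continuous, strictly positive ($f>0$ implies $Tf>0$) linear projection with $T(e)=e$ whose range $R(T)$ is a Dedekind complete Riesz subspace of $E$. Let $E^u$ denote the universal completion of $E$, in which $E$ is regarded as an order dense Riesz subspace; $E^u$ is an $f$-algebra with algebraic unit $e$, and products are taken in $E^u$. The triple is $T$-universally complete if every non-empty upwards directed $A\subseteq E$ such that $T[A]$ is bounded from above in $E^u$ has a supremum in $E$. In this case one writes $L^1(T):=E$; $R(T)$ is universally complete and is an $f$-algebra with algebraic unit and weak order unit $e$; $E$ is an $R(T)$-module. A map between $R(T)$-modules is $R(T)$-linear if it is additive and commutes with multiplication by elements of $R(T)$. $L^\infty(T):=\{f\in L^1(T):\exists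 g\in R(T)_+,\ |f|\le g\}$, an order ideal and $R(T)$-submodule, with $R(T)$-valued norm $\|f\|_{T,\infty}:=\inf\{\alpha\in R(T)_+:|f|\le\alpha\}$. Strong dual: $\widehat{L^\infty(T)}$ is the set of all $R(T)$-linear maps $\varphi\colon L^\infty(T)\to R(T)$ that are regular (a difference of two positive linear operators) and $\|\cdot\|_{T,\infty}$-bounded, i.e. there is $g\in R(T)_+$ with $|\varphi(f)|\le g\|f\|_{T,\infty}$ for all $f\in L^\infty(T)$. It is an order ideal and $R(T)$-submodule of the Dedekind complete Riesz space $\mathrm L^{\mathrm r}(L^\infty(T),R(T))$ of regular operators (with $\varphi\le\psi$ iff $\psi-\varphi$ is positive; pointwise operations), with $R(T)$-valued norm $\|\varphi\|_{\widehat{L^\infty(T)}}:=\inf\{g\in R(T)_+:|\varphi(f)|\le g\|f\|_{T,\infty}\ \forall f\in L^\infty(T)\}$. Charges: $C_e$ is the set of components of $e$, i.e. of $p\in E$ with $p\wedge(e-p)=0$. A signed $R(T)$-valued charge on $C_e$ is a map $\mu\colon C_e\to R(T)$ with $\mu(0)=0$ and $\mu(p+q)=\mu(p)+\mu(q)$ whenever $p,q\in C_e$, $p\wedge q=0$; it is a charge if moreover $\mu(p)\ge0$ for all $p$; it is order bounded if there is $g\in R(T)_+$ with $|\mu(p)|\le g$ for all $p\in C_e$. $\mathrm{ba}(C_e,R(T))$ is the set of order bounded signed $R(T)$-valued charges, ordered by $\mu\le\nu$ iff $\nu-\mu$ is a charge; it is a Dedekind complete Riesz space with $|\mu|(p)=\sup\{\mu(q)-\mu(p-q):q\in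 C_e,q\le p\}$ and $\mu^+(p)=\sup\{\mu(q):q\in C_e,q\le p\}$, an $R(T)$-module under pointwise operations, and carries the $R(T)$-valued norm $\|\mu\|:=|\mu|(e)$. Let $B_{Tp}$ be the band generated by $Tp$ in $R(T)$; $\mu$ is $T$-absolutely continuous if $\mu(p)\in B_{Tp}$ for all $p\in C_e$. $\mathrm{ba}(T)$ is the set of $T$-absolutely continuous $\mu\in\mathrm{ba}(C_e,R(T))$ with the inherited order, module structure and norm (it is a band and submodule of $\mathrm{ba}(C_e,R(T))$). Integral: $\mathcal S_e(T)$ is the set of all $x=\sum_{i=1}^n\alpha_ip_i$ with $\alpha_i\in R(T)$ and pairwise disjoint $p_i\in C_e$. For $\mu\in\mathrm{ba}(T)$, $I_\mu\colon\mathcal S_e(T)\to R(T)$, $I_\mu(\sum_i\alpha_ip_i):=\sum_i\alpha_i\mu(p_i)$ (independent of the representation). For $f\in L^\infty(T)_+$ and $0\le\mu\in\mathrm{ba}(T)$, $\int f\,\mathrm d\mu:=\sup\{I_\mu(g):g\in\mathcal S_e(T),0\le g\le f\}$ (supremum in $R(T)$); for general $f\in L^\infty(T)$, $\mu\in\mathrm{ba}(T)$, $\int f\,\mathrm d\mu:=\int f^+\,\mathrm d\mu^+-\int f^-\,\mathrm d\mu^+-\int f^+\,\mathrm d\mu^-+\int f^-\,\mathrm d\mu^-$. Isometric means that the $R(T)$-valued norms are preserved. *)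

theory Defs
  imports Complex_Main "HOL-Library.Lattice_Algebras" "HOL-Library.FuncSet"
begin

section \<open>The ambient f-algebra\<close>

text \<open>
  The universal completion of \<open>E\<close> is the type \<open>'u\<close>, and \<open>E\<close>, the range of \<open>T\<close>, etc. are subsets
  of it.  No unit is built into the classes: the algebraic unit is the element \<open>e\<close> of the triple,
  and the zero space, in which \<open>e = 0\<close>, is not excluded (as it would be by \<open>ring_1\<close>).
  Commutativity is not assumed; for an Archimedean f-algebra it is a theorem.
\<close>

class f_algebra = lattice_ring + ordered_real_vector + real_algebra +
  assumes f_algebra_left: "inf a b = 0 \<Longrightarrow> 0 \<le> c \<Longrightarrow> inf (c * a) b = 0"
    and f_algebra_right: "inf a b = 0 \<Longrightarrow> 0 \<le> c \<Longrightarrow> inf (a * c) b = 0"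

class universally_complete_f_algebra = f_algebra + conditionally_complete_lattice +
  assumes laterally_complete:
    "(\<And>a. a \<in> A \<Longrightarrow> 0 \<le> a) \<Longrightarrow> (\<And>a b. a \<in> A \<Longrightarrow> b \<in> A \<Longrightarrow> a \<noteq> b \<Longrightarrow> inf a b = 0) \<Longrightarrow>
      A \<noteq> {} \<Longrightarrow> \<exists>s. (\<forall>a\<in>A. a \<le> s) \<and> (\<forall>u. (\<forall>a\<in>A. a \<le> u) \<longrightarrow> s \<le> u)"


section \<open>Suprema and infima relative to a carrier\<close>

text \<open>
  Suprema are always taken in a stated carrier \<open>L\<close> (such as \<open>E\<close> or the range of \<open>T\<close>) and with
  respect to a stated order, so that the same notion serves for spaces of charges and of operators.
\<close>

definition is_lub :: "('b \<Rightarrow> 'b \<Rightarrow> bool) \<Rightarrow> 'b set \<Rightarrow> 'b set \<Rightarrow> 'b \<Rightarrow> bool" where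
  "is_lub le L A s \<longleftrightarrow>
     s \<in> L \<and> (\<forall>a\<in>A. le a s) \<and> (\<forall>u\<in>L. (\<forall>a\<in>A. le a u) \<longrightarrow> le s u)"

definition is_glb :: "('b \<Rightarrow> 'b \<Rightarrow> bool) \<Rightarrow> 'b set \<Rightarrow> 'b set \<Rightarrow> 'b \<Rightarrow> bool" where
  "is_glb le L A s \<longleftrightarrow>
     s \<in> L \<and> (\<forall>a\<in>A. le s a) \<and> (\<forall>u\<in>L. (\<forall>a\<in>A. le u a) \<longrightarrow> le u s)"

definition Lub :: "('b \<Rightarrow> 'b \<Rightarrow> bool) \<Rightarrow> 'b set \<Rightarrow> 'b set \<Rightarrow> 'b" where
  "Lub le L A = (THE s. is_lub le L A s)"

definition Glb :: "('b \<Rightarrow> 'b \<Rightarrow> bool) \<Rightarrow> 'b set \<Rightarrow> 'b set \<Rightarrow> 'b" where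
  "Glb le L A = (THE s. is_glb le L A s)"


section \<open>Riesz subspaces, bands, conditional Riesz triples\<close>

context
  fixes L :: "'u::universally_complete_f_algebra set"
begin

definition riesz_subspace :: bool where
  "riesz_subspace \<longleftrightarrow> subspace L \<and> (\<forall>x\<in>L. \<forall>y\<in>L. sup x y \<in> L \<and> inf x y \<in> L)"

definition dedekind_complete_in :: bool where
  "dedekind_complete_in \<longleftrightarrow>
     (\<forall>A. A \<subseteq> L \<and> A \<noteq> {} \<and> (\<exists>u\<in>L. \<forall>a\<in>A. a \<le> u) \<longrightarrow> (\<exists>s. is_lub (\<le>) L A s))"

definition order_dense :: bool where
  "order_dense \<longleftrightarrow> (\<forall>u>0. \<exists>x\<in>L. 0 < x \<and> x \<le> u)"

definition order_ideal_in :: "'u set \<Rightarrow> bool" where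
  "order_ideal_in J \<longleftrightarrow>
     J \<subseteq> L \<and> subspace J \<and> (\<forall>x\<in>L. \<forall>y\<in>J. \<bar>x\<bar> \<le> \<bar>y\<bar> \<longrightarrow> x \<in> J)"

definition band_in :: "'u set \<Rightarrow> bool" where
  "band_in B \<longleftrightarrow>
     order_ideal_in B \<and> (\<forall>A s. A \<subseteq> B \<and> A \<noteq> {} \<and> is_lub (\<le>) L A s \<longrightarrow> s \<in> B)"

definition band_generated :: "'u \<Rightarrow> 'u set" where
  "band_generated x = \<Inter>{B. band_in B \<and> x \<in> B}"

end

definition upwards_directed :: "'u::order set \<Rightarrow> bool" where
  "upwards_directed A \<longleftrightarrow> (\<forall>a\<in>A. \<forall>b\<in>A. \<exists>c\<in>A. a \<le> c \<and> b \<le> c)"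

definition downwards_directed :: "'u::order set \<Rightarrow> bool" where
  "downwards_directed A \<longleftrightarrow> (\<forall>a\<in>A. \<forall>b\<in>A. \<exists>c\<in>A. c \<le> a \<and> c \<le> b)"

text \<open>
  Order continuity is the usual notion for positive operators: \<open>D \<down> 0\<close> implies \<open>T D \<down> 0\<close>
  (\<open>T D\<close> is downwards directed because \<open>T\<close> is monotone).
\<close>

definition order_continuous_on ::
    "'u::universally_complete_f_algebra set \<Rightarrow> ('u \<Rightarrow> 'u) \<Rightarrow> bool" where
  "order_continuous_on E T \<longleftrightarrow>
     (\<forall>D. D \<subseteq> E \<and> D \<noteq> {} \<and> downwards_directed D \<and> is_glb (\<le>) E D 0 \<longrightarrow>
          is_glb (\<le>) E (T ` D) 0)"

definition linear_from ::
    "'u::real_vector set \<Rightarrow> ('u \<Rightarrow> 'u) \<Rightarrow> bool" where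
  "linear_from L \<phi> \<longleftrightarrow>
     (\<forall>x\<in>L. \<forall>y\<in>L. \<phi> (x + y) = \<phi> x + \<phi> y) \<and> (\<forall>c. \<forall>x\<in>L. \<phi> (c *\<^sub>R x) = c *\<^sub>R \<phi> x)"

text \<open>
  \<open>T\<close> is a total function of type \<open>'u \<Rightarrow> 'u\<close>, but only its values on \<open>E\<close> matter; the range
  of \<open>T\<close> is \<open>T ` E\<close>.
\<close>

definition conditional_riesz_triple ::
    "'u::universally_complete_f_algebra set \<Rightarrow> 'u \<Rightarrow> ('u \<Rightarrow> 'u) \<Rightarrow> bool" where
  "conditional_riesz_triple E e T \<longleftrightarrow>
     riesz_subspace E \<and> dedekind_complete_in E \<and>
     e \<in> E \<and> 0 \<le> e \<and> band_generated E e = E \<and>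
     T \<in> E \<rightarrow> E \<and> linear_from E T \<and> (\<forall>f\<in>E. T (T f) = T f) \<and>
     (\<forall>f\<in>E. 0 < f \<longrightarrow> 0 < T f) \<and> order_continuous_on E T \<and> T e = e \<and>
     riesz_subspace (T ` E) \<and> dedekind_complete_in (T ` E)"

text \<open>
  The type \<open>'u\<close> is the universal completion of its order dense Riesz subspace \<open>E\<close>, with the
  multiplication whose unit is \<open>e\<close>.
\<close>

definition universal_completion_of ::
    "'u::universally_complete_f_algebra set \<Rightarrow> 'u \<Rightarrow> bool" where
  "universal_completion_of E e \<longleftrightarrow>
     riesz_subspace E \<and> order_dense E \<and> (\<forall>x. e * x = x \<and> x * e = x)"

definition T_universally_complete ::
    "'u::universally_complete_f_algebra set \<Rightarrow> ('u \<Rightarrow> 'u) \<Rightarrow> bool" where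
  "T_universally_complete E T \<longleftrightarrow>
     (\<forall>A. A \<subseteq> E \<and> A \<noteq> {} \<and> upwards_directed A \<and> bdd_above (T ` A) \<longrightarrow>
          (\<exists>s. is_lub (\<le>) E A s))"


section \<open>Function spaces with pointwise operations\<close>

text \<open>
  Charges and operators have a domain \<open>D\<close> that is a subset of \<open>'u\<close>; they are represented as
  functions that are \<^const>\<open>extensional\<close> on \<open>D\<close>, so that equality of functions is equality on \<open>D\<close>.
\<close>

definition fadd :: "'a set \<Rightarrow> ('a \<Rightarrow> 'u::plus) \<Rightarrow> ('a \<Rightarrow> 'u) \<Rightarrow> 'a \<Rightarrow> 'u" where
  "fadd D x y = (\<lambda>d\<in>D. x d + y d)"

definition fscale :: "'a set \<Rightarrow> real \<Rightarrow> ('a \<Rightarrow> 'u::real_vector) \<Rightarrow> 'a \<Rightarrow> 'u" where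
  "fscale D c x = (\<lambda>d\<in>D. c *\<^sub>R x d)"

definition fmult :: "'a set \<Rightarrow> 'u::times \<Rightarrow> ('a \<Rightarrow> 'u) \<Rightarrow> 'a \<Rightarrow> 'u" where
  "fmult D \<alpha> x = (\<lambda>d\<in>D. \<alpha> * x d)"

definition fun_riesz_space ::
    "'a set \<Rightarrow> (('a \<Rightarrow> 'u::real_vector) \<Rightarrow> ('a \<Rightarrow> 'u) \<Rightarrow> bool) \<Rightarrow> ('a \<Rightarrow> 'u) set \<Rightarrow> bool" where
  "fun_riesz_space D le X \<longleftrightarrow>
     X \<noteq> {} \<and> (\<forall>x\<in>X. \<forall>y\<in>X. fadd D x y \<in> X) \<and> (\<forall>c. \<forall>x\<in>X. fscale D c x \<in> X) \<and>
     (\<forall>x\<in>X. \<forall>y\<in>X. (\<exists>s. is_lub le X {x, y} s) \<and> (\<exists>s. is_glb le X {x, y} s))"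

definition fun_module ::
    "'u::ring set \<Rightarrow> 'a set \<Rightarrow> ('a \<Rightarrow> 'u) set \<Rightarrow> bool" where
  "fun_module R D X \<longleftrightarrow>
     X \<noteq> {} \<and> (\<forall>x\<in>X. \<forall>y\<in>X. fadd D x y \<in> X) \<and> (\<forall>\<alpha>\<in>R. \<forall>x\<in>X. fmult D \<alpha> x \<in> X)"

definition module_linear ::
    "'u::ring set \<Rightarrow> 'a set \<Rightarrow> ('a \<Rightarrow> 'u) set \<Rightarrow> 'b set \<Rightarrow> ('b \<Rightarrow> 'u) set \<Rightarrow>
      (('a \<Rightarrow> 'u) \<Rightarrow> ('b \<Rightarrow> 'u)) \<Rightarrow> bool" where
  "module_linear R D X D' Y h \<longleftrightarrow>
     fun_module R D X \<and> fun_module R D' Y \<and> h \<in> X \<rightarrow> Y \<and>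
     (\<forall>x\<in>X. \<forall>y\<in>X. h (fadd D x y) = fadd D' (h x) (h y)) \<and>
     (\<forall>\<alpha>\<in>R. \<forall>x\<in>X. h (fmult D \<alpha> x) = fmult D' \<alpha> (h x))"

definition riesz_isomorphism ::
    "'a set \<Rightarrow> (('a \<Rightarrow> 'u::real_vector) \<Rightarrow> ('a \<Rightarrow> 'u) \<Rightarrow> bool) \<Rightarrow> ('a \<Rightarrow> 'u) set \<Rightarrow>
     'b set \<Rightarrow> (('b \<Rightarrow> 'u) \<Rightarrow> ('b \<Rightarrow> 'u) \<Rightarrow> bool) \<Rightarrow> ('b \<Rightarrow> 'u) set \<Rightarrow>
      (('a \<Rightarrow> 'u) \<Rightarrow> ('b \<Rightarrow> 'u)) \<Rightarrow> bool" where
  "riesz_isomorphism D le X D' le' Y h \<longleftrightarrow>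
     fun_riesz_space D le X \<and> fun_riesz_space D' le' Y \<and> bij_betw h X Y \<and>
     (\<forall>x\<in>X. \<forall>y\<in>X. h (fadd D x y) = fadd D' (h x) (h y)) \<and>
     (\<forall>c. \<forall>x\<in>X. h (fscale D c x) = fscale D' c (h x)) \<and>
     (\<forall>x\<in>X. \<forall>y\<in>X. h (Lub le X {x, y}) = Lub le' Y {h x, h y}) \<and>
     (\<forall>x\<in>X. \<forall>y\<in>X. h (Glb le X {x, y}) = Glb le' Y {h x, h y})"


section \<open>The space \<open>L\<^sup>\<infinity>(T)\<close> and its strong dual\<close>

context
  fixes E :: "'u::universally_complete_f_algebra set" and T :: "'u \<Rightarrow> 'u"
begin

definition Linf :: "'u set" where
  "Linf = {f \<in> E. \<exists>g \<in> T ` E. 0 \<le> g \<and> \<bar>f\<bar> \<le> g}"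

definition Linf_norm :: "'u \<Rightarrow> 'u" where
  "Linf_norm f = Glb (\<le>) (T ` E) {\<alpha> \<in> T ` E. 0 \<le> \<alpha> \<and> \<bar>f\<bar> \<le> \<alpha>}"

definition positive_operator :: "('u \<Rightarrow> 'u) \<Rightarrow> bool" where
  "positive_operator P \<longleftrightarrow>
     P \<in> Linf \<rightarrow> T ` E \<and> linear_from Linf P \<and> (\<forall>f\<in>Linf. 0 \<le> f \<longrightarrow> 0 \<le> P f)"

definition Linf_dual :: "('u \<Rightarrow> 'u) set" where
  "Linf_dual = {\<phi> \<in> Linf \<rightarrow>\<^sub>E T ` E.
     (\<forall>f\<in>Linf. \<forall>g\<in>Linf. \<phi> (f + g) = \<phi> f + \<phi> g) \<and>
     (\<forall>\<alpha>\<in>T ` E. \<forall>f\<in>Linf. \<phi> (\<alpha> * f) = \<alpha> * \<phi> f) \<and>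
     (\<exists>P Q. positive_operator P \<and> positive_operator Q \<and> (\<forall>f\<in>Linf. \<phi> f = P f - Q f)) \<and>
     (\<exists>g\<in>T ` E. 0 \<le> g \<and> (\<forall>f\<in>Linf. \<bar>\<phi> f\<bar> \<le> g * Linf_norm f))}"

definition dual_le :: "('u \<Rightarrow> 'u) \<Rightarrow> ('u \<Rightarrow> 'u) \<Rightarrow> bool" where
  "dual_le \<phi> \<psi> \<longleftrightarrow> (\<forall>f\<in>Linf. 0 \<le> f \<longrightarrow> 0 \<le> \<psi> f - \<phi> f)"

definition dual_norm :: "('u \<Rightarrow> 'u) \<Rightarrow> 'u" where
  "dual_norm \<phi> =
     Glb (\<le>) (T ` E) {g \<in> T ` E. 0 \<le> g \<and> (\<forall>f\<in>Linf. \<bar>\<phi> f\<bar> \<le> g * Linf_norm f)}"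

end


section \<open>Charges and the integral\<close>

context
  fixes E :: "'u::universally_complete_f_algebra set" and e :: 'u and T :: "'u \<Rightarrow> 'u"
begin

definition components :: "'u set" where
  "components = {p \<in> E. inf p (e - p) = 0}"

definition signed_charge :: "('u \<Rightarrow> 'u) \<Rightarrow> bool" where
  "signed_charge \<mu> \<longleftrightarrow>
     \<mu> \<in> components \<rightarrow>\<^sub>E T ` E \<and> \<mu> 0 = 0 \<and>
     (\<forall>p\<in>components. \<forall>q\<in>components. inf p q = 0 \<longrightarrow> \<mu> (p + q) = \<mu> p + \<mu> q)"

definition charge :: "('u \<Rightarrow> 'u) \<Rightarrow> bool" where
  "charge \<mu> \<longleftrightarrow> signed_charge \<mu> \<and> (\<forall>p\<in>components. 0 \<le> \<mu> p)"

definition ba_C :: "('u \<Rightarrow> 'u) set" where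
  "ba_C = {\<mu>. signed_charge \<mu> \<and> (\<exists>g\<in>T ` E. 0 \<le> g \<and> (\<forall>p\<in>components. \<bar>\<mu> p\<bar> \<le> g))}"

definition ba_le :: "('u \<Rightarrow> 'u) \<Rightarrow> ('u \<Rightarrow> 'u) \<Rightarrow> bool" where
  "ba_le \<mu> \<nu> \<longleftrightarrow> charge (\<lambda>p\<in>components. \<nu> p - \<mu> p)"

text \<open>
  The positive part, negative part and modulus are the lattice operations of the Riesz space
  \<^term>\<open>ba_C\<close>; the zero charge is \<open>\<lambda>p\<in>components. 0\<close>.
\<close>

definition ba_neg :: "('u \<Rightarrow> 'u) \<Rightarrow> 'u \<Rightarrow> 'u" where
  "ba_neg \<mu> = (\<lambda>p\<in>components. - \<mu> p)"

definition ba_pos_part :: "('u \<Rightarrow> 'u) \<Rightarrow> 'u \<Rightarrow> 'u" where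
  "ba_pos_part \<mu> = Lub ba_le ba_C {\<mu>, \<lambda>p\<in>components. 0}"

definition ba_neg_part :: "('u \<Rightarrow> 'u) \<Rightarrow> 'u \<Rightarrow> 'u" where
  "ba_neg_part \<mu> = Lub ba_le ba_C {ba_neg \<mu>, \<lambda>p\<in>components. 0}"

definition ba_modulus :: "('u \<Rightarrow> 'u) \<Rightarrow> 'u \<Rightarrow> 'u" where
  "ba_modulus \<mu> = Lub ba_le ba_C {\<mu>, ba_neg \<mu>}"

definition ba_norm :: "('u \<Rightarrow> 'u) \<Rightarrow> 'u" where
  "ba_norm \<mu> = ba_modulus \<mu> e"

definition ba_T :: "('u \<Rightarrow> 'u) set" where
  "ba_T = {\<mu> \<in> ba_C. \<forall>p\<in>components. \<mu> p \<in> band_generated (T ` E) (T p)}"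

definition step_rep :: "nat \<Rightarrow> (nat \<Rightarrow> 'u) \<Rightarrow> (nat \<Rightarrow> 'u) \<Rightarrow> 'u \<Rightarrow> bool" where
  "step_rep n \<alpha> p x \<longleftrightarrow>
     (\<forall>i<n. \<alpha> i \<in> T ` E \<and> p i \<in> components) \<and>
     (\<forall>i<n. \<forall>j<n. i \<noteq> j \<longrightarrow> inf (p i) (p j) = 0) \<and>
     x = (\<Sum>i<n. \<alpha> i * p i)"

definition step_elements :: "'u set" where
  "step_elements = {x. \<exists>n \<alpha> p. step_rep n \<alpha> p x}"

definition step_integral :: "('u \<Rightarrow> 'u) \<Rightarrow> 'u \<Rightarrow> 'u" where
  "step_integral \<mu> x = (THE y. \<exists>n \<alpha> p. step_rep n \<alpha> p x \<and> y = (\<Sum>i<n. \<alpha> i * \<mu> (p i)))"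

definition pos_integral :: "('u \<Rightarrow> 'u) \<Rightarrow> 'u \<Rightarrow> 'u" where
  "pos_integral \<mu> f =
     Lub (\<le>) (T ` E) {step_integral \<mu> g | g. g \<in> step_elements \<and> 0 \<le> g \<and> g \<le> f}"

definition charge_integral :: "('u \<Rightarrow> 'u) \<Rightarrow> 'u \<Rightarrow> 'u" where
  "charge_integral \<mu> f =
     pos_integral (ba_pos_part \<mu>) (sup f 0) - pos_integral (ba_pos_part \<mu>) (sup (- f) 0)
     - pos_integral (ba_neg_part \<mu>) (sup f 0) + pos_integral (ba_neg_part \<mu>) (sup (- f) 0)"

definition Phi :: "('u \<Rightarrow> 'u) \<Rightarrow> 'u \<Rightarrow> 'u" where
  "Phi \<mu> = (\<lambda>f\<in>Linf E T. charge_integral \<mu> f)"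

definition Psi :: "('u \<Rightarrow> 'u) \<Rightarrow> 'u \<Rightarrow> 'u" where
  "Psi \<phi> = restrict \<phi> components"

end

end

theory Submission
  imports Defs
begin

text \<open>
  A positive charge integrates step elements \<open>\<Sum> \<alpha>\<^sub>i p\<^sub>i\<close>. If such a sum is positive, then so is its integral:
  splitting along the \<open>p\<^sub>i\<close> reduces this to \<open>\<gamma> p \<ge> 0\<close>, and there \<open>T\<close>-absolute continuity says that
  \<open>\<mu> p\<close> is disjoint from everything in the range of \<open>T\<close> that is disjoint from \<open>p\<close> (which is the
  same as being disjoint from \<open>T p\<close>, as \<open>T\<close> is strictly positive and fixes \<open>e\<close>). Binary expansion
  approximates \<open>0 \<le> f \<le> \<beta>\<close> by step elements up to \<open>\<beta> / 2\<^sup>n\<close>, which makes the integral additive and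
  a bounded functional on \<open>L\<^sup>\<infinity>(T)\<close> positive as soon as it is positive on components. Hence the
  restriction \<open>\<Psi>\<close> is injective and reflects the order. As \<open>\<Psi> \<circ> \<Phi>\<close> is the identity, \<open>\<Phi>\<close> is the
  inverse of \<open>\<Psi>\<close> and inherits its linearity.

  Multiplication in the range of \<open>T\<close> comes from \<open>a\<^sup>2 = sup {2 t a - t\<^sup>2 e | t \<in> \<real>}\<close>, since that range
  is closed under the suprema that exist in the universal completion.
\<close>

section \<open>Disjointness in vector lattices and f-algebras\<close>

text \<open>The universal completion is given abstractly: there is no representation by functions,
  commutativity is not an axiom, and neither the ideal property of \<open>E\<close> nor closure of
  the range of \<open>T\<close> under products is given. Pointwise arguments become Archimedean
  ones, and the components of \<open>e\<close>, which are its idempotents, stand in for sets.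

  Absolute continuity is forced by the coefficients. In \<alpha> p the coefficient \<alpha> is
  determined only where p lives, so \<alpha> \<mu>(p) makes sense only if \<mu>(p) ignores
  everything disjoint from p. Conversely, a functional \<phi> that is linear over the range of
  \<open>T\<close> has d \<phi>(p) = \<phi>(d p) = 0 as soon as d p = 0.

  Passing from \<mu> to its positive part is not additive, so linearity is awkward to read off the
  definition of the integral, while restriction is visibly linear. The lattice structure of the dual
  is not constructed either: it is transported from the charges, where suprema of pairs have an
  explicit formula. For the isometry the test elements are q - (e - q): their modulus is at most e,
  and the supremum of their integrals is the total variation.\<close>

declare neg_inf_eq_sup [simp del] and neg_sup_eq_inf [simp del]
  and diff_inf_eq_sup [simp del] and diff_sup_eq_inf [simp del]

lemma disjoint_mono:
  fixes a :: "'a::lattice_ab_group_add"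
  assumes "inf a b = 0" "0 \<le> c" "c \<le> a"
  shows "inf c b = 0"
proof (rule antisym)
  show "inf c b \<le> 0" using inf_mono[OF assms(3) order_refl, of b] assms(1) by simp
  have "0 \<le> b" using inf_le2[of a b] assms(1) by simp
  then show "0 \<le> inf c b" using assms(2) by simp
qed

lemma disjoint_add:
  fixes a :: "'a::lattice_ab_group_add"
  assumes "inf a c = 0" "inf b c = 0"
  shows "inf (a + b) c = 0"
proof (rule antisym)
  have a: "0 \<le> a" and c: "0 \<le> c" and b: "0 \<le> b"
    using assms inf_le1[of a c] inf_le2[of a c] inf_le1[of b c] by auto
  let ?x = "inf (a + b) c"
  have "?x - b \<le> a" by (simp add: diff_le_eq)
  moreover have "?x - b \<le> c"
    using b by (simp add: diff_le_eq le_infI2)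
  ultimately have "?x - b \<le> inf a c" by simp
  then have "?x \<le> b" using assms by simp
  then have "?x \<le> inf b c" by (meson inf_le2 le_infI)
  then show "?x \<le> 0" using assms by simp
  show "0 \<le> ?x" using a b c by simp
qed

lemma disjoint_scaleR:
  fixes a :: "'a::{lattice_ab_group_add,ordered_real_vector}"
  assumes "inf a c = 0" "0 \<le> r"
  shows "inf (r *\<^sub>R a) c = 0"
proof -
  have a: "0 \<le> a" and c: "0 \<le> c" using assms inf_le1[of a c] inf_le2[of a c] by auto
  have n: "inf (real n *\<^sub>R a) c = 0" for n
  proof (induction n)
    case 0 then show ?case using c by (simp add: inf_absorb1)
  next
    case (Suc n) then show ?case using disjoint_add[OF assms(1) Suc] by (simp add: scaleR_add_left)
  qed
  obtain n where "r \<le> real n" using real_arch_simple by blast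
  then show ?thesis using a assms(2)
    by (intro disjoint_mono[OF n[of n]] scaleR_right_mono scaleR_nonneg_nonneg)
qed

lemma disjoint_add_le:
  fixes a :: "'a::lattice_ab_group_add"
  assumes "inf a b = 0" "a \<le> u" "b \<le> u"
  shows "a + b \<le> u"
  using assms add_eq_inf_sup[of a b] by simp

lemma pprt_disjoint:
  fixes x :: "'a::lattice_ab_group_add"
  shows "inf (pprt x) (pprt (- x)) = 0"
proof -
  have "pprt x = x + pprt (- x)" by (metis add_diff_cancel_right' diff_add_cancel pprt_neg prts diff_minus_eq_add)
  then have "inf (pprt x) (pprt (- x)) = pprt (- x) + inf x 0"
    by (simp add: add_inf_distrib_left add.commute)
  also have "\<dots> = 0" by (simp add: pprt_neg nprt_def)
  finally show ?thesis .
qed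

lemma pprt_diff: "pprt x - pprt (- x) = (x :: 'a::lattice_ab_group_add)"
  by (metis pprt_neg prts diff_minus_eq_add)

lemma abs_eq_pprt: "\<bar>x\<bar> = pprt x + pprt (- x :: 'a::lattice_ab_group_add_abs)"
  by (simp add: abs_prts pprt_neg)

lemma pprt_diff_le:
  fixes a :: "'a::lattice_ab_group_add"
  assumes "0 \<le> a" "0 \<le> b" shows "pprt (a - b) \<le> a"
  using assms by (simp add: pprt_def)

text \<open>One move of a grid argument, from a grid point to the next at distance
  \<open>\<delta>\<close>. With \<open>A\<close> the right-hand side, the two entries of the infimum
  are below \<open>A + pprt x\<close> and \<open>A + pprt (- x)\<close>; these positive parts are
  disjoint, so the infimum is at most \<open>A\<close>.\<close>

lemma inf_add_pprt_abs_le: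
  fixes x :: "'a::lattice_ab_group_add_abs"
  assumes "0 \<le> \<delta>" "0 \<le> r"
  shows "inf (\<delta> + pprt x + r) \<bar>x - \<delta>\<bar> \<le> \<delta> + pprt (x - \<delta>) + r"
proof -
  let ?A = "\<delta> + r + pprt (x - \<delta>)"
  have 1: "\<delta> + pprt x + r \<le> ?A + pprt x" by (simp add: algebra_simps)
  have "\<delta> - x \<le> \<delta> + pprt (- x)" by (simp add: pprt_def)
  then have "pprt (\<delta> - x) \<le> \<delta> + pprt (- x)"
    using assms unfolding pprt_def[of "\<delta> - x"] by simp
  then have "\<bar>x - \<delta>\<bar> \<le> pprt (x - \<delta>) + (\<delta> + pprt (- x))"
    by (simp add: abs_eq_pprt[of "x - \<delta>"])
  also have "\<dots> \<le> ?A + pprt (- x)" using assms by (simp add: algebra_simps)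
  finally have "\<bar>x - \<delta>\<bar> \<le> ?A + pprt (- x)" .
  with 1 have "inf (\<delta> + pprt x + r) \<bar>x - \<delta>\<bar> \<le> inf (?A + pprt x) (?A + pprt (- x))"
    by (rule inf_mono)
  also have "\<dots> = ?A" by (simp add: add_inf_distrib_left[symmetric] pprt_disjoint)
  finally show ?thesis by (simp add: algebra_simps)
qed

text \<open>The remainders \<open>a - inf a b\<close> and \<open>b - inf a b\<close> are disjoint,
  and applying \<open>\<pi>\<close> to one argument at a time keeps them so; additivity then
  restores \<open>\<pi> (inf a b)\<close>. The map is abstract because it has to cover both
  multiplication by a positive element and the sum \<open>a * x + x * a\<close>.\<close>

lemma orthomorphism_inf:
  fixes \<pi> :: "'a::lattice_ab_group_add \<Rightarrow> 'a"
  assumes add: "\<And>x y. \<pi> (x + y) = \<pi> x + \<pi> y"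
    and ortho: "\<And>x y. inf x y = 0 \<Longrightarrow> inf (\<pi> x) y = 0"
  shows "\<pi> (inf a b) = inf (\<pi> a) (\<pi> b)"
proof -
  let ?m = "inf a b"
  have d: "inf (a - ?m) (b - ?m) = 0"
    using add_inf_distrib_right[of a b "- ?m"] by (simp only: diff_conv_add_uminus right_minus)
  have "inf (\<pi> (a - ?m)) (\<pi> (b - ?m)) = 0"
    using ortho[OF d] ortho by (metis inf_commute)
  moreover have "\<pi> (x - y) = \<pi> x - \<pi> y" for x y
    using add[of "x - y" y] by simp
  ultimately have "inf (\<pi> a - \<pi> ?m) (\<pi> b - \<pi> ?m) = 0" by simp
  then show ?thesis
    using add_inf_distrib_right[of "\<pi> a" "\<pi> b" "- \<pi> ?m"]
    by (simp only: diff_conv_add_uminus) (metis add.inverse_inverse add_eq_0_iff2)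
qed

lemma orthomorphism_mono:
  fixes \<pi> :: "'a::lattice_ab_group_add \<Rightarrow> 'a"
  assumes add: "\<And>x y. \<pi> (x + y) = \<pi> x + \<pi> y"
    and ortho: "\<And>x y. inf x y = 0 \<Longrightarrow> inf (\<pi> x) y = 0"
    and "a \<le> b"
  shows "\<pi> a \<le> \<pi> b"
  using orthomorphism_inf[of \<pi> a b, OF add ortho] assms(3) by (simp add: inf_absorb1 le_iff_inf)

text \<open>Each of the two f-algebra laws moves one factor across: from \<open>a\<close> disjoint
  from \<open>b\<close> to \<open>a * b\<close> disjoint from \<open>b\<close>, and then to
  \<open>a * b\<close> disjoint from itself.\<close>

lemma disjoint_mult_eq_0:
  fixes a :: "'a::f_algebra"
  assumes "inf a b = 0"
  shows "a * b = 0"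
proof -
  have a: "0 \<le> a" and b: "0 \<le> b" using assms inf_le1[of a b] inf_le2[of a b] by auto
  have "inf b (a * b) = 0" using f_algebra_right[OF assms b] by (simp add: inf_commute)
  from f_algebra_left[OF this a] show ?thesis by simp
qed

lemma square_nonneg:
  fixes a :: "'a::f_algebra"
  shows "0 \<le> a * a"
proof -
  have "a * a = (pprt a - pprt (- a)) * (pprt a - pprt (- a))" by (simp only: pprt_diff)
  also have "\<dots> = pprt a * pprt a + pprt (- a) * pprt (- a)"
    using disjoint_mult_eq_0[OF pprt_disjoint[of a]] disjoint_mult_eq_0[OF pprt_disjoint[of "- a"]]
    by (simp add: algebra_simps)
  finally show ?thesis by simp
qed

lemma mult_inf_distrib_left:
  fixes c :: "'a::f_algebra"
  assumes "0 \<le> c" shows "c * inf a b = inf (c * a) (c * b)"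
  by (rule orthomorphism_inf) (use assms in \<open>auto simp: distrib_left f_algebra_left\<close>)

section \<open>Conditionally complete f-algebras\<close>

text \<open>The multiples of \<open>x\<close> have a supremum, and the index shift from
  \<open>n\<close> to \<open>Suc n\<close> shows that subtracting \<open>x\<close> from it leaves an
  upper bound.\<close>

lemma archimedean:
  fixes x :: "'u::universally_complete_f_algebra"
  assumes "\<And>n. real n *\<^sub>R x \<le> y"
  shows "x \<le> 0"
proof -
  let ?S = "range (\<lambda>n. real n *\<^sub>R x)"
  have b: "bdd_above ?S" using assms by (auto intro!: bdd_aboveI[of _ y])
  have "Sup ?S \<le> Sup ?S - x"
  proof (rule cSup_least)
    fix z assume "z \<in> ?S"
    then obtain n where z: "z = real n *\<^sub>R x" by auto
    have "real (Suc n) *\<^sub>R x \<le> Sup ?S" using b by (intro cSup_upper rangeI)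
    then show "z \<le> Sup ?S - x" by (simp add: z scaleR_add_left le_diff_eq add.commute)
  qed auto
  then show ?thesis by simp
qed

lemma archimedean_eps:
  fixes x :: "'u::universally_complete_f_algebra"
  assumes "\<And>\<epsilon>. 0 < \<epsilon> \<Longrightarrow> x \<le> \<epsilon> *\<^sub>R y"
  shows "x \<le> 0"
proof (rule archimedean)
  fix n
  \<comment> \<open>For \<open>n = 0\<close> the bound has to be nonnegative, which \<open>y\<close>
    itself need not be.\<close>
  show "real n *\<^sub>R x \<le> sup y 0"
  proof (cases n)
    case (Suc m)
    have "real n *\<^sub>R x \<le> real n *\<^sub>R ((1 / real n) *\<^sub>R y)"
      using Suc by (intro scaleR_left_mono assms) auto
    also have "\<dots> = y" using Suc by simp
    finally show ?thesis by (simp add: le_supI1)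
  qed simp
qed

lemma archimedean_power_half:
  fixes x :: "'u::universally_complete_f_algebra"
  assumes "\<And>n. x \<le> ((1/2)^n) *\<^sub>R y" "0 \<le> y"
  shows "x \<le> 0"
proof (rule archimedean_eps)
  fix \<epsilon> :: real assume "0 < \<epsilon>"
  then obtain n where "(1/2)^n < \<epsilon>" using real_arch_pow_inv[of \<epsilon> "1/2"] by auto
  then have "((1/2)^n) *\<^sub>R y \<le> \<epsilon> *\<^sub>R y" using assms(2) by (intro scaleR_right_mono) auto
  then show "x \<le> \<epsilon> *\<^sub>R y" using assms(1)[of n] by simp
qed

text \<open>The overlap \<open>?x\<close> of the supremum with \<open>d\<close> is disjoint from
  each \<open>pprt a\<close>, and both lie below \<open>?s\<close>. Hence so does their sum, and
  \<open>?s - ?x\<close> still dominates \<open>A\<close>, which leaves no room for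
  \<open>?x\<close>.\<close>

lemma disjoint_cSup:
  fixes d :: "'u::universally_complete_f_algebra"
  assumes A: "A \<noteq> {}" "bdd_above A" and d: "0 \<le> d" and disj: "\<And>a. a \<in> A \<Longrightarrow> inf (pprt a) d = 0"
  shows "inf (pprt (Sup A)) d = 0"
proof -
  let ?s = "pprt (Sup A)" let ?x = "inf ?s d"
  have x: "0 \<le> ?x" using d by simp
  have le: "pprt a + ?x \<le> ?s" if "a \<in> A" for a
  proof (rule disjoint_add_le)
    have "inf ?x (pprt a) = 0"
      by (rule disjoint_mono[of d]) (use disj[OF that] x in \<open>auto simp: inf_commute\<close>)
    then show "inf (pprt a) ?x = 0" by (simp add: inf_commute)
    show "pprt a \<le> ?s" using that A by (simp add: cSup_upper)
  qed simp
  have "Sup A \<le> ?s - ?x"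
  proof (rule cSup_least[OF A(1)])
    fix a assume "a \<in> A"
    have "a \<le> pprt a" by (simp add: pprt_def)
    also have "\<dots> \<le> ?s - ?x" using le[OF \<open>a \<in> A\<close>] by (simp add: le_diff_eq)
    finally show "a \<le> ?s - ?x" .
  qed
  moreover have "0 \<le> ?s - ?x" by (simp only: diff_ge_0_iff_ge inf_le1)
  ultimately have "?s \<le> ?s - ?x" unfolding pprt_def[of "Sup A"] by simp
  then have "?x \<le> 0" by (simp only: le_diff_eq) (metis add_le_same_cancel1)
  then show ?thesis using x by (rule antisym)
qed

text \<open>For nonnegative \<open>a\<close> and \<open>b\<close> this is the projection of
  \<open>a\<close> onto the principal band generated by \<open>b\<close>.\<close>

definition band_part :: "'u::universally_complete_f_algebra \<Rightarrow> 'u \<Rightarrow> 'u" where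
  "band_part a b = (SUP n::nat. inf a (real n *\<^sub>R b))"

lemma band_part_bdd: "bdd_above (range (\<lambda>n::nat. inf a (real n *\<^sub>R b)))"
  for a :: "'u::universally_complete_f_algebra"
  by (rule bdd_aboveI[of _ a]) auto

lemma band_part_upper: "inf a (real n *\<^sub>R b) \<le> band_part a b"
  unfolding band_part_def by (rule cSUP_upper[OF _ band_part_bdd]) simp

lemma band_part_le: "band_part a b \<le> a"
  unfolding band_part_def by (rule cSUP_least) auto

lemma band_part_nonneg:
  assumes "0 \<le> a" "0 \<le> b" shows "0 \<le> band_part a b"
  using band_part_upper[of a 0 b] assms by (simp add: inf_absorb2)

text \<open>The overlap \<open>?y\<close> of the remainder with \<open>b\<close> can be added to any
  term of the supremum at the price of raising \<open>n\<close> by one, so adding it does not lead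
  above the supremum.\<close>

lemma disjoint_diff_band_part:
  fixes a :: "'u::universally_complete_f_algebra"
  assumes a: "0 \<le> a" and b: "0 \<le> b"
  shows "inf (a - band_part a b) b = 0"
proof -
  let ?s = "band_part a b" let ?y = "inf (a - ?s) b"
  have y: "0 \<le> ?y" using b band_part_le[of a b] by simp
  have "(SUP n::nat. inf a (real n *\<^sub>R b)) \<le> ?s - ?y"
  proof (rule cSUP_least)
    fix n :: nat
    have "inf a (real n *\<^sub>R b) + ?y \<le> ?s + (a - ?s)"
      by (intro add_mono band_part_upper inf_le1)
    moreover have "inf a (real n *\<^sub>R b) + ?y \<le> real n *\<^sub>R b + b"
      by (intro add_mono inf_le1 inf_le2)
    ultimately have "inf a (real n *\<^sub>R b) + ?y \<le> inf a (real (Suc n) *\<^sub>R b)"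
      by (simp add: scaleR_add_left add.commute)
    also have "\<dots> \<le> ?s" by (rule band_part_upper)
    finally show "inf a (real n *\<^sub>R b) \<le> ?s - ?y" by (simp only: le_diff_eq)
  qed simp
  then have "?s \<le> ?s - ?y" by (simp only: band_part_def)
  then have "?y \<le> 0" by (simp only: le_diff_eq) (metis add_le_same_cancel1)
  then show ?thesis using y by (rule antisym)
qed

lemma band_part_disjoint:
  fixes a :: "'u::universally_complete_f_algebra"
  assumes "0 \<le> a" "0 \<le> b" "inf b d = 0"
  shows "inf (band_part a b) d = 0"
proof -
  have d: "0 \<le> d" using assms(3) inf_le2[of b d] by simp
  have "inf (pprt (band_part a b)) d = 0"
    unfolding band_part_def
  proof (rule disjoint_cSup[OF _ band_part_bdd d])
    fix c assume "c \<in> range (\<lambda>n::nat. inf a (real n *\<^sub>R b))"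
    then obtain n :: nat where c: "c = inf a (real n *\<^sub>R b)" by auto
    have c0: "0 \<le> c" using assms by (simp add: c scaleR_nonneg_nonneg)
    have "inf c d = 0"
      by (rule disjoint_mono[OF disjoint_scaleR[OF assms(3), of "real n"]]) (use c0 c in auto)
    then show "inf (pprt c) d = 0" using c0 by simp
  qed simp
  then show ?thesis using band_part_nonneg[OF assms(1,2)] by simp
qed

lemma band_part_eq:
  fixes a :: "'u::universally_complete_f_algebra"
  assumes "0 \<le> a" "0 \<le> b" "inf (a - band_part a b) a = 0"
  shows "band_part a b = a"
  using assms(3) band_part_nonneg[OF assms(1,2)] by (simp add: inf_absorb1)

section \<open>The unital case\<close>

locale unital_f_algebra =
  fixes e :: "'u::universally_complete_f_algebra"
  assumes unit [simp]: "e * x = x" "x * e = x"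
begin

lemma unit_nonneg [simp]: "0 \<le> e"
  using square_nonneg[of e] by simp

text \<open>Multiplying \<open>e\<close> by \<open>z\<close> preserves disjointness from
  \<open>z\<close> and turns \<open>e\<close> into \<open>z\<close>. Thus the algebraic unit is a
  weak order unit of the whole algebra.\<close>

lemma disjoint_unit_eq_0:
  assumes "inf z e = 0" shows "z = 0"
proof -
  have z: "0 \<le> z" using assms inf_le1[of z e] by simp
  from f_algebra_left[OF assms[unfolded inf_commute[of z]] z] show ?thesis by simp
qed

text \<open>The infimum \<open>?x\<close> squares to 0, so the square of \<open>e - n ?x\<close> is
  \<open>e - 2 n ?x\<close>. As squares are nonnegative, all multiples of \<open>?x\<close> stay
  below \<open>e\<close>.\<close>

lemma disjoint_if_mult_eq_0:
  fixes a :: 'u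
  assumes "0 \<le> a" "0 \<le> b" "a * b = 0"
  shows "inf a b = 0"
proof -
  let ?x = "inf a b"
  have x: "0 \<le> ?x" using assms by simp
  have "?x * ?x \<le> a * b" by (intro mult_mono x assms inf_le1 inf_le2)
  then have xx: "?x * ?x = 0" using square_nonneg[of ?x] assms(3) by (intro antisym) auto
  have "real n *\<^sub>R (2 *\<^sub>R ?x) \<le> e" for n
  proof -
    have "0 \<le> (e - real n *\<^sub>R ?x) * (e - real n *\<^sub>R ?x)" by (rule square_nonneg)
    also have "\<dots> = e - real n *\<^sub>R (2 *\<^sub>R ?x)"
      by (simp add: left_diff_distrib right_diff_distrib xx scaleR_2 scaleR_right_distrib)
    finally show ?thesis by simp
  qed
  then have "2 *\<^sub>R ?x \<le> 0" by (rule archimedean)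
  then have "?x \<le> 0" using scaleR_left_mono[of "2 *\<^sub>R ?x" 0 "1/2"] by simp
  then show ?thesis using x by (rule antisym)
qed

text \<open>For real functions the hypothesis at \<open>t = b(\<omega>)\<close> gives \<open>z(\<omega>) \<le> 0\<close>. Here \<open>t\<close> runs
  through a fine finite grid in \<open>[-M, M]\<close> instead, which shows that \<open>z\<close> vanishes where
  \<open>\<bar>b\<bar> < M\<close>.\<close>

lemma eq_0_if_le_orthomorphism:
  fixes \<pi> :: "'u \<Rightarrow> 'u"
  assumes add: "\<And>x y. \<pi> (x + y) = \<pi> x + \<pi> y"
    and scale: "\<And>r x. \<pi> (r *\<^sub>R x) = r *\<^sub>R \<pi> x"
    and ortho: "\<And>x y. inf x y = 0 \<Longrightarrow> inf (\<pi> x) y = 0"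
    and z: "0 \<le> z" and le: "\<And>t. z \<le> \<pi> \<bar>b - t *\<^sub>R e\<bar>"
  shows "z = 0"
proof -
  have mono: "\<pi> x \<le> \<pi> y" if "x \<le> y" for x y
    by (rule orthomorphism_mono[of \<pi>, OF _ _ that]) (fact add ortho)+
  \<comment> \<open>Invariant after using the grid points from \<open>s\<close> to
    \<open>s + n * \<epsilon>\<close>: the bound adds up the distance to the right of the last
    point, the distance to the left of \<open>s\<close>, and \<open>\<epsilon>\<close> for the gaps
    in between.\<close>
  have grid: "z \<le> \<pi> (\<epsilon> *\<^sub>R e + pprt (b - (s + real n * \<epsilon>) *\<^sub>R e) + pprt (s *\<^sub>R e - b))"
    if "0 \<le> \<epsilon>" for \<epsilon> s n
  proof (induction n)
    case 0
    have "\<bar>b - s *\<^sub>R e\<bar> \<le> \<epsilon> *\<^sub>R e + pprt (b - s *\<^sub>R e) + pprt (s *\<^sub>R e - b)"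
      using that by (simp add: abs_eq_pprt scaleR_nonneg_nonneg)
    then show ?case using order_trans[OF le mono] by simp
  next
    case (Suc n)
    let ?x = "b - (s + real n * \<epsilon>) *\<^sub>R e" let ?r = "pprt (s *\<^sub>R e - b)"
    have t: "b - (s + real (Suc n) * \<epsilon>) *\<^sub>R e = ?x - \<epsilon> *\<^sub>R e"
      by (simp add: algebra_simps)
    have "z \<le> \<pi> \<bar>?x - \<epsilon> *\<^sub>R e\<bar>" using le[of "s + real (Suc n) * \<epsilon>"] by (simp only: t)
    with Suc have "z \<le> inf (\<pi> (\<epsilon> *\<^sub>R e + pprt ?x + ?r)) (\<pi> \<bar>?x - \<epsilon> *\<^sub>R e\<bar>)" by simp
    also have "\<dots> = \<pi> (inf (\<epsilon> *\<^sub>R e + pprt ?x + ?r) \<bar>?x - \<epsilon> *\<^sub>R e\<bar>)"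
      by (rule orthomorphism_inf[symmetric]) (fact add ortho)+
    also have "\<dots> \<le> \<pi> (\<epsilon> *\<^sub>R e + pprt (?x - \<epsilon> *\<^sub>R e) + ?r)"
      using that by (intro mono inf_add_pprt_abs_le scaleR_nonneg_nonneg) auto
    finally show ?case by (simp only: t)
  qed
  have \<pi>e: "0 \<le> \<pi> e" using mono[of 0 e] add[of 0 0] by simp
  have disj: "inf z (pprt (M *\<^sub>R e - \<bar>b\<bar>)) = 0" if "0 < M" for M
  proof -
    let ?c = "pprt (M *\<^sub>R e - \<bar>b\<bar>)" let ?z = "inf z ?c"
    \<comment> \<open>\<open>?w\<close> is the distance of \<open>b\<close> from the interval
      between -M and M, and \<open>?c\<close> is the depth of \<open>\<bar>b\<bar>\<close> below M.
      They are disjoint, so \<open>\<pi> ?w\<close> contributes nothing to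
      \<open>?z\<close>.\<close>
    let ?w = "pprt (b - M *\<^sub>R e) + pprt ((- M) *\<^sub>R e - b)"
    have d: "inf (pprt (\<bar>b\<bar> - M *\<^sub>R e)) ?c = 0"
      using pprt_disjoint[of "\<bar>b\<bar> - M *\<^sub>R e"] by simp
    have "inf ?w ?c = 0"
      by (intro disjoint_add disjoint_mono[OF d] pprt_mono zero_le_pprt)
        (auto simp: abs_ge_self abs_ge_minus_self)
    then have w: "inf (\<pi> ?w) ?c = 0" by (rule ortho)
    have "?z \<le> \<epsilon> *\<^sub>R \<pi> e" if \<epsilon>: "0 < \<epsilon>" for \<epsilon>
    proof -
      \<comment> \<open>With so many points a grid of mesh \<open>\<epsilon>\<close> that starts at
        -M reaches M.\<close>
      obtain n where n: "2 * M / \<epsilon> \<le> real n" using real_arch_simple by blast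
      then have "M \<le> - M + real n * \<epsilon>" using \<epsilon> by (simp add: field_simps)
      then have "pprt (b - (- M + real n * \<epsilon>) *\<^sub>R e) \<le> pprt (b - M *\<^sub>R e)"
        by (intro pprt_mono diff_left_mono scaleR_right_mono) auto
      then have "\<epsilon> *\<^sub>R e + pprt (b - (- M + real n * \<epsilon>) *\<^sub>R e) + pprt ((- M) *\<^sub>R e - b) \<le> \<epsilon> *\<^sub>R e + ?w"
        unfolding add.assoc by (intro add_left_mono add_right_mono)
      from order_trans[OF grid mono[OF this]] \<epsilon> have "z \<le> \<epsilon> *\<^sub>R \<pi> e + \<pi> ?w"
        by (simp add: add[of "\<epsilon> *\<^sub>R e"] scale)
      then have "?z - \<epsilon> *\<^sub>R \<pi> e \<le> \<pi> ?w" by (simp add: algebra_simps le_infI1)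
      moreover have "?z - \<epsilon> *\<^sub>R \<pi> e \<le> ?c"
        using \<epsilon> \<pi>e by (simp add: diff_le_eq le_infI2 scaleR_nonneg_nonneg add_increasing2)
      ultimately have "?z - \<epsilon> *\<^sub>R \<pi> e \<le> inf (\<pi> ?w) ?c" by simp
      then show ?thesis by (simp only: w diff_le_0_iff_le)
    qed
    then have "?z \<le> 0" by (rule archimedean_eps)
    moreover have "0 \<le> ?z" using z by simp
    ultimately show ?thesis by (rule antisym)
  qed
  let ?y = "inf z e"
  have y: "0 \<le> ?y" using z by simp
  \<comment> \<open>By now \<open>z\<close> vanishes where \<open>\<bar>b\<bar>\<close> is below n,
    for every positive n. The truncation \<open>?y\<close> is at most \<open>e\<close>, so the
    excess of n \<open>?y\<close> over \<open>\<bar>b\<bar>\<close> lies below both n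
    \<open>?y\<close> and \<open>?c\<close>; these are disjoint, and there is no excess.\<close>
  have "real n *\<^sub>R ?y \<le> \<bar>b\<bar>" for n
  proof (cases "n = 0")
    case False
    let ?M = "real n" let ?c = "pprt (?M *\<^sub>R e - \<bar>b\<bar>)"
    have "inf ?y ?c = 0"
      by (rule disjoint_mono[OF disj]) (use False y in auto)
    then have d: "inf (?M *\<^sub>R ?y) ?c = 0" by (rule disjoint_scaleR) simp
    have "pprt (?M *\<^sub>R ?y - \<bar>b\<bar>) \<le> ?M *\<^sub>R ?y"
      using y by (intro pprt_diff_le scaleR_nonneg_nonneg) auto
    moreover have "pprt (?M *\<^sub>R ?y - \<bar>b\<bar>) \<le> ?c"
      by (intro pprt_mono diff_right_mono scaleR_left_mono) auto
    ultimately have "pprt (?M *\<^sub>R ?y - \<bar>b\<bar>) \<le> inf (?M *\<^sub>R ?y) ?c" by (rule inf_greatest)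
    then have "pprt (?M *\<^sub>R ?y - \<bar>b\<bar>) \<le> 0" by (simp only: d)
    then have "?M *\<^sub>R ?y - \<bar>b\<bar> \<le> 0" unfolding pprt_def by simp
    then show ?thesis by simp
  qed simp
  then have "?y \<le> 0" by (rule archimedean)
  then have "?y = 0" using y by (rule antisym)
  then show ?thesis by (rule disjoint_unit_eq_0)
qed

text \<open>The commutator of \<open>a\<close> and \<open>b\<close> does not change when a real
  multiple of \<open>e\<close> is subtracted from \<open>b\<close>. For \<open>0 \<le> a\<close> it
  is therefore bounded by \<open>a * x + x * a\<close> at x = \<open>\<bar>b - t e\<bar>\<close> for
  every real t, which forces it to be 0.\<close>

lemma mult_commute: "a * b = b * a" for a :: 'u
proof -
  have pos: "a * b = b * a" if a: "0 \<le> a" for a b :: 'u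
  proof -
    have "\<bar>a * b - b * a\<bar> = 0"
    proof (rule eq_0_if_le_orthomorphism[of "\<lambda>x. a * x + x * a"])
      fix t
      have "a * b - b * a = a * (b - t *\<^sub>R e) - (b - t *\<^sub>R e) * a"
        by (simp add: algebra_simps)
      also have "\<bar>\<dots>\<bar> \<le> \<bar>a * (b - t *\<^sub>R e)\<bar> + \<bar>(b - t *\<^sub>R e) * a\<bar>" by (rule abs_triangle_ineq4)
      also have "\<dots> \<le> \<bar>a\<bar> * \<bar>b - t *\<^sub>R e\<bar> + \<bar>b - t *\<^sub>R e\<bar> * \<bar>a\<bar>"
        by (intro add_mono abs_le_mult)
      finally show "\<bar>a * b - b * a\<bar> \<le> a * \<bar>b - t *\<^sub>R e\<bar> + \<bar>b - t *\<^sub>R e\<bar> * a"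
        using a by simp
      show "inf (a * x + x * a) y = 0" if "inf x y = 0" for x y
        using that a by (intro disjoint_add f_algebra_left f_algebra_right)
    qed (auto simp: algebra_simps)
    then show ?thesis by simp
  qed
  have "a * b = (pprt a - pprt (- a)) * b" by (simp only: pprt_diff)
  also have "\<dots> = b * (pprt a - pprt (- a))"
    by (simp only: left_diff_distrib right_diff_distrib pos zero_le_pprt)
  finally show ?thesis by (simp only: pprt_diff)
qed

lemma mult_left_commute: "a * (b * c) = b * (a * c)" for a :: 'u
  by (metis mult.assoc mult_commute)

lemmas mult_ac = mult.assoc mult_commute mult_left_commute

lemma abs_mult_self: "\<bar>a\<bar> * \<bar>a\<bar> = a * a" for a :: 'u
proof -
  have "a * a = (pprt a - pprt (- a)) * (pprt a - pprt (- a))" by (simp only: pprt_diff)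
  then show ?thesis
    using disjoint_mult_eq_0[OF pprt_disjoint[of a]] disjoint_mult_eq_0[OF pprt_disjoint[of "- a"]]
    by (simp add: abs_eq_pprt algebra_simps)
qed

text \<open>After subtracting \<open>x\<close>, the two entries are \<open>x * (x - e)\<close> and
  \<open>e - x\<close>. They are dominated by \<open>x * pprt (x - e)\<close> and
  \<open>pprt (e - x)\<close>, which are disjoint.\<close>

lemma inf_square_unit_le:
  assumes "0 \<le> x" shows "inf (x * x) e \<le> x"
proof -
  have d: "inf (x * pprt (x - e)) (pprt (e - x)) = 0"
    using f_algebra_left[OF pprt_disjoint[of "x - e"] assms] by simp
  have "x * x - x = x * (x - e)" by (simp add: algebra_simps)
  also have "\<dots> \<le> x * pprt (x - e)" using assms by (intro mult_left_mono) (auto simp: pprt_def)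
  finally have 1: "x * x - x \<le> x * pprt (x - e)" .
  have "inf (x * x) e - x = inf (x * x - x) (e - x)"
    by (simp only: diff_conv_add_uminus add_inf_distrib_right)
  also have "\<dots> \<le> inf (x * pprt (x - e)) (pprt (e - x))"
    using 1 by (rule inf_mono) (simp add: pprt_def)
  finally show ?thesis by (simp only: d diff_le_0_iff_le)
qed

text \<open>The square as the upper envelope of its tangents: a supremum of affine expressions.\<close>

lemma square_eq_Sup:
  "a * a = (SUP t::real. (2 * t) *\<^sub>R a - (t * t) *\<^sub>R e)"
    and bdd_above_tangents: "bdd_above (range (\<lambda>t::real. (2 * t) *\<^sub>R a - (t * t) *\<^sub>R e))"
proof -
  let ?f = "\<lambda>t::real. (2 * t) *\<^sub>R a - (t * t) *\<^sub>R e"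
  have f: "?f t = a * a - (a - t *\<^sub>R e) * (a - t *\<^sub>R e)" for t
    by (simp add: algebra_simps) (simp flip: scaleR_add_left)
  then have ub: "?f t \<le> a * a" for t using square_nonneg[of "a - t *\<^sub>R e"] by (simp add: f)
  show bdd: "bdd_above (range ?f)" by (rule bdd_aboveI[of _ "a * a"]) (use ub in auto)
  let ?z = "a * a - (SUP t. ?f t)"
  have z: "0 \<le> ?z" using cSUP_least[of UNIV ?f "a * a"] ub by simp
  \<comment> \<open>For every t the gap \<open>?z\<close> is at most the square of
    \<open>\<bar>a - t e\<bar>\<close>. Truncation by \<open>e\<close> exchanges that square for
    \<open>\<bar>a - t e\<bar>\<close> itself, so the grid lemma applies with the identity as
    orthomorphism.\<close>
  have "inf ?z e = 0"
  proof (rule eq_0_if_le_orthomorphism[of "\<lambda>x. x" _ a])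
    fix t
    let ?x = "\<bar>a - t *\<^sub>R e\<bar>"
    have "?f t \<le> (SUP t. ?f t)" by (rule cSUP_upper[OF _ bdd]) simp
    then have "?z \<le> ?x * ?x" unfolding f abs_mult_self by (simp only: diff_le_eq add.commute)
    then have "inf ?z e \<le> inf (?x * ?x) e" by (intro inf_mono) auto
    also have "\<dots> \<le> ?x" by (rule inf_square_unit_le) simp
    finally show "inf ?z e \<le> ?x" .
  qed (use z in auto)
  then have "?z = 0" by (rule disjoint_unit_eq_0)
  then show "a * a = (SUP t. ?f t)" by simp
qed

text \<open>Formulated without the carrier \<open>E\<close>, so that the calculus of components is
  pure algebra; membership in \<open>E\<close> follows later because \<open>E\<close> contains every
  element between 0 and \<open>e\<close>.\<close>

definition component :: "'u \<Rightarrow> bool" where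
  "component p \<longleftrightarrow> inf p (e - p) = 0"

lemma component_nonneg: "component p \<Longrightarrow> 0 \<le> p"
  unfolding component_def by (metis inf_le1)

lemma component_le_unit: "component p \<Longrightarrow> p \<le> e"
  unfolding component_def by (metis diff_ge_0_iff_ge inf_le2)

text \<open>Reduces lattice relations between components to identities of products. In the converse
  direction \<open>p\<close> and \<open>e - p\<close> are both squares and hence nonnegative, so a
  vanishing product makes them disjoint.\<close>

lemma component_iff_idempotent: "component p \<longleftrightarrow> p * p = p"
proof
  assume "component p"
  then have "p * (e - p) = 0" unfolding component_def by (rule disjoint_mult_eq_0)
  then show "p * p = p" by (simp add: algebra_simps)
next
  assume p: "p * p = p"
  have "(e - p) * (e - p) = e - p" "p * (e - p) = 0" using p by (auto simp: algebra_simps)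
  with p show "component p"
    unfolding component_def using square_nonneg[of p] square_nonneg[of "e - p"]
    by (intro disjoint_if_mult_eq_0) auto
qed

lemma component_0 [simp]: "component 0" and component_unit [simp]: "component e"
  by (auto simp: component_iff_idempotent)

lemma component_mult: "component p \<Longrightarrow> component q \<Longrightarrow> component (p * q)"
  unfolding component_iff_idempotent by (metis mult.assoc mult_commute)

lemma component_compl: "component p \<Longrightarrow> component (e - p)"
  unfolding component_iff_idempotent by (simp add: algebra_simps)

lemma component_disjoint_iff:
  "component p \<Longrightarrow> component q \<Longrightarrow> inf p q = 0 \<longleftrightarrow> p * q = 0"
  using disjoint_if_mult_eq_0 disjoint_mult_eq_0 component_nonneg by blast

lemma component_add:
  "component p \<Longrightarrow> component q \<Longrightarrow> p * q = 0 \<Longrightarrow> component (p + q)"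
  unfolding component_iff_idempotent by (simp add: algebra_simps mult_commute[of q p])

lemma component_mult_le: "component p \<Longrightarrow> 0 \<le> x \<Longrightarrow> p * x \<le> x"
  using mult_right_mono[of p e x] component_le_unit by simp

lemma component_mult_eq:
  assumes "component p" "0 \<le> q" "q \<le> p" shows "p * q = q"
proof -
  have "(e - p) * q \<le> (e - p) * p"
    using assms component_le_unit by (intro mult_left_mono) auto
  also have "\<dots> = 0" using assms(1) by (simp add: component_iff_idempotent algebra_simps)
  finally have "q \<le> p * q" by (simp add: algebra_simps)
  with component_mult_le[OF assms(1,2)] show ?thesis by (rule antisym)
qed

lemma component_diff:
  assumes "component p" "component q" "q \<le> p"
  shows "component (p - q)"
  using component_mult_eq[OF assms(1) component_nonneg[OF assms(2)] assms(3)] assms(1,2)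
  unfolding component_iff_idempotent by (simp add: algebra_simps mult_commute[of q p])

text \<open>The witness is the projection of \<open>e\<close> onto the band of
  \<open>pprt x\<close>: it annihilates \<open>pprt (- x)\<close>, and its complement annihilates
  \<open>pprt x\<close>.\<close>

lemma ex_component_pprt: "\<exists>p. component p \<and> p * x = pprt x"
proof (intro exI conjI)
  let ?p = "band_part e (pprt x)"
  have d: "inf (e - ?p) (pprt x) = 0" by (rule disjoint_diff_band_part) auto
  have "inf ?p (e - ?p) = 0"
    by (rule band_part_disjoint) (use d in \<open>auto simp: inf_commute\<close>)
  then show "component ?p" by (simp add: component_def)
  have 1: "(e - ?p) * pprt x = 0" using d by (rule disjoint_mult_eq_0)
  have 2: "?p * pprt (- x) = 0"
    by (intro disjoint_mult_eq_0 band_part_disjoint pprt_disjoint) auto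
  have "?p * x = ?p * (pprt x - pprt (- x))" by (simp only: pprt_diff)
  also have "\<dots> = pprt x" using 1 2 by (simp add: algebra_simps)
  finally show "?p * x = pprt x" .
qed

end

lemma abs_scaleR_le: "\<bar>r *\<^sub>R x\<bar> \<le> \<bar>r\<bar> *\<^sub>R \<bar>x\<bar>"
  for x :: "'a::{lattice_ab_group_add_abs,ordered_real_vector}"
proof (cases "0 \<le> r")
  case True
  have "r *\<^sub>R x \<le> r *\<^sub>R \<bar>x\<bar>" "r *\<^sub>R (- x) \<le> r *\<^sub>R \<bar>x\<bar>"
    using True by (auto intro!: scaleR_left_mono abs_ge_self abs_ge_minus_self simp del: scaleR_minus_right)
  then show ?thesis using True by (intro abs_leI) auto
next
  case False
  then have "(- r) *\<^sub>R x \<le> (- r) *\<^sub>R \<bar>x\<bar>" "(- r) *\<^sub>R (- x) \<le> (- r) *\<^sub>R \<bar>x\<bar>"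
    by (auto intro!: scaleR_left_mono abs_ge_self abs_ge_minus_self simp del: scaleR_minus_right scaleR_minus_left)
  then show ?thesis using False by (intro abs_leI) auto
qed

lemma riesz_subspaceD:
  assumes "riesz_subspace L"
  shows "0 \<in> L" "x \<in> L \<Longrightarrow> y \<in> L \<Longrightarrow> x + y \<in> L" "x \<in> L \<Longrightarrow> y \<in> L \<Longrightarrow> x - y \<in> L"
    "x \<in> L \<Longrightarrow> - x \<in> L" "x \<in> L \<Longrightarrow> r *\<^sub>R x \<in> L" "x \<in> L \<Longrightarrow> y \<in> L \<Longrightarrow> sup x y \<in> L"
    "x \<in> L \<Longrightarrow> y \<in> L \<Longrightarrow> inf x y \<in> L" "x \<in> L \<Longrightarrow> \<bar>x\<bar> \<in> L" "x \<in> L \<Longrightarrow> pprt x \<in> L"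
  using assms subspace_0[of L] subspace_add[of L x y] subspace_diff[of L x y] subspace_neg[of L x]
    subspace_scale[of L x r]
  unfolding riesz_subspace_def abs_lattice pprt_def by (auto simp: subspace_neg subspace_0)

section \<open>Universally complete conditional Riesz triples\<close>

locale T_universally_complete_triple =
  fixes E :: "'u::universally_complete_f_algebra set" and e :: 'u and T :: "'u \<Rightarrow> 'u"
  assumes completion: "universal_completion_of E e"
    and triple: "conditional_riesz_triple E e T"
    and T_complete: "T_universally_complete E T"
begin

sublocale unital_f_algebra e
  using completion by unfold_locales (auto simp: universal_completion_of_def)

definition R :: "'u set" where "R = T ` E"

lemma T_in_R [simp]: "x \<in> E \<Longrightarrow> T x \<in> R"
  unfolding R_def by simp

lemma E_riesz: "riesz_subspace E" and R_riesz: "riesz_subspace R" and R_subset_E: "R \<subseteq> E"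
  using triple unfolding conditional_riesz_triple_def R_def by auto

lemmas E_simps [simp] = riesz_subspaceD[OF E_riesz]
lemmas R_simps [simp] = riesz_subspaceD[OF R_riesz]

text \<open>An order dense, Dedekind complete subspace is an ideal. Let \<open>s\<close> be the
  supremum in \<open>E\<close> of the elements of \<open>E\<close> between 0 and \<open>y\<close>.
  If \<open>y\<close> and \<open>s\<close> differed, order density would give some
  \<open>w > 0\<close> in \<open>E\<close> below \<open>pprt (y - s)\<close> or
  \<open>pprt (s - y)\<close>; in either case every \<open>a + w\<close> is below \<open>s\<close>,
  and \<open>s - w\<close> would be a smaller upper bound.\<close>

lemma E_interval:
  assumes x: "x \<in> E" and y: "0 \<le> y" "y \<le> x"
  shows "y \<in> E"
proof -
  let ?A = "{z \<in> E. 0 \<le> z \<and> z \<le> y}"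
  have dense: "\<exists>w\<in>E. 0 < w \<and> w \<le> u" if "0 < u" for u
    using completion that unfolding universal_completion_of_def order_dense_def by blast
  have "0 \<in> ?A" using y by simp
  moreover have "\<exists>u\<in>E. \<forall>a\<in>?A. a \<le> u" using x y by (intro bexI[of _ x]) auto
  moreover have "dedekind_complete_in E" using triple unfolding conditional_riesz_triple_def by simp
  ultimately obtain s where s: "is_lub (\<le>) E ?A s"
    unfolding dedekind_complete_in_def by (smt (verit) mem_Collect_eq subsetI empty_iff)
  then have sE: "s \<in> E" and ub: "\<And>a. a \<in> ?A \<Longrightarrow> a \<le> s"
    and least: "\<And>u. u \<in> E \<Longrightarrow> (\<And>a. a \<in> ?A \<Longrightarrow> a \<le> u) \<Longrightarrow> s \<le> u"
    unfolding is_lub_def by auto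
  have no: False if w: "w \<in> E" "0 < w" and "\<And>a. a \<in> ?A \<Longrightarrow> a + w \<le> s" for w
  proof -
    have "s \<le> s - w"
      using that(3) sE w(1) by (intro least) (auto simp: le_diff_eq)
    then show False using w(2) by auto
  qed
  have "pprt (y - s) = 0"
  proof (rule ccontr)
    assume "pprt (y - s) \<noteq> 0"
    then obtain w where w: "w \<in> E" "0 < w" "w \<le> pprt (y - s)"
      using dense[of "pprt (y - s)"] by (metis order.not_eq_order_implies_strict zero_le_pprt)
    have "a + w \<in> ?A" if a: "a \<in> ?A" for a
    proof -
      have "a + pprt (y - s) \<le> y"
        using a ub[OF a] add_mono[of a s "y - s" "y - s"]
        by (simp add: pprt_def add_sup_distrib_left)
      then have "a + w \<le> y" using w(3) by (meson add_left_mono order_trans)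
      then show ?thesis using a w by (simp add: add_increasing2)
    qed
    then show False using ub by (intro no[OF w(1,2)]) blast
  qed
  moreover have "pprt (s - y) = 0"
  proof (rule ccontr)
    assume "pprt (s - y) \<noteq> 0"
    then obtain w where w: "w \<in> E" "0 < w" "w \<le> pprt (s - y)"
      using dense[of "pprt (s - y)"] by (metis order.not_eq_order_implies_strict zero_le_pprt)
    have "a + w \<le> s" if a: "a \<in> ?A" for a
    proof -
      have "a + pprt (s - y) \<le> s"
        using a ub[OF a] add_mono[of a y "s - y" "s - y"]
        by (simp add: pprt_def add_sup_distrib_left)
      then show ?thesis using w(3) by (meson add_left_mono order_trans)
    qed
    then show False by (rule no[OF w(1,2)])
  qed
  ultimately have "y = s" by (simp add: le_zero_iff_zero_pprt[symmetric])
  then show ?thesis using sE by simp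
qed

lemma E_ideal:
  assumes "x \<in> E" "\<bar>y\<bar> \<le> x" shows "y \<in> E"
proof -
  have "pprt y \<le> \<bar>y\<bar>" "pprt (- y) \<le> \<bar>y\<bar>" by (auto simp: abs_eq_pprt)
  then have "pprt y \<le> x" "pprt (- y) \<le> x" using assms(2) by auto
  then have "pprt y - pprt (- y) \<in> E" using E_interval[OF assms(1)] by auto
  then show ?thesis by (simp only: pprt_diff)
qed

lemma unit_R [simp]: "e \<in> R"
  using triple unfolding conditional_riesz_triple_def R_def by (metis imageI)

lemma T_add: "x \<in> E \<Longrightarrow> y \<in> E \<Longrightarrow> T (x + y) = T x + T y"
  and T_R [simp]: "r \<in> R \<Longrightarrow> T r = r"
  and T_pos: "x \<in> E \<Longrightarrow> 0 < x \<Longrightarrow> 0 < T x"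
  using triple unfolding conditional_riesz_triple_def linear_from_def R_def by auto

lemma T_mono:
  assumes "x \<in> E" "y \<in> E" "x \<le> y" shows "T x \<le> T y"
proof -
  have "0 \<le> T (y - x)"
    using T_pos[of "y - x"] assms T_R[of 0] by (cases "y = x") (auto simp: less_le)
  moreover have "T y = T (y - x) + T x" using T_add[of "y - x" x] assms by simp
  ultimately show ?thesis by simp
qed

text \<open>Completeness of the triple needs a directed set, hence all elements of \<open>R\<close>
  below \<open>Sup A\<close>; \<open>T\<close> fixes them, so their images are bounded. Their
  supremum \<open>s\<close> in \<open>E\<close> equals \<open>Sup A\<close> because \<open>E\<close>
  is an ideal. The differences \<open>s - y\<close> decrease to 0, so by order continuity do
  \<open>T s - y\<close>; this gives \<open>T s \<le> s\<close>, while \<open>s \<le> T s\<close>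
  holds since \<open>T s\<close> is an upper bound.\<close>

lemma R_Sup [simp]:
  assumes A: "A \<subseteq> R" "A \<noteq> {}" "bdd_above A"
  shows "Sup A \<in> R"
proof -
  let ?A = "{y \<in> R. y \<le> Sup A}"
  obtain a where a: "a \<in> A" using A by auto
  have sub: "A \<subseteq> ?A" using A by (auto intro: cSup_upper)
  have "upwards_directed ?A" unfolding upwards_directed_def
  proof (intro ballI)
    show "\<exists>c\<in>?A. a \<le> c \<and> b \<le> c" if "a \<in> ?A" "b \<in> ?A" for a b
      using that by (intro bexI[of _ "sup a b"]) auto
  qed
  moreover have "bdd_above (T ` ?A)" by (rule bdd_aboveI[of _ "Sup A"]) auto
  moreover have "?A \<subseteq> E" using R_subset_E by auto
  moreover have "?A \<noteq> {}" using sub a by blast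
  ultimately obtain s where s: "is_lub (\<le>) E ?A s"
    using T_complete unfolding T_universally_complete_def by blast
  then have sE: "s \<in> E" and ub: "\<And>a. a \<in> ?A \<Longrightarrow> a \<le> s"
    and least: "\<And>u. u \<in> E \<Longrightarrow> (\<And>a. a \<in> ?A \<Longrightarrow> a \<le> u) \<Longrightarrow> s \<le> u"
    unfolding is_lub_def by auto
  have Sup_le: "Sup A \<le> s" using sub ub A(2) by (intro cSup_least) auto
  have "Sup A - a \<in> E"
    by (rule E_interval[of "s - a"])
      (use sE a A R_subset_E Sup_le in \<open>auto intro: cSup_upper\<close>)
  from E_simps(2)[OF this, of a] have "Sup A \<in> E" using a A R_subset_E by auto
  then have s_eq: "s = Sup A" using least[of "Sup A"] Sup_le by (intro antisym) auto
  let ?D = "(\<lambda>y. s - y) ` ?A"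
  have "is_glb (\<le>) E ?D 0" unfolding is_glb_def
  proof (intro conjI ballI impI)
    fix u assume u: "u \<in> E" "\<forall>d\<in>?D. u \<le> d"
    have "s \<le> s - u" using u sE by (intro least) (auto simp: le_diff_eq add.commute)
    then show "u \<le> 0" by simp
  qed (use ub in auto)
  moreover have "downwards_directed ?D" unfolding downwards_directed_def
  proof (intro ballI)
    fix x y assume "x \<in> ?D" "y \<in> ?D"
    then obtain a b where "a \<in> ?A" "b \<in> ?A" "x = s - a" "y = s - b" by blast
    then show "\<exists>c\<in>?D. c \<le> x \<and> c \<le> y"
      by (intro bexI[of _ "s - sup a b"] imageI) (auto simp: diff_left_mono)
  qed
  moreover have "?D \<subseteq> E" using sE R_subset_E by auto
  moreover have "?D \<noteq> {}" using sub a by blast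
  moreover have "order_continuous_on E T"
    using triple unfolding conditional_riesz_triple_def by simp
  ultimately have glb: "is_glb (\<le>) E (T ` ?D) 0"
    unfolding order_continuous_on_def by blast
  have Ts: "T s \<in> R" using sE by auto
  have Td: "T (s - y) = T s - y" if "y \<in> R" for y
    using T_add[of "s - y" y] that sE R_subset_E by (auto simp: eq_diff_eq)
  have "s \<le> T s"
    using T_mono[OF _ sE] ub R_subset_E Ts by (intro least) (auto, metis T_R imageI subsetD)
  moreover have "T s - s \<le> 0"
  proof -
    have "\<forall>d\<in>T ` ?D. T s - s \<le> d" using Td ub by (auto simp: diff_left_mono)
    moreover have "T s - s \<in> E" using Ts sE R_subset_E by (simp add: subsetD)
    ultimately show ?thesis using glb unfolding is_glb_def by blast
  qed
  ultimately show ?thesis using Ts s_eq by auto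
qed

lemma R_Inf [simp]:
  assumes A: "A \<subseteq> R" "A \<noteq> {}" "bdd_below A"
  shows "Inf A \<in> R"
proof -
  obtain l where l: "\<And>a. a \<in> A \<Longrightarrow> l \<le> a" using A(3) unfolding bdd_below_def by blast
  then have bdd: "bdd_above (uminus ` A)" by (intro bdd_aboveI[of _ "- l"]) auto
  have "Inf A = - Sup (uminus ` A)"
  proof (rule antisym)
    have "Sup (uminus ` A) \<le> - Inf A"
      using A by (intro cSup_least) (auto intro: cInf_lower)
    then show "Inf A \<le> - Sup (uminus ` A)" by (simp add: le_minus_iff)
    have "- Sup (uminus ` A) \<le> a" if "a \<in> A" for a
      using cSup_upper[OF imageI[OF that] bdd] by (simp add: minus_le_iff)
    then show "- Sup (uminus ` A) \<le> Inf A" using A by (intro cInf_greatest)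
  qed
  moreover have "Sup (uminus ` A) \<in> R" using A bdd by (intro R_Sup) auto
  ultimately show ?thesis by simp
qed

lemma is_lub_R:
  assumes "A \<subseteq> R" "A \<noteq> {}" "bdd_above A"
  shows "is_lub (\<le>) R A s \<longleftrightarrow> s = Sup A"
proof
  assume "is_lub (\<le>) R A s"
  then show "s = Sup A" using R_Sup[OF assms] assms(2,3) unfolding is_lub_def
    by (intro antisym) (auto intro: cSup_upper cSup_least)
next
  assume "s = Sup A"
  then show "is_lub (\<le>) R A s" using R_Sup[OF assms] assms(2,3) unfolding is_lub_def
    by (auto intro: cSup_upper cSup_least)
qed

lemma Lub_R:
  assumes "A \<subseteq> R" "A \<noteq> {}" "bdd_above A"
  shows "Lub (\<le>) R A = Sup A"
  unfolding Lub_def is_lub_R[OF assms] by simp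

lemma is_glb_R:
  assumes "A \<subseteq> R" "A \<noteq> {}" "bdd_below A"
  shows "is_glb (\<le>) R A s \<longleftrightarrow> s = Inf A"
proof
  assume "is_glb (\<le>) R A s"
  then show "s = Inf A" using R_Inf[OF assms] assms(2,3) unfolding is_glb_def
    by (intro antisym) (auto intro: cInf_lower cInf_greatest)
next
  assume "s = Inf A"
  then show "is_glb (\<le>) R A s" using R_Inf[OF assms] assms(2,3) unfolding is_glb_def
    by (auto intro: cInf_lower cInf_greatest)
qed

lemma Glb_R:
  assumes "A \<subseteq> R" "A \<noteq> {}" "bdd_below A"
  shows "Glb (\<le>) R A = Inf A"
  unfolding Glb_def is_glb_R[OF assms] by simp

lemma R_mult [simp]:
  assumes "a \<in> R" "b \<in> R" shows "a * b \<in> R"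
proof -
  have sq: "x * x \<in> R" if "x \<in> R" for x
    unfolding square_eq_Sup[of x]
    by (rule R_Sup) (use that bdd_above_tangents in auto)
  \<comment> \<open>Polarization leaves only squares, and these are suprema of real combinations of
    an element of \<open>R\<close> and \<open>e\<close>.\<close>
  have "a * b = (1/4) *\<^sub>R ((a + b) * (a + b) - (a - b) * (a - b))"
    by (simp add: algebra_simps mult_commute[of b a]) (simp flip: scaleR_add_left)
  also have "\<dots> \<in> R" using assms by (intro R_simps sq)
  finally show ?thesis .
qed

section \<open>Components and absolute continuity\<close>

lemma component_in_E: "component p \<Longrightarrow> p \<in> E"
  using E_interval[of e p] R_subset_E unit_R component_nonneg component_le_unit by blast

lemma components_eq: "components E e = {p. component p}"
  unfolding components_def component_def using component_in_E component_def by auto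

text \<open>If \<open>d\<close> is disjoint from \<open>p\<close>, then \<open>e\<close> has room
  for \<open>p\<close> and for every truncated multiple of \<open>d\<close> side by side. Applying
  \<open>T\<close>, which fixes these truncations and \<open>e\<close>, gives the same room beside
  \<open>T p\<close>. The other direction is strict positivity applied to
  \<open>inf p d\<close>.\<close>

lemma component_disjoint_T_iff:
  assumes p: "component p" and d: "d \<in> R" "0 \<le> d"
  shows "inf (T p) d = 0 \<longleftrightarrow> inf p d = 0"
proof
  have pE: "p \<in> E" and p0: "0 \<le> p" using p component_in_E component_nonneg by auto
  have Tp: "0 \<le> T p" using T_mono[of 0 p] pE p0 T_R[of 0] by simp
  {
    assume pd: "inf p d = 0"
    let ?d = "inf d e"
    have d': "?d \<in> R" "0 \<le> ?d" using d by auto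
    have "inf ?d p = 0" by (rule disjoint_mono[of d]) (use pd d in \<open>auto simp: inf_commute\<close>)
    then have nd: "inf (real n *\<^sub>R ?d) p = 0" for n by (rule disjoint_scaleR) simp
    have "inf (inf (real n *\<^sub>R ?d) e) p = 0" for n
      by (rule disjoint_mono[OF nd[of n]]) (use d' in \<open>auto simp: scaleR_nonneg_nonneg\<close>)
    then have "p + inf (real n *\<^sub>R ?d) e \<le> e" for n
      using p component_le_unit by (intro disjoint_add_le) (auto simp: inf_commute)
    moreover have dR: "inf (real n *\<^sub>R ?d) e \<in> R" for n using d' by auto
    then have dE: "inf (real n *\<^sub>R ?d) e \<in> E" for n using R_subset_E by blast
    ultimately have "T (p + inf (real n *\<^sub>R ?d) e) \<le> T e" for n
      using pE unit_R R_subset_E by (intro T_mono) auto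
    moreover have "T (p + inf (real n *\<^sub>R ?d) e) = T p + inf (real n *\<^sub>R ?d) e" for n
      using T_add[OF pE dE] dR by simp
    ultimately have le: "T p + inf (real n *\<^sub>R ?d) e \<le> e" for n by simp
    let ?x = "inf (T p) ?d"
    \<comment> \<open>If n \<open>?x\<close> is below \<open>e\<close>, it is below the truncated
      multiple of \<open>?d\<close>; one further \<open>?x\<close> fits in as part of
      \<open>T p\<close>.\<close>
    have "real n *\<^sub>R ?x \<le> e" for n
    proof (induction n)
      case (Suc n)
      have "real n *\<^sub>R ?x \<le> inf (real n *\<^sub>R ?d) e"
        by (intro inf_greatest[OF scaleR_left_mono[OF inf_le2] Suc]) simp
      then have "?x + real n *\<^sub>R ?x \<le> T p + inf (real n *\<^sub>R ?d) e" by (intro add_mono) auto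
      with le[of n] show ?case by (simp add: scaleR_add_left)
    qed simp
    then have "?x \<le> 0" by (rule archimedean)
    moreover have "0 \<le> ?x" using Tp d' by simp
    ultimately have "inf (inf (T p) d) e = 0" by (simp add: inf_assoc)
    then show "inf (T p) d = 0" by (rule disjoint_unit_eq_0)
  }
  assume "inf (T p) d = 0"
  moreover have dE: "d \<in> E" using d R_subset_E by auto
  have "T (inf p d) \<le> inf (T p) d"
    using T_mono[of "inf p d" p] T_mono[of "inf p d" d] d pE dE by auto
  moreover have "0 \<le> inf p d" using p0 d by simp
  ultimately show "inf p d = 0" using T_pos[of "inf p d"] pE dE by (auto simp: less_le)
qed

text \<open>A double disjoint complement within \<open>R\<close>, with \<open>b\<close> allowed to
  lie outside \<open>R\<close>: this makes it possible to test the band of \<open>T p\<close> on the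
  component \<open>p\<close> itself.\<close>

definition in_band :: "'u \<Rightarrow> 'u \<Rightarrow> bool" where
  "in_band b m \<longleftrightarrow> m \<in> R \<and> (\<forall>d\<in>R. 0 \<le> d \<and> inf b d = 0 \<longrightarrow> inf \<bar>m\<bar> d = 0)"

lemma in_bandD:
  assumes "in_band b m"
  shows "m \<in> R" "d \<in> R \<Longrightarrow> 0 \<le> d \<Longrightarrow> inf b d = 0 \<Longrightarrow> inf \<bar>m\<bar> d = 0"
  using assms unfolding in_band_def by auto

lemma in_band_0 [simp]: "in_band b 0"
  unfolding in_band_def by (auto simp: inf_absorb1)

lemma in_band_ideal: "in_band b m \<Longrightarrow> x \<in> R \<Longrightarrow> \<bar>x\<bar> \<le> \<bar>m\<bar> \<Longrightarrow> in_band b x"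
  unfolding in_band_def by (auto intro: disjoint_mono[of "\<bar>m\<bar>"])

lemma in_band_add:
  assumes "in_band b x" "in_band b y" shows "in_band b (x + y)"
proof -
  have "inf \<bar>x + y\<bar> d = 0" if "d \<in> R" "0 \<le> d" "inf b d = 0" for d
    by (rule disjoint_mono[OF disjoint_add[of "\<bar>x\<bar>" _ "\<bar>y\<bar>"]])
      (use that assms[THEN in_bandD(2)] in \<open>auto simp: abs_triangle_ineq\<close>)
  then show ?thesis using assms unfolding in_band_def by auto
qed

lemma in_band_scaleR:
  assumes "in_band b x" shows "in_band b (r *\<^sub>R x)"
proof -
  have "inf \<bar>r *\<^sub>R x\<bar> d = 0" if "d \<in> R" "0 \<le> d" "inf b d = 0" for d
    by (rule disjoint_mono[OF disjoint_scaleR[of "\<bar>x\<bar>" _ "\<bar>r\<bar>"]])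
      (use that assms[THEN in_bandD(2)] abs_scaleR_le in auto)
  then show ?thesis using assms unfolding in_band_def by auto
qed

lemma in_band_mult:
  assumes "in_band b x" "\<alpha> \<in> R" shows "in_band b (\<alpha> * x)"
proof -
  have "inf \<bar>\<alpha> * x\<bar> d = 0" if "d \<in> R" "0 \<le> d" "inf b d = 0" for d
    by (rule disjoint_mono[OF f_algebra_left[of "\<bar>x\<bar>" _ "\<bar>\<alpha>\<bar>"]])
      (use that assms(1)[THEN in_bandD(2)] abs_le_mult in auto)
  then show ?thesis using assms unfolding in_band_def by auto
qed

lemma in_band_cSup:
  assumes A: "\<And>a. a \<in> A \<Longrightarrow> in_band b a" "A \<noteq> {}" "bdd_above A"
  shows "in_band b (Sup A)"
proof -
  have R: "Sup A \<in> R" using A unfolding in_band_def by (intro R_Sup) auto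
  have "inf \<bar>Sup A\<bar> d = 0" if d: "d \<in> R" "0 \<le> d" "inf b d = 0" for d
    unfolding abs_eq_pprt
  proof (intro disjoint_add disjoint_cSup A d)
    have a: "inf \<bar>a\<bar> d = 0" if "a \<in> A" for a using A(1)[OF that] d unfolding in_band_def by auto
    then show "inf (pprt a) d = 0" if "a \<in> A" for a
      using that by (intro disjoint_mono[OF a]) (auto simp: abs_eq_pprt)
    obtain a where aA: "a \<in> A" using A by auto
    \<comment> \<open>The negative part of a supremum is below the negative part of any single
      member.\<close>
    have "pprt (- Sup A) \<le> pprt (- a)" using cSup_upper[OF aA A(3)] by simp
    also have "\<dots> \<le> \<bar>a\<bar>" by (auto simp: abs_eq_pprt)
    finally show "inf (pprt (- Sup A)) d = 0" by (intro disjoint_mono[OF a[OF aA]]) auto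
  qed
  then show ?thesis using R unfolding in_band_def by auto
qed

text \<open>A double disjoint complement is a band, which gives one inclusion. For the other,
  \<open>\<bar>m\<bar>\<close> minus its projection is disjoint from \<open>b\<close>, hence from
  \<open>\<bar>m\<bar>\<close>, hence 0; so \<open>\<bar>m\<bar>\<close> is a supremum of elements
  that any band containing \<open>b\<close> contains.\<close>

lemma band_generated_iff:
  assumes b: "b \<in> R" "0 \<le> b"
  shows "m \<in> band_generated R b \<longleftrightarrow> in_band b m"
proof
  have "band_in R (Collect (in_band b))"
    unfolding band_in_def order_ideal_in_def
  proof (intro conjI allI impI ballI)
    show "Collect (in_band b) \<subseteq> R" unfolding in_band_def by auto
    show "subspace (Collect (in_band b))"
      unfolding subspace_def using in_band_add in_band_scaleR by auto
    fix A s assume A: "A \<subseteq> Collect (in_band b) \<and> A \<noteq> {} \<and> is_lub (\<le>) R A s"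
    then have "bdd_above A" "A \<subseteq> R" unfolding is_lub_def in_band_def by (auto intro: bdd_aboveI)
    then show "s \<in> Collect (in_band b)" using A is_lub_R[of A s] in_band_cSup[of A b] by auto
  qed (auto intro: in_band_ideal)
  moreover have "in_band b b" using b unfolding in_band_def by auto
  ultimately show "in_band b m" if "m \<in> band_generated R b"
    using that unfolding band_generated_def by auto
next
  assume m: "in_band b m"
  then have mR: "m \<in> R" unfolding in_band_def by simp
  show "m \<in> band_generated R b"
    unfolding band_generated_def
  proof clarify
    fix B assume B: "band_in R B" "b \<in> B"
    let ?A = "range (\<lambda>n::nat. inf \<bar>m\<bar> (real n *\<^sub>R b))"
    have A: "?A \<subseteq> R" using mR b by auto
    have ideal: "x \<in> B" if "y \<in> B" "x \<in> R" "\<bar>x\<bar> \<le> \<bar>y\<bar>" for x y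
      using B that unfolding band_in_def order_ideal_in_def by blast
    have "real n *\<^sub>R b \<in> B" for n :: nat
      using B unfolding band_in_def order_ideal_in_def by (auto intro: subspace_scale)
    moreover have "\<bar>inf \<bar>m\<bar> (real n *\<^sub>R b)\<bar> \<le> \<bar>real n *\<^sub>R b\<bar>" for n :: nat
      using b by (simp add: scaleR_nonneg_nonneg)
    ultimately have "?A \<subseteq> B" using A ideal by blast
    moreover have "is_lub (\<le>) R ?A (band_part \<bar>m\<bar> b)"
      using is_lub_R[OF A _ band_part_bdd] by (simp add: band_part_def)
    ultimately have "band_part \<bar>m\<bar> b \<in> B" using B unfolding band_in_def by blast
    moreover have "band_part \<bar>m\<bar> b = \<bar>m\<bar>"
    proof (rule band_part_eq)
      have "band_part \<bar>m\<bar> b \<in> R" unfolding band_part_def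
        using A band_part_bdd by (intro R_Sup) auto
      then have "inf \<bar>m\<bar> (\<bar>m\<bar> - band_part \<bar>m\<bar> b) = 0"
        using disjoint_diff_band_part[of "\<bar>m\<bar>" b] b band_part_le[of "\<bar>m\<bar>" b] mR
        by (intro in_bandD(2)[OF m]) (auto simp: inf_commute)
      then show "inf (\<bar>m\<bar> - band_part \<bar>m\<bar> b) \<bar>m\<bar> = 0" by (simp add: inf_commute)
    qed (use b in auto)
    ultimately show "m \<in> B" using ideal[of "\<bar>m\<bar>" m] mR by simp
  qed
qed

lemma band_generated_T_component_iff:
  assumes "component p"
  shows "m \<in> band_generated R (T p) \<longleftrightarrow> in_band p m"
proof -
  have "p \<in> E" "0 \<le> p" using assms component_in_E component_nonneg by auto
  then have "0 \<le> T p" "T p \<in> R" using T_mono[of 0 p] T_R[of 0] by auto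
  then show ?thesis
    using band_generated_iff component_disjoint_T_iff[OF assms] unfolding in_band_def by auto
qed

subsection \<open>The space of bounded elements\<close>

abbreviation "\<L> \<equiv> Linf E T"

text \<open>Membership in \<open>E\<close> is automatic, since \<open>E\<close> is an ideal that
  contains \<open>R\<close>.\<close>

lemma Linf_iff: "f \<in> \<L> \<longleftrightarrow> (\<exists>g\<in>R. \<bar>f\<bar> \<le> g)"
proof
  assume "\<exists>g\<in>R. \<bar>f\<bar> \<le> g"
  then obtain g where g: "g \<in> R" "\<bar>f\<bar> \<le> g" by auto
  moreover have "0 \<le> g" using order_trans[OF abs_ge_zero g(2)] .
  moreover have "f \<in> E" using E_ideal[of g f] g R_subset_E by auto
  ultimately show "f \<in> \<L>" unfolding Linf_def R_def[symmetric] by auto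
qed (unfold Linf_def R_def, blast)

lemma LinfI: "\<bar>f\<bar> \<le> g \<Longrightarrow> g \<in> R \<Longrightarrow> f \<in> \<L>"
  unfolding Linf_iff by (rule bexI)

lemma Linf_ideal: "f \<in> \<L> \<Longrightarrow> \<bar>g\<bar> \<le> \<bar>f\<bar> \<Longrightarrow> g \<in> \<L>"
  unfolding Linf_iff using order_trans[of "\<bar>g\<bar>" "\<bar>f\<bar>"] by blast

lemma Linf_add [simp]: "f \<in> \<L> \<Longrightarrow> g \<in> \<L> \<Longrightarrow> f + g \<in> \<L>"
proof -
  assume "f \<in> \<L>" "g \<in> \<L>"
  then obtain a b where ab: "a \<in> R" "\<bar>f\<bar> \<le> a" "b \<in> R" "\<bar>g\<bar> \<le> b" unfolding Linf_iff by blast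
  have "\<bar>f + g\<bar> \<le> a + b"
    by (rule order_trans[OF abs_triangle_ineq add_mono]) (fact ab)+
  then show ?thesis using ab by (intro LinfI[of _ "a + b"]) auto
qed

lemma Linf_minus [simp]: "f \<in> \<L> \<Longrightarrow> - f \<in> \<L>"
  unfolding Linf_iff by simp

lemma Linf_diff [simp]: "f \<in> \<L> \<Longrightarrow> g \<in> \<L> \<Longrightarrow> f - g \<in> \<L>"
  using Linf_add[of f "- g"] by simp

lemma Linf_R: "g \<in> R \<Longrightarrow> g \<in> \<L>"
  by (rule LinfI[of _ "\<bar>g\<bar>"]) auto

lemma Linf_0 [simp]: "0 \<in> \<L>" and Linf_unit [simp, intro]: "e \<in> \<L>"
  by (rule Linf_R, simp)+

lemma Linf_mult [simp]: "\<alpha> \<in> R \<Longrightarrow> f \<in> \<L> \<Longrightarrow> \<alpha> * f \<in> \<L>"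
proof -
  assume a: "\<alpha> \<in> R" and "f \<in> \<L>"
  then obtain g where g: "g \<in> R" "\<bar>f\<bar> \<le> g" unfolding Linf_iff by blast
  have "\<bar>\<alpha> * f\<bar> \<le> \<bar>\<alpha>\<bar> * \<bar>f\<bar>" by (rule abs_le_mult)
  also have "\<dots> \<le> \<bar>\<alpha>\<bar> * g" by (rule mult_left_mono[OF g(2) abs_ge_zero])
  finally show ?thesis by (rule LinfI) (intro R_mult R_simps(8) a g)
qed

lemma Linf_scaleR [simp]: "f \<in> \<L> \<Longrightarrow> r *\<^sub>R f \<in> \<L>"
  using Linf_mult[of "r *\<^sub>R e" f] by simp

lemma Linf_pprt [simp]: "f \<in> \<L> \<Longrightarrow> pprt f \<in> \<L>"
  by (erule Linf_ideal) (auto simp: abs_eq_pprt[of f])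

lemma Linf_component [simp]: "component p \<Longrightarrow> p \<in> \<L>"
  by (rule LinfI[of _ e]) (auto simp: component_nonneg component_le_unit)

lemma Linf_norm:
  assumes "f \<in> \<L>"
  shows "Linf_norm E T f \<in> R" "\<bar>f\<bar> \<le> Linf_norm E T f" "0 \<le> Linf_norm E T f"
    "\<And>g. g \<in> R \<Longrightarrow> \<bar>f\<bar> \<le> g \<Longrightarrow> Linf_norm E T f \<le> g"
proof -
  let ?A = "{\<alpha> \<in> R. 0 \<le> \<alpha> \<and> \<bar>f\<bar> \<le> \<alpha>}"
  have pos: "0 \<le> g" if "\<bar>f\<bar> \<le> g" for g using order_trans[OF abs_ge_zero that] .
  have A: "?A \<noteq> {}" "?A \<subseteq> R" "bdd_below ?A"
  proof -
    obtain g where "g \<in> R" "\<bar>f\<bar> \<le> g" using assms unfolding Linf_iff by blast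
    then have "g \<in> ?A" using pos by blast
    then show "?A \<noteq> {}" by blast
    show "bdd_below ?A" by (rule bdd_belowI[of _ 0]) blast
  qed blast
  then have n: "Linf_norm E T f = Inf ?A" unfolding Linf_norm_def R_def[symmetric] by (intro Glb_R)
  show "Linf_norm E T f \<in> R" unfolding n using A by (intro R_Inf)
  show "\<bar>f\<bar> \<le> Linf_norm E T f" "0 \<le> Linf_norm E T f"
    unfolding n using A(1) by (blast intro!: cInf_greatest)+
  show "Linf_norm E T f \<le> g" if "g \<in> R" "\<bar>f\<bar> \<le> g" for g
    unfolding n using that A(3) pos by (intro cInf_lower) blast+
qed

subsection \<open>Approximation by step elements\<close>

text \<open>The components may overlap, so that sums of step elements are concatenations of lists;
  disjoint representations are recovered when the two notions of step element are compared.\<close>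

definition step_list :: "('u \<times> 'u) list \<Rightarrow> bool" where
  "step_list xs \<longleftrightarrow> (\<forall>(\<alpha>, p)\<in>set xs. \<alpha> \<in> R \<and> component p)"

definition step_value :: "('u \<times> 'u) list \<Rightarrow> 'u" where
  "step_value xs = (\<Sum>(\<alpha>, p)\<leftarrow>xs. \<alpha> * p)"

lemma step_list_simps [simp]:
  "step_list []" "step_list ((\<alpha>, p) # xs) \<longleftrightarrow> \<alpha> \<in> R \<and> component p \<and> step_list xs"
  "step_list (xs @ ys) \<longleftrightarrow> step_list xs \<and> step_list ys"
  by (auto simp: step_list_def)

lemma step_value_simps [simp]:
  "step_value [] = 0" "step_value ((\<alpha>, p) # xs) = \<alpha> * p + step_value xs"
  "step_value (xs @ ys) = step_value xs + step_value ys"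
  by (auto simp: step_value_def)

lemma Linf_step_value: "step_list xs \<Longrightarrow> step_value xs \<in> \<L>"
  by (induction xs) (auto)

text \<open>Binary expansion: with \<open>\<gamma> = \<beta> / 2\<^sup>n\<close> and \<open>0 \<le> g \<le> \<gamma>\<close>, the next digit is the
  component on which \<open>g > \<gamma> / 2\<close>.\<close>

lemma step_approx:
  assumes f: "0 \<le> f" "f \<le> \<beta>" and \<beta>: "\<beta> \<in> R"
  shows "\<exists>xs. step_list xs \<and> 0 \<le> step_value xs \<and> step_value xs \<le> f \<and> f \<le> step_value xs + ((1/2)^n) *\<^sub>R \<beta>"
proof (induction n)
  case 0
  then show ?case using f by (intro exI[of _ "[]"]) auto
next
  case (Suc n)
  have \<beta>0: "0 \<le> \<beta>" using f by simp
  obtain xs where xs: "step_list xs" "0 \<le> step_value xs" "step_value xs \<le> f" "f \<le> step_value xs + ((1/2)^n) *\<^sub>R \<beta>"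
    using Suc by blast
  define \<alpha> where "\<alpha> = ((1/2)^Suc n) *\<^sub>R \<beta>"
  have \<alpha>2: "((1/2)^n) *\<^sub>R \<beta> = \<alpha> + \<alpha>" by (simp add: \<alpha>_def flip: scaleR_add_left)
  have \<alpha>: "\<alpha> \<in> R" "0 \<le> \<alpha>" using \<beta> \<beta>0 by (auto simp: \<alpha>_def scaleR_nonneg_nonneg)
  define g where "g = f - step_value xs"
  define x where "x = g - \<alpha>"
  have g: "0 \<le> g" "g \<le> \<alpha> + \<alpha>" using xs \<alpha>2 by (auto simp: g_def algebra_simps)
  obtain p where p: "component p" "p * x = pprt x" using ex_component_pprt by blast
  have px: "pprt (- x) = p * x - x" unfolding p(2) using pprt_diff[of x] by (simp add: algebra_simps)
  have c: "0 \<le> e - p" "0 \<le> p" using component_le_unit component_nonneg p(1) by auto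
  \<comment> \<open>Inequalities 1 and 2 both arise by writing the difference of the two sides as a
    nonnegative piece carried by \<open>p\<close> plus one carried by \<open>e - p\<close>.\<close>
  have "0 \<le> (e - p) * g" using c g by simp
  then have "0 \<le> pprt x + (e - p) * g" by simp
  also have "\<dots> = g - \<alpha> * p" unfolding p(2)[symmetric] by (simp add: x_def algebra_simps mult_commute[of \<alpha> p])
  finally have 1: "\<alpha> * p \<le> g" by simp
  have "0 \<le> p * (\<alpha> + \<alpha> - g) + pprt (- x)" using c g by simp
  also have "\<dots> = \<alpha> * p + \<alpha> - g" unfolding px by (simp add: x_def algebra_simps mult_commute[of \<alpha> p])
  finally have 2: "g \<le> \<alpha> * p + \<alpha>" by simp
  show ?case
    by (rule exI[of _ "(\<alpha>, p) # xs"])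
      (use 1 2 p(1) \<alpha> xs c in \<open>auto simp: g_def \<alpha>_def[symmetric] algebra_simps simp del: power_Suc\<close>)
qed

section \<open>The integral of a positive charge\<close>

definition additive_on_components :: "('u \<Rightarrow> 'u) \<Rightarrow> bool" where
  "additive_on_components \<mu> \<longleftrightarrow>
     (\<forall>p q. component p \<longrightarrow> component q \<longrightarrow> p * q = 0 \<longrightarrow> \<mu> (p + q) = \<mu> p + \<mu> q)"

definition positive_T_charge :: "('u \<Rightarrow> 'u) \<Rightarrow> bool" where
  "positive_T_charge \<mu> \<longleftrightarrow>
     additive_on_components \<mu> \<and> (\<forall>p. component p \<longrightarrow> 0 \<le> \<mu> p \<and> in_band p (\<mu> p))"

lemma additive_on_componentsD:
  "additive_on_components \<mu> \<Longrightarrow> component p \<Longrightarrow> component q \<Longrightarrow> p * q = 0 \<Longrightarrow> \<mu> (p + q) = \<mu> p + \<mu> q"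
  unfolding additive_on_components_def by blast

lemma additive_split:
  assumes "additive_on_components \<mu>" "component p" "component q"
  shows "\<mu> p = \<mu> (p * q) + \<mu> (p * (e - q))"
proof -
  have "p * q * (p * (e - q)) = p * (p * (q * (e - q)))" by (simp only: mult_ac)
  also have "q * (e - q) = 0" using assms(3) by (simp add: component_iff_idempotent algebra_simps)
  finally have "\<mu> (p * q + p * (e - q)) = \<mu> (p * q) + \<mu> (p * (e - q))"
    using additive_on_componentsD[OF assms(1) component_mult[OF assms(2,3)]
      component_mult[OF assms(2) component_compl[OF assms(3)]]] by simp
  then show ?thesis by (simp add: algebra_simps)
qed

lemma positive_T_chargeD:
  assumes "positive_T_charge \<mu>"
  shows "additive_on_components \<mu>" "component p \<Longrightarrow> 0 \<le> \<mu> p" "component p \<Longrightarrow> in_band p (\<mu> p)"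
    "component p \<Longrightarrow> \<mu> p \<in> R"
  using assms unfolding positive_T_charge_def in_band_def by auto

lemma mult_pprt:
  fixes c :: 'u
  assumes "0 \<le> c" shows "c * pprt x = pprt (c * x)"
proof -
  have "pprt y = y - inf y 0" for y :: 'u using prts[of y] by (simp add: nprt_def algebra_simps)
  then show ?thesis using mult_inf_distrib_left[OF assms, of x 0] by (simp add: right_diff_distrib)
qed

text \<open>\<open>\<gamma> * p \<ge> 0\<close> means that the negative part of
  \<open>\<gamma>\<close> is disjoint from \<open>p\<close>. It lies in \<open>R\<close>, so
  absolute continuity makes it disjoint from \<open>\<mu> p\<close> as well, and only the positive
  part of \<open>\<gamma>\<close> acts on \<open>\<mu> p\<close>.\<close>

lemma charge_mult_nonneg:
  assumes \<mu>: "positive_T_charge \<mu>" and p: "component p" and \<gamma>: "\<gamma> \<in> R" "0 \<le> \<gamma> * p"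
  shows "0 \<le> \<gamma> * \<mu> p"
proof -
  have "p * pprt (- \<gamma>) = pprt (- (\<gamma> * p))"
    using mult_pprt[OF component_nonneg[OF p], of "- \<gamma>"] by (simp add: mult_commute[of p \<gamma>])
  also have "\<dots> = 0" using \<gamma>(2) by simp
  finally have "inf p (pprt (- \<gamma>)) = 0"
    using component_nonneg[OF p] by (intro disjoint_if_mult_eq_0) auto
  then have "inf \<bar>\<mu> p\<bar> (pprt (- \<gamma>)) = 0"
    using in_bandD(2)[OF positive_T_chargeD(3)[OF \<mu> p], of "pprt (- \<gamma>)"] \<gamma>(1) by simp
  then have "\<mu> p * pprt (- \<gamma>) = 0"
    using disjoint_mult_eq_0 positive_T_chargeD(2)[OF \<mu> p] by simp
  then have 0: "pprt (- \<gamma>) * \<mu> p = 0" by (simp only: mult_commute)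
  have "\<gamma> * \<mu> p = (pprt \<gamma> - pprt (- \<gamma>)) * \<mu> p" by (simp only: pprt_diff)
  also have "\<dots> = pprt \<gamma> * \<mu> p" using 0 by (simp add: left_diff_distrib)
  finally show ?thesis using positive_T_chargeD(2)[OF \<mu> p] by simp
qed

text \<open>The integral over the component \<open>q\<close> of the step element that the list
  represents; the variable \<open>q\<close> is what inductions on the list cut into pieces.\<close>

definition step_sum :: "('u \<Rightarrow> 'u) \<Rightarrow> 'u \<Rightarrow> ('u \<times> 'u) list \<Rightarrow> 'u" where
  "step_sum \<mu> q xs = (\<Sum>(\<alpha>, p)\<leftarrow>xs. \<alpha> * \<mu> (p * q))"

lemma step_sum_simps [simp]:
  "step_sum \<mu> q [] = 0" "step_sum \<mu> q ((\<alpha>, p) # xs) = \<alpha> * \<mu> (p * q) + step_sum \<mu> q xs"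
  "step_sum \<mu> q (xs @ ys) = step_sum \<mu> q xs + step_sum \<mu> q ys"
  by (auto simp: step_sum_def)

lemma step_sum_split:
  assumes "additive_on_components \<mu>" "component p" "component q" "step_list xs"
  shows "step_sum \<mu> q xs = step_sum \<mu> (q * p) xs + step_sum \<mu> (q * (e - p)) xs"
  using assms(4)
proof (induction xs)
  case (Cons x xs)
  obtain \<alpha> r where x: "x = (\<alpha>, r)" by (cases x)
  have "\<mu> (r * q) = \<mu> (r * (q * p)) + \<mu> (r * (q * (e - p)))"
    using additive_split[OF assms(1) component_mult[OF _ assms(3)] assms(2)] Cons.prems x
    by (simp add: mult.assoc)
  then show ?case using Cons x by (simp add: distrib_left)
qed simp

text \<open>Splitting \<open>q\<close> along the components in the list makes all of them constant on the pieces,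
  and the induction hypothesis can be applied to both pieces because the constant \<open>\<gamma>\<close> varies.\<close>

lemma step_sum_nonneg_aux:
  assumes \<mu>: "positive_T_charge \<mu>" and "step_list xs" "\<gamma> \<in> R" "component q"
    "0 \<le> step_value xs * q + \<gamma> * q"
  shows "0 \<le> step_sum \<mu> q xs + \<gamma> * \<mu> q"
  using assms(2-)
proof (induction xs arbitrary: \<gamma> q)
  case Nil
  then show ?case using charge_mult_nonneg[OF \<mu>] by simp
next
  case (Cons x xs)
  obtain \<alpha> p where x: "x = (\<alpha>, p)" by (cases x)
  have xs: "step_list xs" and \<alpha>: "\<alpha> \<in> R" and p: "component p" using Cons.prems x by auto
  note q = \<open>component q\<close> and \<gamma> = \<open>\<gamma> \<in> R\<close>
  note \<mu>' = positive_T_chargeD(1)[OF \<mu>]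
  let ?h = "step_value (x # xs) * q + \<gamma> * q"
  have pp: "p * (p * z) = p * z" for z
    using p by (simp add: component_iff_idempotent flip: mult.assoc)
  have "0 \<le> p * ?h" using Cons.prems component_nonneg[OF p] by simp
  \<comment> \<open>On \<open>q * p\<close> the head of the list is the constant
    \<open>\<alpha>\<close>, which is absorbed into \<open>\<gamma>\<close>; on
    \<open>q * (e - p)\<close> it vanishes.\<close>
  also have "p * ?h = step_value xs * (q * p) + (\<alpha> + \<gamma>) * (q * p)"
    by (simp add: x algebra_simps mult_ac pp)
  finally have 1: "0 \<le> step_sum \<mu> (q * p) xs + (\<alpha> + \<gamma>) * \<mu> (q * p)"
    using \<alpha> \<gamma> p q by (intro Cons.IH xs component_mult) auto
  have "0 \<le> (e - p) * ?h" using Cons.prems component_nonneg[OF component_compl[OF p]] by simp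
  also have "(e - p) * ?h = step_value xs * (q * (e - p)) + \<gamma> * (q * (e - p))"
    by (simp add: x algebra_simps mult_ac pp)
  finally have 2: "0 \<le> step_sum \<mu> (q * (e - p)) xs + \<gamma> * \<mu> (q * (e - p))"
    using \<gamma> p q by (intro Cons.IH xs component_mult component_compl) auto
  have "step_sum \<mu> q (x # xs) + \<gamma> * \<mu> q
      = (step_sum \<mu> (q * p) xs + (\<alpha> + \<gamma>) * \<mu> (q * p)) + (step_sum \<mu> (q * (e - p)) xs + \<gamma> * \<mu> (q * (e - p)))"
    using step_sum_split[OF \<mu>' p q xs] additive_split[OF \<mu>' q p]
    by (simp add: x distrib_left distrib_right mult_commute[of p q])
  with 1 2 show ?case by simp
qed

definition step_scale :: "'u \<Rightarrow> ('u \<times> 'u) list \<Rightarrow> ('u \<times> 'u) list" where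
  "step_scale \<beta> xs = map (\<lambda>(\<alpha>, p). (\<beta> * \<alpha>, p)) xs"

lemma step_scale:
  "\<beta> \<in> R \<Longrightarrow> step_list xs \<Longrightarrow> step_list (step_scale \<beta> xs)"
  "step_value (step_scale \<beta> xs) = \<beta> * step_value xs"
  "step_sum \<mu> q (step_scale \<beta> xs) = \<beta> * step_sum \<mu> q xs"
proof -
  show "step_list (step_scale \<beta> xs)" if "\<beta> \<in> R" "step_list xs"
    using that unfolding step_list_def step_scale_def by auto
  show "step_value (step_scale \<beta> xs) = \<beta> * step_value xs"
    by (induction xs) (auto simp: step_scale_def distrib_left mult.assoc)
  show "step_sum \<mu> q (step_scale \<beta> xs) = \<beta> * step_sum \<mu> q xs"
    by (induction xs) (auto simp: step_scale_def distrib_left mult.assoc)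
qed

text \<open>The difference of two step elements is represented by appending one list scaled by
  \<open>- e\<close>. Used in both directions, this is what makes the integral independent of the
  representation.\<close>

lemma step_sum_mono:
  assumes \<mu>: "positive_T_charge \<mu>" and xs: "step_list xs" and ys: "step_list ys"
    and "step_value xs \<le> step_value ys"
  shows "step_sum \<mu> e xs \<le> step_sum \<mu> e ys"
  using step_sum_nonneg_aux[OF \<mu>, of "ys @ step_scale (- e) xs" 0 e] xs ys assms(4) step_scale(1)[of "- e" xs]
  by (simp add: step_scale)

lemma step_sum_R:
  assumes "positive_T_charge \<mu>" "step_list xs" shows "step_sum \<mu> e xs \<in> R"
  using assms(2) by (induction xs) (auto simp: positive_T_chargeD(4)[OF assms(1)])

text \<open>The cutting of \<open>q\<close> along the head component is that of the positivity
  argument; the empty list leaves the single piece \<open>(\<gamma>, q)\<close>. The invariant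
  \<open>snd a * q = snd a\<close> keeps the pieces inside \<open>q\<close>, so pieces from the two
  halves are disjoint.\<close>

lemma ex_disjoint_step_list_aux:
  assumes "step_list xs" "\<gamma> \<in> R" "component q"
  shows "\<exists>ys. step_list ys \<and> sorted_wrt (\<lambda>a b. snd a * snd b = 0) ys \<and>
    (\<forall>a\<in>set ys. snd a * q = snd a) \<and> step_value ys = step_value xs * q + \<gamma> * q"
  using assms
proof (induction xs arbitrary: \<gamma> q)
  case Nil
  then show ?case by (intro exI[of _ "[(\<gamma>, q)]"]) (auto simp: component_iff_idempotent)
next
  case (Cons x xs)
  obtain \<alpha> p where x: "x = (\<alpha>, p)" by (cases x)
  have xs: "step_list xs" and \<alpha>: "\<alpha> \<in> R" and p: "component p" using Cons.prems x by auto
  note q = \<open>component q\<close> and \<gamma> = \<open>\<gamma> \<in> R\<close>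
  have pp: "p * p = p" "p * (p * z) = p * z" for z
    using p by (auto simp: component_iff_idempotent simp flip: mult.assoc)
  have qq: "q * q = q" "q * (q * z) = q * z" for z
    using q by (auto simp: component_iff_idempotent simp flip: mult.assoc)
  obtain ys where ys: "step_list ys" "sorted_wrt (\<lambda>a b. snd a * snd b = 0) ys"
    "\<And>a. a \<in> set ys \<Longrightarrow> snd a * (q * p) = snd a"
    "step_value ys = step_value xs * (q * p) + (\<alpha> + \<gamma>) * (q * p)"
    using Cons.IH[OF xs R_simps(2)[OF \<alpha> \<gamma>] component_mult[OF q p]] by blast
  obtain zs where zs: "step_list zs" "sorted_wrt (\<lambda>a b. snd a * snd b = 0) zs"
    "\<And>a. a \<in> set zs \<Longrightarrow> snd a * (q * (e - p)) = snd a"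
    "step_value zs = step_value xs * (q * (e - p)) + \<gamma> * (q * (e - p))"
    using Cons.IH[OF xs \<gamma> component_mult[OF q component_compl[OF p]]] by blast
  have 1: "snd a * snd b = 0" if "a \<in> set ys" "b \<in> set zs" for a b
  proof -
    have "snd a * snd b = (snd a * (q * p)) * (snd b * (q * (e - p)))" using ys(3) zs(3) that by simp
    also have "\<dots> = snd a * (q * (snd b * (q * (p * (e - p)))))" by (simp only: mult_ac)
    also have "p * (e - p) = 0" by (simp add: right_diff_distrib pp)
    finally show ?thesis by simp
  qed
  have 2: "snd a * q = snd a" if "a \<in> set ys" for a
  proof -
    have "snd a * q = snd a * (q * p) * q" using ys(3)[OF that] by simp
    also have "\<dots> = snd a * (q * (q * p))" by (simp only: mult_ac)
    finally show ?thesis using ys(3)[OF that] by (simp only: qq)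
  qed
  have 3: "snd a * q = snd a" if "a \<in> set zs" for a
  proof -
    have "snd a * q = snd a * (q * (e - p)) * q" using zs(3)[OF that] by simp
    also have "\<dots> = snd a * (q * (q * (e - p)))" by (simp only: mult_ac)
    finally show ?thesis using zs(3)[OF that] by (simp only: qq)
  qed
  have "step_value (ys @ zs) = step_value (x # xs) * q + \<gamma> * q"
    by (simp add: ys zs x distrib_left distrib_right left_diff_distrib right_diff_distrib mult_ac)
  then show ?case using ys(1,2) zs(1,2) 1 2 3
    by (intro exI[of _ "ys @ zs"]) (auto simp: sorted_wrt_append)
qed

lemma step_rep_imp_step_list:
  assumes "step_rep E e T n \<alpha> p x"
  shows "\<exists>xs. step_list xs \<and> step_value xs = x \<and> step_sum \<mu> e xs = (\<Sum>i<n. \<alpha> i * \<mu> (p i))"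
proof (intro exI conjI)
  let ?xs = "map (\<lambda>i. (\<alpha> i, p i)) [0..<n]"
  show "step_list ?xs" "step_value ?xs = x"
    using assms unfolding step_list_def step_rep_def step_value_def components_eq R_def
    by (auto simp: interv_sum_list_conv_sum_set_nat comp_def lessThan_atLeast0)
  show "step_sum \<mu> e ?xs = (\<Sum>i<n. \<alpha> i * \<mu> (p i))"
    unfolding step_sum_def by (simp add: interv_sum_list_conv_sum_set_nat comp_def lessThan_atLeast0)
qed

lemma ex_step_rep:
  assumes "step_list xs"
  shows "\<exists>n \<alpha> p. step_rep E e T n \<alpha> p (step_value xs)"
proof -
  obtain ys where ys: "step_list ys" "sorted_wrt (\<lambda>a b. snd a * snd b = 0) ys"
    "step_value ys = step_value xs"
    using ex_disjoint_step_list_aux[OF assms, of 0 e] by auto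
  let ?\<alpha> = "\<lambda>i. fst (ys ! i)" and ?p = "\<lambda>i. snd (ys ! i)"
  have mem: "?\<alpha> i \<in> R" "component (?p i)" if "i < length ys" for i
    using ys(1) nth_mem[OF that] unfolding step_list_def by auto
  have lt: "?p i * ?p j = 0" if "i < j" "j < length ys" for i j
    using ys(2) that unfolding sorted_wrt_iff_nth_less by auto
  have "?p i * ?p j = 0" if "i \<noteq> j" "i < length ys" "j < length ys" for i j
    using lt[of i j] lt[of j i] that mult_commute by (metis linorder_neqE_nat)
  then have disj: "inf (?p i) (?p j) = 0" if "i \<noteq> j" "i < length ys" "j < length ys" for i j
    using that mem by (simp add: component_disjoint_iff)
  have "step_value ys = (\<Sum>i<length ys. ?\<alpha> i * ?p i)"
    unfolding step_value_def by (simp add: sum_list_sum_nth lessThan_atLeast0 case_prod_beta)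
  then have "step_rep E e T (length ys) ?\<alpha> ?p (step_value xs)"
    unfolding step_rep_def components_eq R_def[symmetric] using mem disj ys(3) by auto
  then show ?thesis by blast
qed

lemma step_elements_eq: "step_elements E e T = {step_value xs |xs. step_list xs}"
proof (intro equalityI subsetI)
  fix x assume "x \<in> step_elements E e T"
  then obtain n \<alpha> p where "step_rep E e T n \<alpha> p x" unfolding step_elements_def by blast
  then show "x \<in> {step_value xs |xs. step_list xs}"
    using step_rep_imp_step_list[of n \<alpha> p x "\<lambda>x. x"] by blast
next
  fix x assume "x \<in> {step_value xs |xs. step_list xs}"
  then obtain xs where "x = step_value xs" "step_list xs" by blast
  then show "x \<in> step_elements E e T" unfolding step_elements_def using ex_step_rep[of xs] by simp
qed

lemma step_integral_eq:
  assumes \<mu>: "positive_T_charge \<mu>" and xs: "step_list xs"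
  shows "step_integral E e T \<mu> (step_value xs) = step_sum \<mu> e xs"
proof -
  have eq: "y = step_sum \<mu> e xs"
    if rep: "step_rep E e T n \<alpha> p (step_value xs)" and y: "y = (\<Sum>i<n. \<alpha> i * \<mu> (p i))" for n \<alpha> p y
  proof -
    obtain ys where ys: "step_list ys" "step_value ys = step_value xs" "step_sum \<mu> e ys = y"
      using step_rep_imp_step_list[OF rep, of \<mu>] y by blast
    then show ?thesis using step_sum_mono[OF \<mu> ys(1) xs] step_sum_mono[OF \<mu> xs ys(1)] by simp
  qed
  obtain n \<alpha> p where rep: "step_rep E e T n \<alpha> p (step_value xs)" using ex_step_rep[OF xs] by blast
  show ?thesis unfolding step_integral_def
  proof (rule the_equality)
    show "\<exists>n \<alpha> p. step_rep E e T n \<alpha> p (step_value xs) \<and> step_sum \<mu> e xs = (\<Sum>i<n. \<alpha> i * \<mu> (p i))"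
      by (intro exI conjI, rule rep) (rule eq[OF rep refl, symmetric])
  qed (elim exE conjE, rule eq)
qed

section \<open>The integral as a supremum over step elements\<close>

lemma ex_R_bound:
  assumes "f \<in> \<L>" shows "\<exists>\<beta>\<in>R. 0 \<le> \<beta> \<and> f \<le> \<beta>"
  using Linf_norm(1,3)[OF assms] order_trans[OF abs_ge_self Linf_norm(2)[OF assms]] by blast

context
  fixes \<mu> :: "'u \<Rightarrow> 'u"
  assumes \<mu>: "positive_T_charge \<mu>"
begin

abbreviation J :: "'u \<Rightarrow> 'u" where "J \<equiv> pos_integral E e T \<mu>"

lemma total_mass [simp]: "0 \<le> \<mu> e" "\<mu> e \<in> R"
  using positive_T_chargeD[OF \<mu>] by auto

text \<open>The upper estimate admits step elements that need not lie below \<open>f\<close>,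
  provided they miss it by at most some \<open>\<delta>\<close> in \<open>R\<close>; the price is
  \<open>\<delta> * \<mu> e\<close>. With the lower estimate this squeezes the integral.\<close>

lemma pos_integral:
  assumes f: "f \<in> \<L>" "0 \<le> f"
  shows pos_integral_R: "J f \<in> R"
    and pos_integral_upper:
      "\<And>xs. step_list xs \<Longrightarrow> 0 \<le> step_value xs \<Longrightarrow> step_value xs \<le> f \<Longrightarrow> step_sum \<mu> e xs \<le> J f"
    and pos_integral_least:
      "\<And>xs \<delta>. step_list xs \<Longrightarrow> \<delta> \<in> R \<Longrightarrow> f \<le> step_value xs + \<delta> \<Longrightarrow> J f \<le> step_sum \<mu> e xs + \<delta> * \<mu> e"
proof -
  let ?A = "{step_sum \<mu> e xs |xs. step_list xs \<and> 0 \<le> step_value xs \<and> step_value xs \<le> f}"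
  obtain \<beta> where \<beta>: "\<beta> \<in> R" "f \<le> \<beta>" using ex_R_bound[OF f(1)] by blast
  have le: "step_sum \<mu> e ys \<le> step_sum \<mu> e xs + \<delta> * \<mu> e"
    if "step_list xs" "\<delta> \<in> R" "f \<le> step_value xs + \<delta>" "step_list ys" "step_value ys \<le> f" for xs \<delta> ys
    using step_sum_mono[OF \<mu> that(4), of "xs @ [(\<delta>, e)]"] that order_trans[OF that(5,3)] by simp
  have "step_sum \<mu> e [] \<in> ?A" using f by (intro CollectI exI[of _ "[]"]) auto
  then have ne: "?A \<noteq> {}" by blast
  have "a \<le> \<beta> * \<mu> e" if "a \<in> ?A" for a using le[of "[]" \<beta>] \<beta> that by auto
  then have bdd: "bdd_above ?A" by (rule bdd_aboveI)
  have sub: "?A \<subseteq> R" using step_sum_R[OF \<mu>] by blast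
  have "{step_integral E e T \<mu> g |g. g \<in> step_elements E e T \<and> 0 \<le> g \<and> g \<le> f} = ?A"
  proof (intro equalityI subsetI)
    fix y assume "y \<in> {step_integral E e T \<mu> g |g. g \<in> step_elements E e T \<and> 0 \<le> g \<and> g \<le> f}"
    then obtain xs where "step_list xs" "0 \<le> step_value xs" "step_value xs \<le> f"
      "y = step_integral E e T \<mu> (step_value xs)"
      unfolding step_elements_eq by blast
    then show "y \<in> ?A" using step_integral_eq[OF \<mu>] by blast
  next
    fix y assume "y \<in> ?A"
    then obtain xs where "step_list xs" "0 \<le> step_value xs" "step_value xs \<le> f"
      "y = step_sum \<mu> e xs" by blast
    then show "y \<in> {step_integral E e T \<mu> g |g. g \<in> step_elements E e T \<and> 0 \<le> g \<and> g \<le> f}"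
      unfolding step_elements_eq using step_integral_eq[OF \<mu>, of xs] by force
  qed
  then have J: "J f = Sup ?A"
    unfolding pos_integral_def R_def[symmetric] using Lub_R[OF sub ne bdd] by simp
  show "J f \<in> R" unfolding J by (rule R_Sup[OF sub ne bdd])
  show "step_sum \<mu> e xs \<le> J f" if "step_list xs" "0 \<le> step_value xs" "step_value xs \<le> f" for xs
    unfolding J using that bdd by (intro cSup_upper) blast+
  show "J f \<le> step_sum \<mu> e xs + \<delta> * \<mu> e"
    if "step_list xs" "\<delta> \<in> R" "f \<le> step_value xs + \<delta>" for xs \<delta>
    unfolding J using le[OF that] by (intro cSup_least[OF ne]) blast
qed

lemma pos_integral_nonneg: "f \<in> \<L> \<Longrightarrow> 0 \<le> f \<Longrightarrow> 0 \<le> J f"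
  using pos_integral_upper[of f "[]"] by simp

lemma pos_integral_component:
  assumes p: "component p" shows "J p = \<mu> p"
proof (rule antisym)
  have p': "p \<in> \<L>" "0 \<le> p" using p component_nonneg by auto
  show "J p \<le> \<mu> p" using pos_integral_least[OF p', of "[(e, p)]" 0] p by simp
  show "\<mu> p \<le> J p" using pos_integral_upper[OF p', of "[(e, p)]"] p p' by simp
qed

lemma pos_integral_approx:
  assumes f: "f \<in> \<L>" "0 \<le> f" "f \<le> \<beta>" and \<beta>: "\<beta> \<in> R"
  shows "\<exists>xs. step_list xs \<and> 0 \<le> step_value xs \<and> step_value xs \<le> f \<and>
    f \<le> step_value xs + ((1/2)^n) *\<^sub>R \<beta> \<and>
    step_sum \<mu> e xs \<le> J f \<and> J f \<le> step_sum \<mu> e xs + ((1/2)^n) *\<^sub>R (\<beta> * \<mu> e)"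
proof -
  obtain xs where xs: "step_list xs" "0 \<le> step_value xs" "step_value xs \<le> f" "f \<le> step_value xs + ((1/2)^n) *\<^sub>R \<beta>"
    using step_approx[OF f(2,3) \<beta>, of n] by blast
  have "((1/2)^n) *\<^sub>R \<beta> \<in> R" using \<beta> by simp
  then show ?thesis using xs pos_integral_upper[OF f(1,2) xs(1-3)] pos_integral_least[OF f(1,2) xs(1) _ xs(4)]
    by (intro exI[of _ xs]) simp
qed

text \<open>Concatenated approximations of \<open>f\<close> and \<open>g\<close> approximate
  \<open>f + g\<close>. A common bound \<open>\<beta>\<close> makes all errors multiples of
  \<open>\<beta>\<close> that tend to 0, and the Archimedean property removes them.\<close>

lemma pos_integral_add:
  assumes f: "f \<in> \<L>" "0 \<le> f" and g: "g \<in> \<L>" "0 \<le> g"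
  shows "J (f + g) = J f + J g"
proof -
  have fg: "f + g \<in> \<L>" "0 \<le> f + g" using f g by auto
  obtain \<beta>1 \<beta>2 where "\<beta>1 \<in> R" "f \<le> \<beta>1" "\<beta>2 \<in> R" "g \<le> \<beta>2" using ex_R_bound f(1) g(1) by meson
  then obtain \<beta> where \<beta>: "\<beta> \<in> R" "f \<le> \<beta>" "g \<le> \<beta>"
    using R_simps(6)[of \<beta>1 \<beta>2] le_supI1[of f \<beta>1 \<beta>2] le_supI2[of g \<beta>2 \<beta>1] by blast
  have \<beta>0: "0 \<le> \<beta>" using f(2) \<beta>(2) by (rule order_trans)
  have both: "J (f + g) - (J f + J g) \<le> ((1/2)^n) *\<^sub>R ((\<beta> + \<beta>) * \<mu> e)"
    "(J f + J g) - J (f + g) \<le> ((1/2)^n) *\<^sub>R ((\<beta> + \<beta>) * \<mu> e)" for n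
  proof -
    let ?\<delta> = "((1/2)^n) *\<^sub>R \<beta>" let ?\<delta>' = "((1/2)^n) *\<^sub>R (\<beta> * \<mu> e)"
    obtain xs where xs: "step_list xs" "0 \<le> step_value xs" "step_value xs \<le> f" "f \<le> step_value xs + ?\<delta>"
      "step_sum \<mu> e xs \<le> J f" "J f \<le> step_sum \<mu> e xs + ?\<delta>'"
      using pos_integral_approx[OF f \<beta>(2,1)] by blast
    obtain ys where ys: "step_list ys" "0 \<le> step_value ys" "step_value ys \<le> g" "g \<le> step_value ys + ?\<delta>"
      "step_sum \<mu> e ys \<le> J g" "J g \<le> step_sum \<mu> e ys + ?\<delta>'"
      using pos_integral_approx[OF g \<beta>(3,1)] by blast
    have "step_sum \<mu> e (xs @ ys) \<le> J (f + g)"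
      by (rule pos_integral_upper[OF fg]) (use xs ys in \<open>auto intro: add_mono\<close>)
    then have "step_sum \<mu> e xs + step_sum \<mu> e ys + (?\<delta>' + ?\<delta>') \<le> J (f + g) + (?\<delta>' + ?\<delta>')" by simp
    moreover have "J f + J g \<le> step_sum \<mu> e xs + step_sum \<mu> e ys + (?\<delta>' + ?\<delta>')"
      using add_mono[OF xs(6) ys(6)] by (simp add: ac_simps)
    ultimately have "J f + J g \<le> J (f + g) + (?\<delta>' + ?\<delta>')" by (rule order_trans[rotated])
    then show "(J f + J g) - J (f + g) \<le> ((1/2)^n) *\<^sub>R ((\<beta> + \<beta>) * \<mu> e)"
      by (simp add: distrib_right scaleR_add_right diff_le_eq ac_simps)
    have "f + g \<le> step_value (xs @ ys) + (?\<delta> + ?\<delta>)"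
      using add_mono[OF xs(4) ys(4)] by (simp add: algebra_simps)
    then have "J (f + g) \<le> step_sum \<mu> e (xs @ ys) + (?\<delta> + ?\<delta>) * \<mu> e"
      using xs ys \<beta>(1) by (intro pos_integral_least[OF fg]) auto
    also have "\<dots> \<le> (J f + J g) + ((1/2)^n) *\<^sub>R ((\<beta> + \<beta>) * \<mu> e)"
      using add_mono[OF xs(5) ys(5)] by (simp add: distrib_right scaleR_add_right)
    finally show "J (f + g) - (J f + J g) \<le> ((1/2)^n) *\<^sub>R ((\<beta> + \<beta>) * \<mu> e)"
      by (simp add: diff_le_eq add.commute)
  qed
  have "0 \<le> (\<beta> + \<beta>) * \<mu> e" using \<beta>0 by simp
  then show ?thesis
    using archimedean_power_half[OF both(1)] archimedean_power_half[OF both(2)] by simp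
qed

lemma pos_integral_mult:
  assumes \<alpha>: "\<alpha> \<in> R" "0 \<le> \<alpha>" and f: "f \<in> \<L>" "0 \<le> f"
  shows "J (\<alpha> * f) = \<alpha> * J f"
proof -
  have \<alpha>f: "\<alpha> * f \<in> \<L>" "0 \<le> \<alpha> * f" using f \<alpha> by auto
  obtain \<beta> where \<beta>: "\<beta> \<in> R" "0 \<le> \<beta>" "f \<le> \<beta>" using ex_R_bound[OF f(1)] by blast
  have both: "J (\<alpha> * f) - \<alpha> * J f \<le> ((1/2)^n) *\<^sub>R (\<alpha> * \<beta> * \<mu> e)"
    "\<alpha> * J f - J (\<alpha> * f) \<le> ((1/2)^n) *\<^sub>R (\<alpha> * \<beta> * \<mu> e)" for n
  proof -
    let ?\<delta> = "((1/2)^n) *\<^sub>R \<beta>" let ?\<delta>' = "((1/2)^n) *\<^sub>R (\<beta> * \<mu> e)"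
    obtain xs where xs: "step_list xs" "0 \<le> step_value xs" "step_value xs \<le> f" "f \<le> step_value xs + ?\<delta>"
      "step_sum \<mu> e xs \<le> J f" "J f \<le> step_sum \<mu> e xs + ?\<delta>'"
      using pos_integral_approx[OF f \<beta>(3,1)] by blast
    let ?ys = "step_scale \<alpha> xs"
    have ys: "step_list ?ys" using xs(1) \<alpha>(1) by (rule step_scale(1)[rotated])
    have "\<alpha> * step_sum \<mu> e xs \<le> J (\<alpha> * f)"
      using pos_integral_upper[OF \<alpha>f ys] xs \<alpha> by (simp add: step_scale mult_left_mono)
    moreover have "\<alpha> * J f \<le> \<alpha> * step_sum \<mu> e xs + \<alpha> * ?\<delta>'"
      using mult_left_mono[OF xs(6) \<alpha>(2)] by (simp add: distrib_left)
    ultimately have "\<alpha> * J f \<le> J (\<alpha> * f) + \<alpha> * ?\<delta>'"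
      by (rule order_trans[rotated, OF add_right_mono])
    then show "\<alpha> * J f - J (\<alpha> * f) \<le> ((1/2)^n) *\<^sub>R (\<alpha> * \<beta> * \<mu> e)"
      by (simp add: diff_le_eq add.commute mult.assoc)
    have "\<alpha> * f \<le> step_value ?ys + \<alpha> * ?\<delta>"
      using mult_left_mono[OF xs(4) \<alpha>(2)] by (simp add: distrib_left step_scale)
    then have "J (\<alpha> * f) \<le> step_sum \<mu> e ?ys + \<alpha> * ?\<delta> * \<mu> e"
      using ys \<beta>(1) \<alpha>(1) by (intro pos_integral_least[OF \<alpha>f]) auto
    also have "\<dots> \<le> \<alpha> * J f + \<alpha> * ?\<delta> * \<mu> e"
      using mult_left_mono[OF xs(5) \<alpha>(2)] by (simp add: step_scale)
    finally show "J (\<alpha> * f) - \<alpha> * J f \<le> ((1/2)^n) *\<^sub>R (\<alpha> * \<beta> * \<mu> e)"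
      by (simp add: diff_le_eq add.commute mult.assoc)
  qed
  have "0 \<le> \<alpha> * \<beta> * \<mu> e" using \<beta> \<alpha> by simp
  then show ?thesis
    using archimedean_power_half[OF both(1)] archimedean_power_half[OF both(2)] by simp
qed

end

section \<open>Extension of the integral from the positive cone\<close>

definition lin_integral :: "('u \<Rightarrow> 'u) \<Rightarrow> 'u \<Rightarrow> 'u" where
  "lin_integral \<mu> f = pos_integral E e T \<mu> (pprt f) - pos_integral E e T \<mu> (pprt (- f))"

context
  fixes \<mu> :: "'u \<Rightarrow> 'u"
  assumes \<mu>: "positive_T_charge \<mu>"
begin

text \<open>By additivity on the cone, every representation as a difference of positive elements
  gives the same value; linearity then only requires a convenient representation.\<close>

lemma lin_integral_diff:
  assumes a: "a \<in> \<L>" "0 \<le> a" and b: "b \<in> \<L>" "0 \<le> b"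
  shows "lin_integral \<mu> (a - b) = pos_integral E e T \<mu> a - pos_integral E e T \<mu> b"
proof -
  let ?f = "a - b"
  have f: "?f \<in> \<L>" "- ?f \<in> \<L>" using a b Linf_minus[OF Linf_diff[OF a(1) b(1)]] by auto
  have "pprt ?f + b = a + pprt (- ?f)" using pprt_diff[of ?f] by (simp add: algebra_simps)
  then have "pos_integral E e T \<mu> (pprt ?f + b) = pos_integral E e T \<mu> (a + pprt (- ?f))" by simp
  then show ?thesis unfolding lin_integral_def
    using pos_integral_add[OF \<mu> Linf_pprt[OF f(1)] zero_le_pprt b]
      pos_integral_add[OF \<mu> a Linf_pprt[OF f(2)] zero_le_pprt]
    by (simp add: algebra_simps)
qed

lemma lin_integral_add:
  assumes f: "f \<in> \<L>" and g: "g \<in> \<L>"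
  shows "lin_integral \<mu> (f + g) = lin_integral \<mu> f + lin_integral \<mu> g"
proof -
  have "f + g = (pprt f + pprt g) - (pprt (- f) + pprt (- g))"
    using pprt_diff[of f] pprt_diff[of g] by (simp add: algebra_simps)
  then show ?thesis
    using f g by (simp add: lin_integral_diff) (simp add: lin_integral_def pos_integral_add[OF \<mu>])
qed

lemma lin_integral_mult:
  assumes f: "f \<in> \<L>" and \<alpha>: "\<alpha> \<in> R"
  shows "lin_integral \<mu> (\<alpha> * f) = \<alpha> * lin_integral \<mu> f"
proof -
  let ?a = "pprt \<alpha>" and ?b = "pprt (- \<alpha>)" and ?g = "pprt f" and ?h = "pprt (- f)"
  have eq: "(?a - ?b) * x = ?a * x - ?b * x" for x by (rule left_diff_distrib)
  have "\<alpha> * f = (?a - ?b) * (?g - ?h)" by (simp only: pprt_diff)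
  also have "\<dots> = (?a * ?g + ?b * ?h) - (?a * ?h + ?b * ?g)" by (simp only: algebra_simps)
  finally have "lin_integral \<mu> (\<alpha> * f) = ?a * pos_integral E e T \<mu> ?g + ?b * pos_integral E e T \<mu> ?h
      - (?a * pos_integral E e T \<mu> ?h + ?b * pos_integral E e T \<mu> ?g)"
    using f \<alpha> by (simp add: lin_integral_diff pos_integral_add[OF \<mu>] pos_integral_mult[OF \<mu>])
  also have "\<dots> = (?a - ?b) * lin_integral \<mu> f"
    unfolding lin_integral_def by (simp only: algebra_simps)
  finally show ?thesis by (simp only: pprt_diff)
qed

lemma lin_integral_scaleR:
  "f \<in> \<L> \<Longrightarrow> lin_integral \<mu> (c *\<^sub>R f) = c *\<^sub>R lin_integral \<mu> f"
  using lin_integral_mult[of f "c *\<^sub>R e"] by simp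

lemma lin_integral_eq_pos:
  assumes "f \<in> \<L>" "0 \<le> f" shows "lin_integral \<mu> f = pos_integral E e T \<mu> f"
  using lin_integral_diff[OF assms Linf_0] pos_integral_add[OF \<mu> Linf_0 _ Linf_0] by simp

lemma lin_integral_nonneg: "f \<in> \<L> \<Longrightarrow> 0 \<le> f \<Longrightarrow> 0 \<le> lin_integral \<mu> f"
  by (simp add: lin_integral_eq_pos pos_integral_nonneg[OF \<mu>])

lemma lin_integral_R [simp]: "f \<in> \<L> \<Longrightarrow> lin_integral \<mu> f \<in> R"
  by (simp add: lin_integral_def pos_integral_R[OF \<mu>])

lemma lin_integral_component: "component p \<Longrightarrow> lin_integral \<mu> p = \<mu> p"
  by (simp add: lin_integral_eq_pos component_nonneg pos_integral_component[OF \<mu>])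

lemma lin_integral_mono:
  assumes "f \<in> \<L>" "g \<in> \<L>" "f \<le> g" shows "lin_integral \<mu> f \<le> lin_integral \<mu> g"
  using lin_integral_add[of f "g - f"] lin_integral_nonneg[of "g - f"] assms by simp

text \<open>The norm of \<open>f\<close> is itself an element of \<open>R\<close> that dominates
  \<open>f\<close> and \<open>- f\<close>, and by linearity over \<open>R\<close> its integral is
  the norm times \<open>\<mu> e\<close>.\<close>

lemma abs_lin_integral_le:
  assumes f: "f \<in> \<L>"
  shows "\<bar>lin_integral \<mu> f\<bar> \<le> \<mu> e * Linf_norm E T f"
proof -
  let ?n = "Linf_norm E T f"
  note n = Linf_norm[OF f]
  have "lin_integral \<mu> ?n = ?n * \<mu> e"
    using lin_integral_mult[OF Linf_unit n(1)] lin_integral_component[of e] by simp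
  moreover have "f \<le> ?n" "- f \<le> ?n" using n(2) by (auto simp: abs_le_iff)
  moreover have "lin_integral \<mu> (- f) = - lin_integral \<mu> f"
    using lin_integral_scaleR[OF f, of "- 1"] by simp
  ultimately show ?thesis
    using lin_integral_mono[OF f Linf_R[OF n(1)]] lin_integral_mono[OF Linf_minus[OF f] Linf_R[OF n(1)]]
    by (intro abs_leI) (auto simp: mult_commute)
qed

end

section \<open>The Riesz space of charges\<close>

abbreviation "\<C> \<equiv> components E e"

lemma mem_components [simp]: "p \<in> \<C> \<longleftrightarrow> component p"
  by (simp add: components_eq)

definition order_bounded :: "('u \<Rightarrow> 'u) \<Rightarrow> bool" where
  "order_bounded \<mu> \<longleftrightarrow> (\<exists>g\<in>R. 0 \<le> g \<and> (\<forall>p. component p \<longrightarrow> \<bar>\<mu> p\<bar> \<le> g))"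

lemma additive_0: "additive_on_components \<mu> \<Longrightarrow> \<mu> 0 = 0"
  using additive_on_componentsD[of \<mu> 0 0] by simp

lemma additive_diff:
  assumes "additive_on_components \<mu>" "component p" "component q" "q \<le> p"
  shows "\<mu> (p - q) = \<mu> p - \<mu> q"
  using additive_split[OF assms(1-3)] component_mult_eq[OF assms(2) component_nonneg[OF assms(3)] assms(4)]
  by (simp add: right_diff_distrib)

lemma signed_charge_iff:
  "signed_charge E e T \<mu> \<longleftrightarrow>
    \<mu> \<in> extensional \<C> \<and> (\<forall>p. component p \<longrightarrow> \<mu> p \<in> R) \<and> additive_on_components \<mu>"
  unfolding signed_charge_def R_def[symmetric] additive_on_components_def
  using additive_0[of \<mu>] additive_on_components_def
  by (auto simp: PiE_iff component_disjoint_iff)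

lemma ba_C_iff:
  "\<mu> \<in> ba_C E e T \<longleftrightarrow> \<mu> \<in> extensional \<C> \<and> (\<forall>p. component p \<longrightarrow> \<mu> p \<in> R) \<and>
    additive_on_components \<mu> \<and> order_bounded \<mu>"
  unfolding ba_C_def signed_charge_iff order_bounded_def R_def[symmetric] by auto

lemma ba_T_iff:
  "\<mu> \<in> ba_T E e T \<longleftrightarrow> \<mu> \<in> extensional \<C> \<and> (\<forall>p. component p \<longrightarrow> in_band p (\<mu> p)) \<and>
    additive_on_components \<mu> \<and> order_bounded \<mu>"
  unfolding ba_T_def R_def[symmetric] mem_Collect_eq ba_C_iff
  using band_generated_T_component_iff in_bandD(1) by auto

lemma ba_T_subset: "\<mu> \<in> ba_T E e T \<Longrightarrow> \<mu> \<in> ba_C E e T"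
  by (simp add: ba_T_def)

lemma ba_CD:
  assumes "\<mu> \<in> ba_C E e T"
  shows "\<mu> \<in> extensional \<C>" "component p \<Longrightarrow> \<mu> p \<in> R" "additive_on_components \<mu>" "order_bounded \<mu>"
  using assms unfolding ba_C_iff by auto

text \<open>Combinations with coefficients in the algebra cover sums, negatives, real multiples and
  module multiples at once, through the coefficients \<open>e\<close>, \<open>- e\<close>, c
  \<open>e\<close> and 0.\<close>

lemma additive_lincomb:
  assumes "additive_on_components \<mu>" "additive_on_components \<nu>"
  shows "additive_on_components (\<lambda>p\<in>\<C>. \<alpha> * \<mu> p + \<beta> * \<nu> p)"
  using assms component_add unfolding additive_on_components_def by (auto simp: algebra_simps)

lemma order_bounded_lincomb:
  assumes "order_bounded \<mu>" "order_bounded \<nu>" "\<alpha> \<in> R" "\<beta> \<in> R"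
  shows "order_bounded (\<lambda>p\<in>\<C>. \<alpha> * \<mu> p + \<beta> * \<nu> p)"
proof -
  obtain g h where g: "g \<in> R" "0 \<le> g" "\<And>p. component p \<Longrightarrow> \<bar>\<mu> p\<bar> \<le> g"
    and h: "h \<in> R" "0 \<le> h" "\<And>p. component p \<Longrightarrow> \<bar>\<nu> p\<bar> \<le> h"
    using assms(1,2) unfolding order_bounded_def by blast
  have "\<bar>\<alpha> * \<mu> p + \<beta> * \<nu> p\<bar> \<le> \<bar>\<alpha>\<bar> * g + \<bar>\<beta>\<bar> * h" if "component p" for p
  proof -
    have "\<bar>\<alpha> * \<mu> p + \<beta> * \<nu> p\<bar> \<le> \<bar>\<alpha> * \<mu> p\<bar> + \<bar>\<beta> * \<nu> p\<bar>" by (rule abs_triangle_ineq)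
    also have "\<dots> \<le> \<bar>\<alpha>\<bar> * \<bar>\<mu> p\<bar> + \<bar>\<beta>\<bar> * \<bar>\<nu> p\<bar>" by (intro add_mono abs_le_mult)
    also have "\<dots> \<le> \<bar>\<alpha>\<bar> * g + \<bar>\<beta>\<bar> * h" using g(3) h(3) that by (intro add_mono mult_left_mono) auto
    finally show ?thesis .
  qed
  then show ?thesis unfolding order_bounded_def using assms g h
    by (intro bexI[of _ "\<bar>\<alpha>\<bar> * g + \<bar>\<beta>\<bar> * h"]) auto
qed

lemma ba_C_lincomb:
  assumes "\<mu> \<in> ba_C E e T" "\<nu> \<in> ba_C E e T" "\<alpha> \<in> R" "\<beta> \<in> R"
  shows "(\<lambda>p\<in>\<C>. \<alpha> * \<mu> p + \<beta> * \<nu> p) \<in> ba_C E e T"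
  using assms additive_lincomb order_bounded_lincomb unfolding ba_C_iff by simp

lemma ba_T_lincomb:
  assumes "\<mu> \<in> ba_T E e T" "\<nu> \<in> ba_T E e T" "\<alpha> \<in> R" "\<beta> \<in> R"
  shows "(\<lambda>p\<in>\<C>. \<alpha> * \<mu> p + \<beta> * \<nu> p) \<in> ba_T E e T"
  using assms additive_lincomb order_bounded_lincomb in_band_add in_band_mult unfolding ba_T_iff by simp

lemma ba_zero: "(\<lambda>p\<in>\<C>. 0) \<in> ba_T E e T" "(\<lambda>p\<in>\<C>. 0) \<in> ba_C E e T"
proof -
  show "(\<lambda>p\<in>\<C>. 0) \<in> ba_T E e T"
    unfolding ba_T_iff additive_on_components_def order_bounded_def
    by (auto simp: component_add intro!: bexI[of _ 0])
  then show "(\<lambda>p\<in>\<C>. 0) \<in> ba_C E e T" by (rule ba_T_subset)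
qed

lemma ba_neg_C: "\<mu> \<in> ba_C E e T \<Longrightarrow> ba_neg E e \<mu> \<in> ba_C E e T"
  and ba_neg_T: "\<nu> \<in> ba_T E e T \<Longrightarrow> ba_neg E e \<nu> \<in> ba_T E e T"
  using ba_C_lincomb[of \<mu> \<mu> "- e" 0] ba_T_lincomb[of \<nu> \<nu> "- e" 0] by (auto simp: ba_neg_def)

lemma ba_le_iff:
  assumes "\<mu> \<in> ba_C E e T" "\<nu> \<in> ba_C E e T"
  shows "ba_le E e T \<mu> \<nu> \<longleftrightarrow> (\<forall>p. component p \<longrightarrow> \<mu> p \<le> \<nu> p)"
proof -
  have "(\<lambda>p\<in>\<C>. e * \<nu> p + (- e) * \<mu> p) \<in> ba_C E e T"
    using assms by (intro ba_C_lincomb) auto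
  then have "(\<lambda>p\<in>\<C>. \<nu> p - \<mu> p) \<in> ba_C E e T" by simp
  then have "signed_charge E e T (\<lambda>p\<in>\<C>. \<nu> p - \<mu> p)" unfolding ba_C_def by blast
  then show ?thesis unfolding ba_le_def charge_def by auto
qed

lemma ba_C_eqI:
  assumes "\<mu> \<in> ba_C E e T" "\<nu> \<in> ba_C E e T" "\<And>p. component p \<Longrightarrow> \<mu> p = \<nu> p"
  shows "\<mu> = \<nu>"
  using extensionalityI[of \<mu> \<C> \<nu>] assms ba_CD(1) by auto

lemma ba_le_antisym:
  assumes "\<mu> \<in> ba_C E e T" "\<nu> \<in> ba_C E e T" "ba_le E e T \<mu> \<nu>" "ba_le E e T \<nu> \<mu>"
  shows "\<mu> = \<nu>"
  using assms by (intro ba_C_eqI) (auto simp: ba_le_iff intro: antisym)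

text \<open>The Riesz-Kantorovich formula for the supremum of two charges.\<close>

definition ba_join :: "('u \<Rightarrow> 'u) \<Rightarrow> ('u \<Rightarrow> 'u) \<Rightarrow> 'u \<Rightarrow> 'u" where
  "ba_join \<mu> \<nu> = (\<lambda>p\<in>\<C>. Sup ((\<lambda>q. \<mu> q + \<nu> (p - q)) ` {q. component q \<and> q \<le> p}))"

lemma ba_join_bounds:
  assumes \<mu>: "\<mu> \<in> ba_C E e T" and \<nu>: "\<nu> \<in> ba_C E e T" and p: "component p"
  shows "\<And>q. component q \<Longrightarrow> q \<le> p \<Longrightarrow> \<mu> q + \<nu> (p - q) \<le> ba_join \<mu> \<nu> p"
    and "\<And>u. (\<And>q. component q \<Longrightarrow> q \<le> p \<Longrightarrow> \<mu> q + \<nu> (p - q) \<le> u) \<Longrightarrow> ba_join \<mu> \<nu> p \<le> u"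
    and "ba_join \<mu> \<nu> p \<in> R"
    and "(\<And>q. component q \<Longrightarrow> q \<le> p \<Longrightarrow> in_band p (\<mu> q + \<nu> (p - q))) \<Longrightarrow> in_band p (ba_join \<mu> \<nu> p)"
proof -
  let ?A = "(\<lambda>q. \<mu> q + \<nu> (p - q)) ` {q. component q \<and> q \<le> p}"
  obtain g h where g: "\<And>p. component p \<Longrightarrow> \<bar>\<mu> p\<bar> \<le> g" and h: "\<And>p. component p \<Longrightarrow> \<bar>\<nu> p\<bar> \<le> h"
    using ba_CD(4)[OF \<mu>] ba_CD(4)[OF \<nu>] unfolding order_bounded_def by blast
  have ne: "?A \<noteq> {}" using p by blast
  have "a \<le> g + h" if a: "a \<in> ?A" for a
  proof -
    obtain q where q: "component q" "q \<le> p" "a = \<mu> q + \<nu> (p - q)" using a by blast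
    have "\<mu> q \<le> g" "\<nu> (p - q) \<le> h"
      using g[OF q(1)] h[OF component_diff[OF p q(1,2)]] by (auto simp: abs_le_iff)
    then show ?thesis using q(3) by (simp add: add_mono)
  qed
  then have bdd: "bdd_above ?A" by (rule bdd_aboveI)
  have sub: "?A \<subseteq> R" using ba_CD(2)[OF \<mu>] ba_CD(2)[OF \<nu>] component_diff[OF p] by auto
  have eq: "ba_join \<mu> \<nu> p = Sup ?A" using p unfolding ba_join_def by simp
  show "\<mu> q + \<nu> (p - q) \<le> ba_join \<mu> \<nu> p" if "component q" "q \<le> p" for q
    unfolding eq using bdd that by (intro cSup_upper) blast+
  show "ba_join \<mu> \<nu> p \<le> u" if "\<And>q. component q \<Longrightarrow> q \<le> p \<Longrightarrow> \<mu> q + \<nu> (p - q) \<le> u" for u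
    unfolding eq using ne that by (intro cSup_least) blast+
  show "ba_join \<mu> \<nu> p \<in> R" unfolding eq by (rule R_Sup[OF sub ne bdd])
  show "in_band p (ba_join \<mu> \<nu> p)" if "\<And>q. component q \<Longrightarrow> q \<le> p \<Longrightarrow> in_band p (\<mu> q + \<nu> (p - q))"
    unfolding eq using that by (intro in_band_cSup ne bdd) blast
qed

lemma ba_join_upper:
  assumes \<mu>: "\<mu> \<in> ba_C E e T" and \<nu>: "\<nu> \<in> ba_C E e T" and p: "component p"
  shows "\<mu> p \<le> ba_join \<mu> \<nu> p" "\<nu> p \<le> ba_join \<mu> \<nu> p"
  using ba_join_bounds(1)[OF \<mu> \<nu> p, of p] ba_join_bounds(1)[OF \<mu> \<nu> p, of 0] p component_nonneg[OF p]
    additive_0[OF ba_CD(3)[OF \<mu>]] additive_0[OF ba_CD(3)[OF \<nu>]] by auto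

text \<open>For disjoint \<open>p\<close> and \<open>r\<close>, a component \<open>q\<close> below
  \<open>p + r\<close> is the sum of \<open>p * q\<close> and \<open>r * q\<close>, and conversely
  components \<open>a \<le> p\<close> and \<open>b \<le> r\<close> add up to one below
  \<open>p + r\<close>. By \<open>val\<close> the terms of the formula split accordingly, so the
  supremum of the sums is the sum of the suprema.\<close>

lemma ba_join_C:
  assumes \<mu>: "\<mu> \<in> ba_C E e T" and \<nu>: "\<nu> \<in> ba_C E e T"
  shows "ba_join \<mu> \<nu> \<in> ba_C E e T"
  unfolding ba_C_iff
proof (intro conjI allI impI)
  let ?v = "ba_join \<mu> \<nu>"
  show "?v \<in> extensional \<C>" unfolding ba_join_def by simp
  show "?v p \<in> R" if "component p" for p using ba_join_bounds(3)[OF \<mu> \<nu> that] .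
  note \<mu>a = ba_CD(3)[OF \<mu>] and \<nu>a = ba_CD(3)[OF \<nu>]
  show "additive_on_components ?v" unfolding additive_on_components_def
  proof (intro allI impI)
    fix p r assume p: "component p" and r: "component r" and pr: "p * r = 0"
    have s: "component (p + r)" using component_add[OF p r pr] .
    have pp: "p * p = p" and rr: "r * r = r" using p r by (auto simp: component_iff_idempotent)
    have val: "\<mu> (a + b) + \<nu> (p + r - (a + b)) = (\<mu> a + \<nu> (p - a)) + (\<mu> b + \<nu> (r - b))"
      if a: "component a" "a \<le> p" and b: "component b" "b \<le> r" for a b
    proof -
      have pa: "p * a = a" and rb: "r * b = b"
        using component_mult_eq p r a b component_nonneg by auto
      have "a * b = p * a * (r * b)" by (simp only: pa rb)
      also have "\<dots> = (p * r) * (a * b)" by (simp only: mult_ac)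
      finally have ab: "a * b = 0" using pr by simp
      have ar: "a * r = 0"
        using pr pa by (metis mult_commute mult.assoc mult_zero_right)
      have pb: "p * b = 0"
        using pr rb by (metis mult.assoc mult_zero_left)
      have "(p - a) * (r - b) = 0" using pr ar pb ab by (simp add: algebra_simps)
      then have "\<nu> ((p - a) + (r - b)) = \<nu> (p - a) + \<nu> (r - b)"
        using p r a b component_diff by (intro additive_on_componentsD[OF \<nu>a]) auto
      moreover have "\<mu> (a + b) = \<mu> a + \<mu> b" using a b ab by (intro additive_on_componentsD[OF \<mu>a]) auto
      moreover have "p + r - (a + b) = (p - a) + (r - b)" by simp
      ultimately show ?thesis by (simp only: ac_simps)
    qed
    show "?v (p + r) = ?v p + ?v r"
    proof (rule antisym)
      show "?v (p + r) \<le> ?v p + ?v r"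
      proof (rule ba_join_bounds(2)[OF \<mu> \<nu> s])
        fix q assume q: "component q" "q \<le> p + r"
        have pq: "component (p * q)" "component (r * q)" using component_mult p r q by auto
        have le: "p * q \<le> p" "r * q \<le> r"
          using mult_left_mono[OF component_le_unit[OF q(1)] component_nonneg[OF p]]
            mult_left_mono[OF component_le_unit[OF q(1)] component_nonneg[OF r]] by auto
        have "p * q + r * q = q"
          using component_mult_eq[OF s component_nonneg[OF q(1)] q(2)] by (simp add: distrib_right)
        then show "\<mu> q + \<nu> (p + r - q) \<le> ?v p + ?v r"
          using val[OF pq(1) le(1) pq(2) le(2)]
            add_mono[OF ba_join_bounds(1)[OF \<mu> \<nu> p pq(1) le(1)] ba_join_bounds(1)[OF \<mu> \<nu> r pq(2) le(2)]]
          by simp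
      qed
      have le: "(\<mu> a + \<nu> (p - a)) + (\<mu> b + \<nu> (r - b)) \<le> ?v (p + r)"
        if a: "component a" "a \<le> p" and b: "component b" "b \<le> r" for a b
      proof -
        have "p * a = a" "r * b = b" using component_mult_eq p r a b component_nonneg by auto
        then have "a * b = p * r * (a * b)" using mult_ac by metis
        then have "component (a + b)" using a b pr by (intro component_add) auto
        then show ?thesis
          using val[OF a b] ba_join_bounds(1)[OF \<mu> \<nu> s, of "a + b"] a b by (simp add: add_mono)
      qed
      \<comment> \<open>The estimate \<open>le\<close> has two free components; the supremum is
        taken over \<open>a\<close> for fixed \<open>b\<close>, and then over
        \<open>b\<close>.\<close>
      have "?v p \<le> ?v (p + r) - (\<mu> b + \<nu> (r - b))" if "component b" "b \<le> r" for b
        using le that by (intro ba_join_bounds(2)[OF \<mu> \<nu> p]) (simp only: le_diff_eq)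
      then have "\<mu> b + \<nu> (r - b) \<le> ?v (p + r) - ?v p" if "component b" "b \<le> r" for b
        using that by (simp only: le_diff_eq add.commute)
      then have "?v r \<le> ?v (p + r) - ?v p" by (rule ba_join_bounds(2)[OF \<mu> \<nu> r])
      then show "?v p + ?v r \<le> ?v (p + r)" by (simp only: le_diff_eq add.commute)
    qed
  qed
  show "order_bounded ?v"
  proof -
    obtain g h where g: "g \<in> R" "0 \<le> g" "\<And>p. component p \<Longrightarrow> \<bar>\<mu> p\<bar> \<le> g"
      and h: "h \<in> R" "0 \<le> h" "\<And>p. component p \<Longrightarrow> \<bar>\<nu> p\<bar> \<le> h"
      using ba_CD(4)[OF \<mu>] ba_CD(4)[OF \<nu>] unfolding order_bounded_def by blast
    have "\<bar>?v p\<bar> \<le> g + h" if p: "component p" for p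
    proof (rule abs_leI)
      show "?v p \<le> g + h"
      proof (rule ba_join_bounds(2)[OF \<mu> \<nu> p])
        fix q assume q: "component q" "q \<le> p"
        have "\<mu> q \<le> g" "\<nu> (p - q) \<le> h"
          using g(3)[OF q(1)] h(3)[OF component_diff[OF p q]] by (auto simp: abs_le_iff)
        then show "\<mu> q + \<nu> (p - q) \<le> g + h" by (rule add_mono)
      qed
      have "- ?v p \<le> - \<mu> p" using ba_join_upper(1)[OF \<mu> \<nu> p] by simp
      also have "\<dots> \<le> g" using g(3)[OF p] by (simp add: abs_le_iff)
      finally show "- ?v p \<le> g + h" using h(2) by (simp add: add_increasing2)
    qed
    then show ?thesis unfolding order_bounded_def using g h by (intro bexI[of _ "g + h"]) auto
  qed
qed

lemma in_band_mono:
  assumes "in_band q m" "0 \<le> q" "q \<le> p" shows "in_band p m"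
  using assms(1) disjoint_mono[OF _ assms(2,3)] unfolding in_band_def by blast

lemma ba_join_T:
  assumes \<mu>: "\<mu> \<in> ba_T E e T" and \<nu>: "\<nu> \<in> ba_T E e T"
  shows "ba_join \<mu> \<nu> \<in> ba_T E e T"
proof -
  have "in_band p (ba_join \<mu> \<nu> p)" if p: "component p" for p
  proof (rule ba_join_bounds(4)[OF ba_T_subset[OF \<mu>] ba_T_subset[OF \<nu>] p])
    fix q assume q: "component q" "q \<le> p"
    have pq: "component (p - q)" "p - q \<le> p" using component_diff[OF p q] component_nonneg[OF q(1)] by auto
    show "in_band p (\<mu> q + \<nu> (p - q))"
      using in_band_mono[OF _ component_nonneg[OF q(1)] q(2)] in_band_mono[OF _ component_nonneg[OF pq(1)] pq(2)]
        \<mu> \<nu> q(1) pq(1) unfolding ba_T_iff by (intro in_band_add) auto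
  qed
  then show ?thesis
    using ba_join_C[OF ba_T_subset[OF \<mu>] ba_T_subset[OF \<nu>]] unfolding ba_T_iff ba_C_iff by auto
qed

lemma ba_join_least:
  assumes \<mu>: "\<mu> \<in> ba_C E e T" and \<nu>: "\<nu> \<in> ba_C E e T" and u: "u \<in> ba_C E e T"
    and "ba_le E e T \<mu> u" "ba_le E e T \<nu> u"
  shows "ba_le E e T (ba_join \<mu> \<nu>) u"
  unfolding ba_le_iff[OF ba_join_C[OF \<mu> \<nu>] u]
proof (intro allI impI)
  fix p assume p: "component p"
  show "ba_join \<mu> \<nu> p \<le> u p"
  proof (rule ba_join_bounds(2)[OF \<mu> \<nu> p])
    fix q assume q: "component q" "q \<le> p"
    have "\<mu> q \<le> u q" "\<nu> (p - q) \<le> u (p - q)"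
      using assms(4,5) q component_diff[OF p q] ba_le_iff[OF \<mu> u] ba_le_iff[OF \<nu> u] by auto
    then show "\<mu> q + \<nu> (p - q) \<le> u p"
      using additive_diff[OF ba_CD(3)[OF u] p q] add_mono[of "\<mu> q" "u q" "\<nu> (p - q)" "u (p - q)"] by simp
  qed
qed

text \<open>The carrier is left open so that the same supremum serves among all bounded charges,
  where the positive part is defined, and among the absolutely continuous ones.\<close>

lemma is_lub_ba_join:
  assumes \<mu>: "\<mu> \<in> ba_C E e T" and \<nu>: "\<nu> \<in> ba_C E e T"
    and X: "X \<subseteq> ba_C E e T" "ba_join \<mu> \<nu> \<in> X"
  shows "is_lub (ba_le E e T) X {\<mu>, \<nu>} (ba_join \<mu> \<nu>)"
  unfolding is_lub_def
  using ba_join_least[OF \<mu> \<nu>] X ba_join_upper[OF \<mu> \<nu>]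
    ba_le_iff[OF \<mu> ba_join_C[OF \<mu> \<nu>]] ba_le_iff[OF \<nu> ba_join_C[OF \<mu> \<nu>]] by blast

lemma Lub_ba_C:
  assumes \<mu>: "\<mu> \<in> ba_C E e T" and \<nu>: "\<nu> \<in> ba_C E e T"
  shows "Lub (ba_le E e T) (ba_C E e T) {\<mu>, \<nu>} = ba_join \<mu> \<nu>"
  unfolding Lub_def
proof (rule the_equality)
  show 1: "is_lub (ba_le E e T) (ba_C E e T) {\<mu>, \<nu>} (ba_join \<mu> \<nu>)"
    using is_lub_ba_join[OF \<mu> \<nu> _ ba_join_C[OF \<mu> \<nu>]] by blast
  fix s assume "is_lub (ba_le E e T) (ba_C E e T) {\<mu>, \<nu>} s"
  then show "s = ba_join \<mu> \<nu>" using 1 unfolding is_lub_def by (intro ba_le_antisym) blast+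
qed

lemma is_glb_ba_join:
  assumes \<mu>: "\<mu> \<in> ba_T E e T" and \<nu>: "\<nu> \<in> ba_T E e T"
  shows "is_glb (ba_le E e T) (ba_T E e T) {\<mu>, \<nu>} (ba_neg E e (ba_join (ba_neg E e \<mu>) (ba_neg E e \<nu>)))"
proof -
  let ?n = "ba_neg E e"
  let ?s = "ba_join (?n \<mu>) (?n \<nu>)"
  have s: "is_lub (ba_le E e T) (ba_T E e T) {?n \<mu>, ?n \<nu>} ?s"
    using \<mu> \<nu> ba_neg_T ba_T_subset ba_join_T by (intro is_lub_ba_join) auto
  have anti: "ba_le E e T (?n b) a" if "a \<in> ba_T E e T" "b \<in> ba_T E e T" "ba_le E e T (?n a) b" for a b
    using that ba_le_iff[OF ba_neg_C[OF ba_T_subset] ba_T_subset, of a b]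
      ba_le_iff[OF ba_neg_C[OF ba_T_subset] ba_T_subset, of b a]
    by (auto simp: ba_neg_def minus_le_iff)
  have anti': "ba_le E e T (?n b) (?n a)" if "a \<in> ba_T E e T" "b \<in> ba_T E e T" "ba_le E e T a b" for a b
    using that ba_le_iff[OF ba_T_subset ba_T_subset, of a b]
      ba_le_iff[OF ba_T_subset[OF ba_neg_T] ba_T_subset[OF ba_neg_T], of b a]
    by (auto simp: ba_neg_def)
  have anti'': "ba_le E e T a (?n b)" if "a \<in> ba_T E e T" "b \<in> ba_T E e T" "ba_le E e T b (?n a)" for a b
    using that ba_le_iff[OF ba_T_subset ba_neg_C[OF ba_T_subset], of a b]
      ba_le_iff[OF ba_T_subset ba_neg_C[OF ba_T_subset], of b a]
    by (auto simp: ba_neg_def le_minus_iff)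
  from s have sT: "?s \<in> ba_T E e T" and ub: "ba_le E e T (?n \<mu>) ?s" "ba_le E e T (?n \<nu>) ?s"
    and least: "\<And>u. u \<in> ba_T E e T \<Longrightarrow> ba_le E e T (?n \<mu>) u \<Longrightarrow> ba_le E e T (?n \<nu>) u \<Longrightarrow> ba_le E e T ?s u"
    unfolding is_lub_def by auto
  show ?thesis unfolding is_glb_def
  proof (intro conjI ballI impI)
    show "?n ?s \<in> ba_T E e T" using sT by (rule ba_neg_T)
    show "ba_le E e T (?n ?s) a" if "a \<in> {\<mu>, \<nu>}" for a
      using that anti[OF \<mu> sT ub(1)] anti[OF \<nu> sT ub(2)] by blast
    fix u assume u: "u \<in> ba_T E e T" and le: "\<forall>a\<in>{\<mu>, \<nu>}. ba_le E e T u a"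
    then have "ba_le E e T ?s (?n u)"
      using anti'[OF u \<mu>] anti'[OF u \<nu>] by (intro least ba_neg_T) blast+
    then show "ba_le E e T u (?n ?s)" by (rule anti''[OF u sT])
  qed
qed

text \<open>Positive part, negative part and modulus are determined by the single supremum
  \<open>s = sup {\<mu> q | q \<le> p}\<close>: they are \<open>s\<close>, \<open>s - \<mu> p\<close> and \<open>2 s - \<mu> p\<close>.\<close>

lemma ba_parts:
  assumes \<mu>: "\<mu> \<in> ba_C E e T" and p: "component p"
  shows ba_pos_part_diff_neg_part: "ba_pos_part E e T \<mu> p - ba_neg_part E e T \<mu> p = \<mu> p"
    and ba_modulus_eq_add: "ba_modulus E e T \<mu> p = ba_pos_part E e T \<mu> p + ba_neg_part E e T \<mu> p"
proof -
  let ?z = "\<lambda>p\<in>\<C>. 0" and ?n = "ba_neg E e \<mu>"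
  let ?s = "ba_join \<mu> ?z p"
  note n = ba_neg_C[OF \<mu>] and z = ba_zero(2)
  have n_eq: "?n q = - \<mu> q" if "component q" for q using that by (simp add: ba_neg_def)
  have diff: "\<mu> (p - q) = \<mu> p - \<mu> q" "component (p - q)" "p - q \<le> p" if "component q" "q \<le> p" for q
    using additive_diff[OF ba_CD(3)[OF \<mu>] p that] component_diff[OF p that] component_nonneg[OF that(1)] by auto
  have s_upper: "\<mu> q \<le> ?s" if "component q" "q \<le> p" for q
    using ba_join_bounds(1)[OF \<mu> z p that] diff[OF that] by simp
  have s_least: "?s \<le> u" if "\<And>q. component q \<Longrightarrow> q \<le> p \<Longrightarrow> \<mu> q \<le> u" for u
    using that diff by (intro ba_join_bounds(2)[OF \<mu> z p]) simp
  have pos: "ba_pos_part E e T \<mu> p = ?s" unfolding ba_pos_part_def Lub_ba_C[OF \<mu> z] ..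
  have neg: "ba_neg_part E e T \<mu> p = ?s - \<mu> p" unfolding ba_neg_part_def Lub_ba_C[OF n z]
  proof (rule antisym)
    show "ba_join ?n ?z p \<le> ?s - \<mu> p"
    proof (rule ba_join_bounds(2)[OF n z p])
      fix q assume q: "component q" "q \<le> p"
      \<comment> \<open>The claim says that \<open>\<mu> (p - q)\<close> is at most
        \<open>?s\<close>: exchanging \<open>q\<close> and \<open>p - q\<close> relates the supremum
        for \<open>\<mu>\<close> to that for its negative.\<close>
      show "?n q + ?z (p - q) \<le> ?s - \<mu> p"
        using s_upper[OF diff(2,3)[OF q]] diff[OF q] q by (simp add: n_eq algebra_simps)
    qed
    have "?s \<le> ba_join ?n ?z p + \<mu> p"
    proof (rule s_least)
      fix q assume q: "component q" "q \<le> p"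
      have "?n (p - q) + ?z (p - (p - q)) \<le> ba_join ?n ?z p"
        using diff[OF q] by (intro ba_join_bounds(1)[OF n z p]) auto
      then show "\<mu> q \<le> ba_join ?n ?z p + \<mu> p"
        using diff[OF q] q by (simp add: n_eq algebra_simps)
    qed
    then show "?s - \<mu> p \<le> ba_join ?n ?z p" by (simp add: algebra_simps)
  qed
  show "ba_pos_part E e T \<mu> p - ba_neg_part E e T \<mu> p = \<mu> p" unfolding pos neg by simp
  have "ba_modulus E e T \<mu> p = ?s + (?s - \<mu> p)" unfolding ba_modulus_def Lub_ba_C[OF \<mu> n]
  proof (rule antisym)
    show "ba_join \<mu> ?n p \<le> ?s + (?s - \<mu> p)"
    proof (rule ba_join_bounds(2)[OF \<mu> n p])
      fix q assume q: "component q" "q \<le> p"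
      show "\<mu> q + ?n (p - q) \<le> ?s + (?s - \<mu> p)"
      proof -
        have "\<mu> q + ?n (p - q) = (\<mu> q + \<mu> q) - \<mu> p" using diff[OF q] n_eq[of "p - q"] by simp
        also have "\<dots> \<le> (?s + ?s) - \<mu> p"
          by (rule diff_right_mono[OF add_mono[OF s_upper[OF q] s_upper[OF q]]])
        finally show ?thesis by (simp only: add_diff_eq)
      qed
    qed
    \<comment> \<open>The terms of the modulus are twice \<open>\<mu> q\<close> minus
      \<open>\<mu> p\<close>; halving isolates \<open>\<mu> q\<close>, to which leastness of
      \<open>?s\<close> applies.\<close>
    have "?s \<le> (1/2) *\<^sub>R (ba_join \<mu> ?n p + \<mu> p)"
    proof (rule s_least)
      fix q assume q: "component q" "q \<le> p"
      have "\<mu> q + \<mu> q \<le> ba_join \<mu> ?n p + \<mu> p"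
        using ba_join_bounds(1)[OF \<mu> n p q] diff[OF q] by (simp add: n_eq algebra_simps)
      then have "(1/2) *\<^sub>R (\<mu> q + \<mu> q) \<le> (1/2) *\<^sub>R (ba_join \<mu> ?n p + \<mu> p)"
        by (rule scaleR_left_mono) simp
      then show "\<mu> q \<le> (1/2) *\<^sub>R (ba_join \<mu> ?n p + \<mu> p)" by (simp flip: scaleR_add_left scaleR_2)
    qed
    from add_mono[OF this this] have "?s + ?s \<le> ba_join \<mu> ?n p + \<mu> p"
      by (simp flip: scaleR_add_left)
    then show "?s + (?s - \<mu> p) \<le> ba_join \<mu> ?n p" by (simp add: algebra_simps)
  qed
  then show "ba_modulus E e T \<mu> p = ba_pos_part E e T \<mu> p + ba_neg_part E e T \<mu> p" unfolding pos neg .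
qed

lemma ba_parts_positive:
  assumes \<mu>: "\<mu> \<in> ba_T E e T"
  shows "positive_T_charge (ba_pos_part E e T \<mu>)" "positive_T_charge (ba_neg_part E e T \<mu>)"
proof -
  have pos: "positive_T_charge (ba_pos_part E e T \<nu>)" if "\<nu> \<in> ba_T E e T" for \<nu>
    using ba_join_T[OF that ba_zero(1)] ba_join_upper(2)[OF ba_T_subset[OF that] ba_zero(2)]
      Lub_ba_C[OF ba_T_subset[OF that] ba_zero(2)]
    unfolding positive_T_charge_def ba_T_iff ba_pos_part_def by auto
  show "positive_T_charge (ba_pos_part E e T \<mu>)" using pos[OF \<mu>] .
  show "positive_T_charge (ba_neg_part E e T \<mu>)"
    using pos[OF ba_neg_T[OF \<mu>]] unfolding ba_pos_part_def ba_neg_part_def .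
qed

lemma charge_integral_eq:
  "charge_integral E e T \<mu> f =
    lin_integral (ba_pos_part E e T \<mu>) f - lin_integral (ba_neg_part E e T \<mu>) f"
  unfolding charge_integral_def lin_integral_def pprt_def by simp

end

section \<open>Order isomorphisms between function spaces\<close>

lemma is_lub_transport:
  assumes h: "bij_betw h X Y" and le: "\<And>x y. x \<in> X \<Longrightarrow> y \<in> X \<Longrightarrow> le x y \<longleftrightarrow> le' (h x) (h y)"
    and A: "A \<subseteq> X" and s: "is_lub le X A s"
  shows "is_lub le' Y (h ` A) (h s)"
  unfolding is_lub_def
proof (intro conjI ballI impI)
  have Y: "Y = h ` X" using h by (simp add: bij_betw_def)
  have sX: "s \<in> X" using s by (simp add: is_lub_def)
  then show "h s \<in> Y" using Y by blast
  show "le' a (h s)" if "a \<in> h ` A" for a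
    using that A s sX le unfolding is_lub_def by blast
  fix u assume "u \<in> Y" and u: "\<forall>a\<in>h ` A. le' a u"
  then obtain x where x: "x \<in> X" "u = h x" using Y by blast
  have "\<forall>a\<in>A. le a x" using u x A le by blast
  then show "le' (h s) u" using s x sX le unfolding is_lub_def by blast
qed

lemma is_glb_eq_is_lub: "is_glb le X A s = is_lub (\<lambda>x y. le y x) X A s"
  by (auto simp: is_glb_def is_lub_def)

lemma is_glb_transport:
  assumes "bij_betw h X Y" "\<And>x y. x \<in> X \<Longrightarrow> y \<in> X \<Longrightarrow> le x y \<longleftrightarrow> le' (h x) (h y)"
    "A \<subseteq> X" "is_glb le X A s"
  shows "is_glb le' Y (h ` A) (h s)"
  using is_lub_transport[of h X Y "\<lambda>x y. le y x" "\<lambda>x y. le' y x" A s] assms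
  unfolding is_glb_eq_is_lub by blast

lemma Lub_eqI:
  assumes "\<And>x y. x \<in> X \<Longrightarrow> y \<in> X \<Longrightarrow> le x y \<Longrightarrow> le y x \<Longrightarrow> x = y" "is_lub le X A s"
  shows "Lub le X A = s"
  unfolding Lub_def using assms by (intro the_equality) (auto simp: is_lub_def)

lemma Glb_eqI:
  assumes "\<And>x y. x \<in> X \<Longrightarrow> y \<in> X \<Longrightarrow> le x y \<Longrightarrow> le y x \<Longrightarrow> x = y" "is_glb le X A s"
  shows "Glb le X A = s"
  unfolding Glb_def using assms by (intro the_equality) (auto simp: is_glb_def)

text \<open>Only \<open>X\<close> is required to be a Riesz space: an order isomorphism carries
  suprema and infima of pairs to \<open>Y\<close>. In this way the dual receives its lattice
  structure from the charges. Antisymmetry makes the definite descriptions \<open>Lub\<close> and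
  \<open>Glb\<close> meaningful on both sides.\<close>

lemma riesz_isomorphismI:
  assumes X: "fun_riesz_space D le X"
    and anti: "\<And>x y. x \<in> X \<Longrightarrow> y \<in> X \<Longrightarrow> le x y \<Longrightarrow> le y x \<Longrightarrow> x = y"
    and h: "bij_betw h X Y"
    and le: "\<And>x y. x \<in> X \<Longrightarrow> y \<in> X \<Longrightarrow> le x y \<longleftrightarrow> le' (h x) (h y)"
    and add: "\<And>x y. x \<in> X \<Longrightarrow> y \<in> X \<Longrightarrow> h (fadd D x y) = fadd D' (h x) (h y)"
    and scale: "\<And>c x. x \<in> X \<Longrightarrow> h (fscale D c x) = fscale D' c (h x)"
  shows "riesz_isomorphism D le X D' le' Y h"
proof -
  have Y: "Y = h ` X" using h by (simp add: bij_betw_def)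
  have inj: "h x = h y \<Longrightarrow> x = y" if "x \<in> X" "y \<in> X" for x y
    using h that by (auto simp: bij_betw_def inj_on_def)
  have anti': "x = y" if "x \<in> Y" "y \<in> Y" "le' x y" "le' y x" for x y
    using that anti le unfolding Y by blast
  have closed: "fadd D x y \<in> X" "fscale D c x \<in> X" if "x \<in> X" "y \<in> X" for c x y
    using X that unfolding fun_riesz_space_def by blast+
  have lub: "\<exists>s. is_lub le X {x, y} s" "\<exists>s. is_glb le X {x, y} s" if "x \<in> X" "y \<in> X" for x y
    using X that unfolding fun_riesz_space_def by blast+
  have lub': "is_lub le' Y {h x, h y} (h s)" if "x \<in> X" "y \<in> X" "is_lub le X {x, y} s" for x y s
    using is_lub_transport[where le = le and le' = le' and A = "{x, y}" and s = s, OF h le] that by simp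
  have glb': "is_glb le' Y {h x, h y} (h s)" if "x \<in> X" "y \<in> X" "is_glb le X {x, y} s" for x y s
    using is_glb_transport[where le = le and le' = le' and A = "{x, y}" and s = s, OF h le] that by simp
  have "h (Lub le X {x, y}) = Lub le' Y {h x, h y}" if xy: "x \<in> X" "y \<in> X" for x y
  proof -
    obtain s where s: "is_lub le X {x, y} s" using lub(1)[OF xy] by blast
    have "Lub le X {x, y} = s" using anti s by (rule Lub_eqI)
    moreover have "Lub le' Y {h x, h y} = h s" using anti' lub'[OF xy s] by (rule Lub_eqI)
    ultimately show ?thesis by simp
  qed
  moreover have "h (Glb le X {x, y}) = Glb le' Y {h x, h y}" if xy: "x \<in> X" "y \<in> X" for x y
  proof -
    obtain s where s: "is_glb le X {x, y} s" using lub(2)[OF xy] by blast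
    have "Glb le X {x, y} = s" using anti s by (rule Glb_eqI)
    moreover have "Glb le' Y {h x, h y} = h s" using anti' glb'[OF xy s] by (rule Glb_eqI)
    ultimately show ?thesis by simp
  qed
  moreover have "fun_riesz_space D' le' Y"
    unfolding fun_riesz_space_def
  proof (intro conjI ballI allI)
    show "Y \<noteq> {}" using X unfolding Y fun_riesz_space_def by blast
    show "fadd D' x y \<in> Y" if "x \<in> Y" "y \<in> Y" for x y
      using that closed(1) unfolding Y by (auto simp flip: add)
    show "fscale D' c x \<in> Y" if "x \<in> Y" for c x
      using that closed(2) unfolding Y by (auto simp flip: scale)
    fix x y assume "x \<in> Y" "y \<in> Y"
    then obtain a b where ab: "a \<in> X" "b \<in> X" "x = h a" "y = h b" unfolding Y by blast
    show "\<exists>s. is_lub le' Y {x, y} s" using lub(1)[OF ab(1,2)] lub'[OF ab(1,2)] ab by blast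
    show "\<exists>s. is_glb le' Y {x, y} s" using lub(2)[OF ab(1,2)] glb'[OF ab(1,2)] ab by blast
  qed
  ultimately show ?thesis
    unfolding riesz_isomorphism_def using X h add scale by blast
qed

context T_universally_complete_triple
begin

section \<open>The strong dual\<close>

lemma Linf_dualD:
  assumes "\<phi> \<in> Linf_dual E T"
  shows "\<phi> \<in> extensional \<L>" "f \<in> \<L> \<Longrightarrow> \<phi> f \<in> R"
    "f \<in> \<L> \<Longrightarrow> g \<in> \<L> \<Longrightarrow> \<phi> (f + g) = \<phi> f + \<phi> g"
    "\<alpha> \<in> R \<Longrightarrow> f \<in> \<L> \<Longrightarrow> \<phi> (\<alpha> * f) = \<alpha> * \<phi> f"
    "\<exists>P Q. positive_operator E T P \<and> positive_operator E T Q \<and> (\<forall>f\<in>\<L>. \<phi> f = P f - Q f)"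
    "\<exists>g\<in>R. 0 \<le> g \<and> (\<forall>f\<in>\<L>. \<bar>\<phi> f\<bar> \<le> g * Linf_norm E T f)"
  using assms unfolding Linf_dual_def R_def by (auto simp: PiE_iff)

lemma positive_operator_lincomb:
  assumes "positive_operator E T P" "positive_operator E T Q" "\<alpha> \<in> R" "0 \<le> \<alpha>" "\<beta> \<in> R" "0 \<le> \<beta>"
  shows "positive_operator E T (\<lambda>f. \<alpha> * P f + \<beta> * Q f)"
  using assms unfolding positive_operator_def linear_from_def R_def[symmetric]
  by (auto simp: Pi_iff distrib_left scaleR_add_right)

lemma Linf_dual_lincomb:
  assumes \<phi>: "\<phi> \<in> Linf_dual E T" and \<psi>: "\<psi> \<in> Linf_dual E T" and \<alpha>: "\<alpha> \<in> R" and \<beta>: "\<beta> \<in> R"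
  shows "(\<lambda>f\<in>\<L>. \<alpha> * \<phi> f + \<beta> * \<psi> f) \<in> Linf_dual E T"
proof -
  let ?\<chi> = "\<lambda>f\<in>\<L>. \<alpha> * \<phi> f + \<beta> * \<psi> f"
  note D = Linf_dualD[OF \<phi>] and D' = Linf_dualD[OF \<psi>]
  have "?\<chi> \<in> \<L> \<rightarrow>\<^sub>E R" using D(2) D'(2) \<alpha> \<beta> by auto
  moreover have "\<forall>f\<in>\<L>. \<forall>g\<in>\<L>. ?\<chi> (f + g) = ?\<chi> f + ?\<chi> g" by (simp add: D(3) D'(3) distrib_left)
  moreover have "\<forall>\<gamma>\<in>R. \<forall>f\<in>\<L>. ?\<chi> (\<gamma> * f) = \<gamma> * ?\<chi> f"
    by (simp add: D(4) D'(4) distrib_left mult_left_commute)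
  moreover have "\<exists>P Q. positive_operator E T P \<and> positive_operator E T Q \<and> (\<forall>f\<in>\<L>. ?\<chi> f = P f - Q f)"
  proof -
    obtain P Q where P: "positive_operator E T P" "positive_operator E T Q" "\<And>f. f \<in> \<L> \<Longrightarrow> \<phi> f = P f - Q f"
      using D(5) by blast
    obtain P' Q' where P': "positive_operator E T P'" "positive_operator E T Q'" "\<And>f. f \<in> \<L> \<Longrightarrow> \<psi> f = P' f - Q' f"
      using D'(5) by blast
    \<comment> \<open>Signed coefficients would spoil positivity. With a - a' for
      \<open>\<alpha>\<close>, the product (a - a') (P - Q) is regrouped as (a P + a' Q) - (a' P + a
      Q), and likewise for \<open>\<beta>\<close>.\<close>
    let ?a = "pprt \<alpha>" and ?a' = "pprt (- \<alpha>)" and ?b = "pprt \<beta>" and ?b' = "pprt (- \<beta>)"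
    note lin = positive_operator_lincomb
    have "positive_operator E T (\<lambda>f. e * (?a * P f + ?a' * Q f) + e * (?b * P' f + ?b' * Q' f))"
      using \<alpha> \<beta> by (intro lin P P') auto
    moreover have "positive_operator E T (\<lambda>f. e * (?a' * P f + ?a * Q f) + e * (?b' * P' f + ?b * Q' f))"
      using \<alpha> \<beta> by (intro lin P P') auto
    moreover have "?\<chi> f = (e * (?a * P f + ?a' * Q f) + e * (?b * P' f + ?b' * Q' f))
        - (e * (?a' * P f + ?a * Q f) + e * (?b' * P' f + ?b * Q' f))" if "f \<in> \<L>" for f
    proof -
      have "?\<chi> f = (?a - ?a') * (P f - Q f) + (?b - ?b') * (P' f - Q' f)"
        using that P(3) P'(3) by (simp only: pprt_diff restrict_apply if_True)
      then show ?thesis by (simp add: algebra_simps)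
    qed
    ultimately show ?thesis by blast
  qed
  moreover have "\<exists>g\<in>R. 0 \<le> g \<and> (\<forall>f\<in>\<L>. \<bar>?\<chi> f\<bar> \<le> g * Linf_norm E T f)"
  proof -
    obtain g h where g: "g \<in> R" "0 \<le> g" "\<And>f. f \<in> \<L> \<Longrightarrow> \<bar>\<phi> f\<bar> \<le> g * Linf_norm E T f"
      and h: "h \<in> R" "0 \<le> h" "\<And>f. f \<in> \<L> \<Longrightarrow> \<bar>\<psi> f\<bar> \<le> h * Linf_norm E T f"
      using D(6) D'(6) by blast
    have "\<bar>?\<chi> f\<bar> \<le> (\<bar>\<alpha>\<bar> * g + \<bar>\<beta>\<bar> * h) * Linf_norm E T f" if f: "f \<in> \<L>" for f
    proof -
      have "\<bar>?\<chi> f\<bar> \<le> \<bar>\<alpha> * \<phi> f\<bar> + \<bar>\<beta> * \<psi> f\<bar>" using f by (simp add: abs_triangle_ineq)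
      also have "\<dots> \<le> \<bar>\<alpha>\<bar> * \<bar>\<phi> f\<bar> + \<bar>\<beta>\<bar> * \<bar>\<psi> f\<bar>" by (intro add_mono abs_le_mult)
      also have "\<dots> \<le> \<bar>\<alpha>\<bar> * (g * Linf_norm E T f) + \<bar>\<beta>\<bar> * (h * Linf_norm E T f)"
        using g(3)[OF f] h(3)[OF f] by (intro add_mono mult_left_mono) auto
      finally show ?thesis by (simp add: distrib_right mult.assoc)
    qed
    then show ?thesis using \<alpha> \<beta> g h by (intro bexI[of _ "\<bar>\<alpha>\<bar> * g + \<bar>\<beta>\<bar> * h"]) auto
  qed
  ultimately show ?thesis unfolding Linf_dual_def R_def[symmetric] by blast
qed

lemma dual_0: "\<phi> \<in> Linf_dual E T \<Longrightarrow> \<phi> 0 = 0"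
  using Linf_dualD(4)[of \<phi> 0 0] by simp

lemma disjoint_abs_if_mult_eq_0:
  fixes d :: 'u
  assumes "0 \<le> d" "d * x = 0" shows "inf \<bar>x\<bar> d = 0"
proof -
  have "d * \<bar>x\<bar> = pprt (d * x) + pprt (d * (- x))"
    by (simp add: abs_eq_pprt distrib_left mult_pprt[OF assms(1)] del: mult_minus_right)
  also have "\<dots> = 0" using assms(2) by simp
  finally have "\<bar>x\<bar> * d = 0" by (simp only: mult_commute)
  then show ?thesis using assms(1) by (intro disjoint_if_mult_eq_0) auto
qed

text \<open>Absolute continuity comes from module linearity alone: if \<open>d\<close> in
  \<open>R\<close> is disjoint from \<open>p\<close>, then \<open>d * p = 0\<close> and so
  \<open>d * \<phi> p = \<phi> (d * p) = 0\<close>.\<close>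

lemma dual_in_band:
  assumes \<phi>: "\<phi> \<in> Linf_dual E T" and p: "component p"
  shows "in_band p (\<phi> p)"
  unfolding in_band_def
proof (intro conjI ballI impI)
  show "\<phi> p \<in> R" using Linf_dualD(2)[OF \<phi>] p by simp
  fix d assume d: "d \<in> R" and "0 \<le> d \<and> inf p d = 0"
  then have "0 \<le> d" "p * d = 0" using disjoint_mult_eq_0 by auto
  then have "d * \<phi> p = 0"
    using Linf_dualD(4)[OF \<phi> d Linf_component[OF p]] dual_0[OF \<phi>] by (simp add: mult_commute[of d p])
  then show "inf \<bar>\<phi> p\<bar> d = 0" using \<open>0 \<le> d\<close> by (rule disjoint_abs_if_mult_eq_0[rotated])
qed

lemma dual_additive:
  assumes \<phi>: "\<phi> \<in> Linf_dual E T" shows "additive_on_components \<phi>"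
  unfolding additive_on_components_def using Linf_dualD(3)[OF \<phi>] by simp

lemma Linf_norm_component:
  assumes "component p" shows "Linf_norm E T p \<le> e"
  using Linf_norm(4)[of p e] assms component_nonneg component_le_unit by simp

lemma Psi_in_ba_T:
  assumes \<phi>: "\<phi> \<in> Linf_dual E T" shows "Psi E e \<phi> \<in> ba_T E e T"
proof -
  obtain g where g: "g \<in> R" "0 \<le> g" "\<And>f. f \<in> \<L> \<Longrightarrow> \<bar>\<phi> f\<bar> \<le> g * Linf_norm E T f"
    using Linf_dualD(6)[OF \<phi>] by blast
  have "\<bar>\<phi> p\<bar> \<le> g" if "component p" for p
  proof -
    have "\<bar>\<phi> p\<bar> \<le> g * Linf_norm E T p" using g(3) that by simp
    also have "\<dots> \<le> g * e" using Linf_norm_component[OF that] g(2) by (rule mult_left_mono)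
    finally show ?thesis by simp
  qed
  then show ?thesis
    unfolding ba_T_iff Psi_def order_bounded_def
    using dual_in_band[OF \<phi>] dual_additive[OF \<phi>] g(1,2)
    by (auto simp: additive_on_components_def component_add)
qed

text \<open>On step elements \<open>\<phi>\<close> is the step sum of its own values on components,
  which is monotone. Boundedness in norm makes \<open>\<phi>\<close> of the remainder in the binary
  approximation arbitrarily small.\<close>

lemma dual_nonneg:
  assumes \<phi>: "\<phi> \<in> Linf_dual E T" and pos: "\<And>p. component p \<Longrightarrow> 0 \<le> \<phi> p"
    and f: "f \<in> \<L>" "0 \<le> f"
  shows "0 \<le> \<phi> f"
proof -
  have \<mu>: "positive_T_charge \<phi>"
    unfolding positive_T_charge_def using dual_in_band[OF \<phi>] dual_additive[OF \<phi>] pos by blast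
  note D = Linf_dualD[OF \<phi>]
  have step: "\<phi> (step_value xs) = step_sum \<phi> e xs" if "step_list xs" for xs
    using that
  proof (induction xs)
    case Nil then show ?case using dual_0[OF \<phi>] by simp
  next
    case (Cons x xs)
    then show ?case by (cases x) (simp add: D(3) D(4) Linf_step_value)
  qed
  obtain \<beta> where \<beta>: "\<beta> \<in> R" "0 \<le> \<beta>" "f \<le> \<beta>" using ex_R_bound[OF f(1)] by blast
  obtain g where g: "g \<in> R" "0 \<le> g" "\<And>f. f \<in> \<L> \<Longrightarrow> \<bar>\<phi> f\<bar> \<le> g * Linf_norm E T f"
    using D(6) by blast
  have "- \<phi> f \<le> ((1/2)^n) *\<^sub>R (g * \<beta>)" for n
  proof -
    obtain xs where xs: "step_list xs" "0 \<le> step_value xs" "step_value xs \<le> f"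
      "f \<le> step_value xs + ((1/2)^n) *\<^sub>R \<beta>"
      using step_approx[OF f(2) \<beta>(3,1), of n] by blast
    let ?d = "f - step_value xs"
    have d: "?d \<in> \<L>" using f Linf_step_value[OF xs(1)] by simp
    have "\<bar>?d\<bar> \<le> ((1/2)^n) *\<^sub>R \<beta>" using xs(3,4) by (simp add: diff_le_eq add.commute)
    then have "Linf_norm E T ?d \<le> ((1/2)^n) *\<^sub>R \<beta>" by (rule Linf_norm(4)[OF d R_simps(5)[OF \<beta>(1)]])
    then have "g * Linf_norm E T ?d \<le> g * (((1/2)^n) *\<^sub>R \<beta>)" using g(2) by (rule mult_left_mono)
    from order_trans[OF order_trans[OF abs_ge_minus_self g(3)[OF d]] this]
    have *: "- \<phi> ?d \<le> ((1/2)^n) *\<^sub>R (g * \<beta>)" by (simp only: mult_scaleR_right)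
    have "\<phi> f = \<phi> ?d + \<phi> (step_value xs)"
      using D(3)[OF d Linf_step_value[OF xs(1)]] by simp
    moreover have "0 \<le> \<phi> (step_value xs)"
      using step_sum_mono[OF \<mu> _ xs(1), of "[]"] xs(2) step[OF xs(1)] by simp
    ultimately have "- \<phi> f \<le> - \<phi> ?d" by simp
    then show ?thesis using * by (rule order_trans)
  qed
  moreover have "0 \<le> g * \<beta>" using g \<beta> by simp
  ultimately have "- \<phi> f \<le> 0" by (rule archimedean_power_half)
  then show ?thesis by simp
qed

lemma dual_le_iff_ba_le:
  assumes \<phi>: "\<phi> \<in> Linf_dual E T" and \<psi>: "\<psi> \<in> Linf_dual E T"
  shows "dual_le E T \<phi> \<psi> \<longleftrightarrow> ba_le E e T (Psi E e \<phi>) (Psi E e \<psi>)"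
proof -
  have iff: "ba_le E e T (Psi E e \<phi>) (Psi E e \<psi>) \<longleftrightarrow> (\<forall>p. component p \<longrightarrow> \<phi> p \<le> \<psi> p)"
    using ba_le_iff[OF Psi_in_ba_T[OF \<phi>, THEN ba_T_subset] Psi_in_ba_T[OF \<psi>, THEN ba_T_subset]]
    by (simp add: Psi_def)
  let ?\<chi> = "\<lambda>f\<in>\<L>. e * \<psi> f + (- e) * \<phi> f"
  have \<chi>: "?\<chi> \<in> Linf_dual E T" using \<phi> \<psi> by (intro Linf_dual_lincomb) auto
  have "0 \<le> \<psi> f - \<phi> f" if "\<forall>p. component p \<longrightarrow> \<phi> p \<le> \<psi> p" "f \<in> \<L>" "0 \<le> f" for f
    using dual_nonneg[OF \<chi> _ that(2,3)] that by simp
  moreover have "\<phi> p \<le> \<psi> p" if "dual_le E T \<phi> \<psi>" "component p" for p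
    using that component_nonneg[OF that(2)] Linf_component[OF that(2)] unfolding dual_le_def by simp
  ultimately show ?thesis unfolding iff dual_le_def by blast
qed

lemma dual_le_antisym:
  assumes \<phi>: "\<phi> \<in> Linf_dual E T" and \<psi>: "\<psi> \<in> Linf_dual E T"
    and "dual_le E T \<phi> \<psi>" "dual_le E T \<psi> \<phi>"
  shows "\<phi> = \<psi>"
proof (rule extensionalityI[of _ \<L>])
  have eq: "\<phi> f = \<psi> f" if "f \<in> \<L>" "0 \<le> f" for f
    using assms(3,4) that unfolding dual_le_def by (intro antisym) auto
  fix f assume f: "f \<in> \<L>"
  have pos: "pprt f \<in> \<L>" "pprt (- f) \<in> \<L>" using f by auto
  have neg: "(- e) * pprt (- f) \<in> \<L>" using pos by simp
  have split: "\<chi> f = \<chi> (pprt f) - \<chi> (pprt (- f))" if \<chi>: "\<chi> \<in> Linf_dual E T" for \<chi>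
  proof -
    have "\<chi> (pprt f + (- e) * pprt (- f)) = \<chi> (pprt f) + (- e) * \<chi> (pprt (- f))"
      using Linf_dualD(3)[OF \<chi> pos(1) neg] Linf_dualD(4)[OF \<chi> R_simps(4)[OF unit_R] pos(2)] by metis
    then show ?thesis using pprt_diff[of f] by simp
  qed
  show "\<phi> f = \<psi> f" unfolding split[OF \<phi>] split[OF \<psi>] by (simp only: eq pos zero_le_pprt)
qed (use Linf_dualD(1) \<phi> \<psi> in auto)

text \<open>Equal restrictions are below each other, and the restriction reflects the order. This
  avoids comparing \<open>\<phi>\<close> with the integral of its restriction directly.\<close>

lemma Psi_inj:
  assumes \<phi>: "\<phi> \<in> Linf_dual E T" and \<psi>: "\<psi> \<in> Linf_dual E T" and eq: "Psi E e \<phi> = Psi E e \<psi>"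
  shows "\<phi> = \<psi>"
proof -
  have "ba_le E e T (Psi E e \<phi>) (Psi E e \<phi>)"
    using ba_le_iff[OF Psi_in_ba_T[OF \<phi>, THEN ba_T_subset] Psi_in_ba_T[OF \<phi>, THEN ba_T_subset]] by simp
  then show ?thesis using dual_le_iff_ba_le[OF \<phi> \<psi>] dual_le_iff_ba_le[OF \<psi> \<phi>] eq
    by (intro dual_le_antisym[OF \<phi> \<psi>]) auto
qed

section \<open>The representation\<close>

lemma Phi_apply:
  "f \<in> \<L> \<Longrightarrow> Phi E e T \<mu> f = lin_integral (ba_pos_part E e T \<mu>) f - lin_integral (ba_neg_part E e T \<mu>) f"
  by (simp add: Phi_def charge_integral_eq)

lemma ba_norm:
  assumes \<mu>: "\<mu> \<in> ba_T E e T"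
  shows "ba_norm E e T \<mu> = ba_pos_part E e T \<mu> e + ba_neg_part E e T \<mu> e"
    and "ba_norm E e T \<mu> \<in> R" "0 \<le> ba_norm E e T \<mu>"
proof -
  show eq: "ba_norm E e T \<mu> = ba_pos_part E e T \<mu> e + ba_neg_part E e T \<mu> e"
    unfolding ba_norm_def by (rule ba_modulus_eq_add[OF ba_T_subset[OF \<mu>] component_unit])
  show "ba_norm E e T \<mu> \<in> R" "0 \<le> ba_norm E e T \<mu>"
    unfolding eq using positive_T_chargeD(2,4)[OF ba_parts_positive(1)[OF \<mu>] component_unit]
      positive_T_chargeD(2,4)[OF ba_parts_positive(2)[OF \<mu>] component_unit] by auto
qed

lemma abs_Phi_le:
  assumes \<mu>: "\<mu> \<in> ba_T E e T" and f: "f \<in> \<L>"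
  shows "\<bar>Phi E e T \<mu> f\<bar> \<le> ba_norm E e T \<mu> * Linf_norm E T f"
proof -
  let ?p = "ba_pos_part E e T \<mu>" and ?n = "ba_neg_part E e T \<mu>"
  have "\<bar>Phi E e T \<mu> f\<bar> \<le> \<bar>lin_integral ?p f\<bar> + \<bar>lin_integral ?n f\<bar>"
    unfolding Phi_apply[OF f] by (rule abs_triangle_ineq4)
  also have "\<dots> \<le> ?p e * Linf_norm E T f + ?n e * Linf_norm E T f"
    by (intro add_mono abs_lin_integral_le ba_parts_positive[OF \<mu>] f)
  finally show ?thesis by (simp add: ba_norm(1)[OF \<mu>] distrib_right)
qed

lemma Phi_in_dual:
  assumes \<mu>: "\<mu> \<in> ba_T E e T" shows "Phi E e T \<mu> \<in> Linf_dual E T"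
proof -
  let ?p = "ba_pos_part E e T \<mu>" and ?n = "ba_neg_part E e T \<mu>" and ?\<Phi> = "Phi E e T \<mu>"
  note p = ba_parts_positive(1)[OF \<mu>] and n = ba_parts_positive(2)[OF \<mu>]
  have op: "positive_operator E T (lin_integral \<nu>)" if "positive_T_charge \<nu>" for \<nu>
    unfolding positive_operator_def linear_from_def R_def[symmetric]
    using lin_integral_add[OF that] lin_integral_scaleR[OF that] lin_integral_nonneg[OF that] lin_integral_R[OF that]
    by auto
  have "?\<Phi> \<in> extensional \<L>" by (simp add: Phi_def)
  then have "?\<Phi> \<in> \<L> \<rightarrow>\<^sub>E R"
    using lin_integral_R[OF p] lin_integral_R[OF n] by (simp add: PiE_iff Phi_apply)
  moreover have "\<forall>f\<in>\<L>. \<forall>g\<in>\<L>. ?\<Phi> (f + g) = ?\<Phi> f + ?\<Phi> g"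
    by (simp add: Phi_apply lin_integral_add[OF p] lin_integral_add[OF n])
  moreover have "\<forall>\<alpha>\<in>R. \<forall>f\<in>\<L>. ?\<Phi> (\<alpha> * f) = \<alpha> * ?\<Phi> f"
    by (simp add: Phi_apply lin_integral_mult[OF p] lin_integral_mult[OF n] right_diff_distrib)
  moreover have "\<exists>P Q. positive_operator E T P \<and> positive_operator E T Q \<and> (\<forall>f\<in>\<L>. ?\<Phi> f = P f - Q f)"
    using op[OF p] op[OF n] Phi_apply by blast
  moreover have "\<exists>g\<in>R. 0 \<le> g \<and> (\<forall>f\<in>\<L>. \<bar>?\<Phi> f\<bar> \<le> g * Linf_norm E T f)"
    using ba_norm(2,3)[OF \<mu>] abs_Phi_le[OF \<mu>] by blast
  ultimately show ?thesis unfolding Linf_dual_def R_def[symmetric] by blast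
qed

lemma Phi_component:
  assumes \<mu>: "\<mu> \<in> ba_T E e T" and p: "component p"
  shows "Phi E e T \<mu> p = \<mu> p"
  using ba_pos_part_diff_neg_part[OF ba_T_subset[OF \<mu>] p]
  by (simp add: Phi_apply p lin_integral_component[OF ba_parts_positive(1)[OF \<mu>]]
      lin_integral_component[OF ba_parts_positive(2)[OF \<mu>]])

lemma Psi_Phi:
  assumes \<mu>: "\<mu> \<in> ba_T E e T" shows "Psi E e (Phi E e T \<mu>) = \<mu>"
  by (rule ba_C_eqI[OF Psi_in_ba_T[OF Phi_in_dual[OF \<mu>], THEN ba_T_subset] ba_T_subset[OF \<mu>]])
    (simp add: Psi_def Phi_component[OF \<mu>])

lemma Phi_Psi:
  assumes \<phi>: "\<phi> \<in> Linf_dual E T" shows "Phi E e T (Psi E e \<phi>) = \<phi>"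
  by (rule Psi_inj[OF Phi_in_dual[OF Psi_in_ba_T[OF \<phi>]] \<phi>]) (rule Psi_Phi[OF Psi_in_ba_T[OF \<phi>]])

text \<open>That the total variation is an admissible bound is \<open>abs_Phi_le\<close>. It is the
  least one because it is the supremum of \<open>\<mu> q - \<mu> (e - q)\<close>, the integrals of
  elements of norm at most \<open>e\<close>.\<close>

lemma dual_norm_Phi:
  assumes \<mu>: "\<mu> \<in> ba_T E e T"
  shows "dual_norm E T (Phi E e T \<mu>) = ba_norm E e T \<mu>"
  unfolding dual_norm_def R_def[symmetric]
proof (rule Glb_eqI)
  let ?G = "{g \<in> R. 0 \<le> g \<and> (\<forall>f\<in>\<L>. \<bar>Phi E e T \<mu> f\<bar> \<le> g * Linf_norm E T f)}"
  note C = ba_T_subset[OF \<mu>] and n = ba_neg_C[OF ba_T_subset[OF \<mu>]]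
  have "ba_norm E e T \<mu> \<le> g" if g: "g \<in> ?G" for g
    unfolding ba_norm_def ba_modulus_def Lub_ba_C[OF C n]
  proof (rule ba_join_bounds(2)[OF C n component_unit])
    fix q assume q: "component q"
    \<comment> \<open>This is \<open>e\<close> on \<open>q\<close> and \<open>- e\<close> off
      \<open>q\<close>; the factor \<open>- e\<close> presents the negative as a module multiple, as
      linearity over \<open>R\<close> is stated for those.\<close>
    let ?f = "q + (- e) * (e - q)"
    have q': "component (e - q)" using component_compl[OF q] .
    have f: "?f \<in> \<L>" using q q' by simp
    have "?f \<le> e"
      using add_mono[OF component_le_unit[OF q], of "(- e) * (e - q)" 0] component_le_unit[OF q] by simp
    moreover have "- ?f \<le> e" using component_nonneg[OF q] by (simp add: minus_le_self_iff)
    ultimately have "Linf_norm E T ?f \<le> e" by (intro Linf_norm(4)[OF f] unit_R abs_leI)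
    then have "g * Linf_norm E T ?f \<le> g" using mult_left_mono[of "Linf_norm E T ?f" e g] g by simp
    moreover have "\<bar>Phi E e T \<mu> ?f\<bar> \<le> g * Linf_norm E T ?f" using g f by blast
    ultimately have "\<bar>Phi E e T \<mu> ?f\<bar> \<le> g" by (rule order_trans[rotated])
    moreover have "Phi E e T \<mu> ?f = \<mu> q + (- e) * \<mu> (e - q)"
    proof -
      have "(- e) * (e - q) \<in> \<L>" using q' Linf_mult[OF R_simps(4)[OF unit_R] Linf_component[OF q']] by blast
      then show ?thesis
        using Linf_dualD(3)[OF Phi_in_dual[OF \<mu>] Linf_component[OF q], of "(- e) * (e - q)"]
          Linf_dualD(4)[OF Phi_in_dual[OF \<mu>] R_simps(4)[OF unit_R] Linf_component[OF q']]
          Phi_component[OF \<mu> q] Phi_component[OF \<mu> q'] by metis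
    qed
    ultimately show "\<mu> q + ba_neg E e \<mu> (e - q) \<le> g"
      using q' by (simp add: ba_neg_def abs_le_iff)
  qed
  then show "is_glb (\<le>) R ?G (ba_norm E e T \<mu>)"
    unfolding is_glb_def using ba_norm(2,3)[OF \<mu>] abs_Phi_le[OF \<mu>] by auto
qed auto

lemma fun_riesz_space_ba_T: "fun_riesz_space \<C> (ba_le E e T) (ba_T E e T)"
  unfolding fun_riesz_space_def
proof (intro conjI ballI allI)
  show "ba_T E e T \<noteq> {}" using ba_zero(1) by blast
  fix \<mu> assume \<mu>: "\<mu> \<in> ba_T E e T"
  show "fscale \<C> c \<mu> \<in> ba_T E e T" for c
    using ba_T_lincomb[OF \<mu> \<mu>, of "c *\<^sub>R e" 0] by (simp add: fscale_def)
  fix \<nu> assume \<nu>: "\<nu> \<in> ba_T E e T"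
  show "fadd \<C> \<mu> \<nu> \<in> ba_T E e T" using ba_T_lincomb[OF \<mu> \<nu>, of e e] by (simp add: fadd_def)
  show "\<exists>s. is_lub (ba_le E e T) (ba_T E e T) {\<mu>, \<nu>} s"
    using is_lub_ba_join[OF ba_T_subset[OF \<mu>] ba_T_subset[OF \<nu>] _ ba_join_T[OF \<mu> \<nu>]] ba_T_subset by blast
  show "\<exists>s. is_glb (ba_le E e T) (ba_T E e T) {\<mu>, \<nu>} s" using is_glb_ba_join[OF \<mu> \<nu>] by blast
qed

lemma fun_module_ba_T: "fun_module R \<C> (ba_T E e T)"
  using fun_riesz_space_ba_T ba_T_lincomb[of \<mu> \<mu> \<alpha> 0 for \<mu> \<alpha>]
  unfolding fun_riesz_space_def fun_module_def fmult_def by simp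

lemma fun_module_dual: "fun_module R \<L> (Linf_dual E T)"
  unfolding fun_module_def
proof (intro conjI ballI)
  show "Linf_dual E T \<noteq> {}" using Phi_in_dual[OF ba_zero(1)] by blast
  show "fadd \<L> \<phi> \<psi> \<in> Linf_dual E T" if "\<phi> \<in> Linf_dual E T" "\<psi> \<in> Linf_dual E T" for \<phi> \<psi>
    using Linf_dual_lincomb[OF that, of e e] by (simp add: fadd_def)
  show "fmult \<L> \<alpha> \<phi> \<in> Linf_dual E T" if "\<alpha> \<in> R" "\<phi> \<in> Linf_dual E T" for \<alpha> \<phi>
    using Linf_dual_lincomb[OF that(2,2,1), of 0] by (simp add: fmult_def)
qed

text \<open>As c \<open>e\<close> lies in \<open>R\<close>, linearity over the reals is a case of
  linearity over \<open>R\<close>.\<close>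

lemma fscale_eq_fmult: "fscale D c x = fmult D (c *\<^sub>R e) x"
  by (simp add: fscale_def fmult_def)

lemma Psi_linear:
  "Psi E e (fadd \<L> \<phi> \<psi>) = fadd \<C> (Psi E e \<phi>) (Psi E e \<psi>)"
  "Psi E e (fmult \<L> \<alpha> \<phi>) = fmult \<C> \<alpha> (Psi E e \<phi>)"
  by (auto simp: Psi_def fadd_def fmult_def)

text \<open>Positive parts of charges do not add up, so the integral is not unfolded: the
  combination of the integrals lies in the dual, its restriction is the combination of the charges,
  and \<open>Phi_Psi\<close> leads back.\<close>

lemma Phi_linear:
  assumes \<mu>: "\<mu> \<in> ba_T E e T" and \<nu>: "\<nu> \<in> ba_T E e T" and \<alpha>: "\<alpha> \<in> R"
  shows "Phi E e T (fadd \<C> \<mu> \<nu>) = fadd \<L> (Phi E e T \<mu>) (Phi E e T \<nu>)"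
    "Phi E e T (fmult \<C> \<alpha> \<mu>) = fmult \<L> \<alpha> (Phi E e T \<mu>)"
proof -
  have "fadd \<L> (Phi E e T \<mu>) (Phi E e T \<nu>) \<in> Linf_dual E T" "fmult \<L> \<alpha> (Phi E e T \<mu>) \<in> Linf_dual E T"
    using fun_module_dual Phi_in_dual \<mu> \<nu> \<alpha> unfolding fun_module_def by auto
  from this[THEN Phi_Psi]
  show "Phi E e T (fadd \<C> \<mu> \<nu>) = fadd \<L> (Phi E e T \<mu>) (Phi E e T \<nu>)"
    "Phi E e T (fmult \<C> \<alpha> \<mu>) = fmult \<L> \<alpha> (Phi E e T \<mu>)"
    unfolding Psi_linear Psi_Phi[OF \<mu>] Psi_Phi[OF \<nu>] by simp_all
qed

lemma module_linear_Phi: "module_linear R \<C> (ba_T E e T) \<L> (Linf_dual E T) (Phi E e T)"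
  unfolding module_linear_def using fun_module_ba_T fun_module_dual Phi_in_dual
    Phi_linear(1)[OF _ _ unit_R] Phi_linear(2) by auto

lemma module_linear_Psi: "module_linear R \<L> (Linf_dual E T) \<C> (ba_T E e T) (Psi E e)"
  unfolding module_linear_def using fun_module_ba_T fun_module_dual Psi_in_ba_T Psi_linear by auto

lemma riesz_isomorphism_Phi:
  "riesz_isomorphism \<C> (ba_le E e T) (ba_T E e T) \<L> (dual_le E T) (Linf_dual E T) (Phi E e T)"
proof (rule riesz_isomorphismI[OF fun_riesz_space_ba_T])
  show "bij_betw (Phi E e T) (ba_T E e T) (Linf_dual E T)"
    by (rule bij_betw_byWitness[of _ "Psi E e"]) (auto simp: Psi_Phi Phi_Psi Phi_in_dual Psi_in_ba_T)
  show "\<mu> = \<nu>" if "\<mu> \<in> ba_T E e T" "\<nu> \<in> ba_T E e T" "ba_le E e T \<mu> \<nu>" "ba_le E e T \<nu> \<mu>" for \<mu> \<nu>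
    using that ba_le_antisym ba_T_subset by blast
  show "Phi E e T (fscale \<C> c \<mu>) = fscale \<L> c (Phi E e T \<mu>)" if "\<mu> \<in> ba_T E e T" for c \<mu>
    using Phi_linear(2)[OF that that] unfolding fscale_eq_fmult by simp
qed (simp_all add: dual_le_iff_ba_le Phi_in_dual Psi_Phi Phi_linear(1)[OF _ _ unit_R])

lemma riesz_isomorphism_Psi:
  "riesz_isomorphism \<L> (dual_le E T) (Linf_dual E T) \<C> (ba_le E e T) (ba_T E e T) (Psi E e)"
proof (rule riesz_isomorphismI)
  show "fun_riesz_space \<L> (dual_le E T) (Linf_dual E T)"
    using riesz_isomorphism_Phi unfolding riesz_isomorphism_def by blast
  show "bij_betw (Psi E e) (Linf_dual E T) (ba_T E e T)"
    by (rule bij_betw_byWitness[of _ "Phi E e T"]) (auto simp: Psi_Phi Phi_Psi Phi_in_dual Psi_in_ba_T)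
  show "Psi E e (fscale \<L> c \<phi>) = fscale \<C> c (Psi E e \<phi>)" for c \<phi>
    unfolding fscale_eq_fmult by (rule Psi_linear)
qed (simp_all add: dual_le_iff_ba_le dual_le_antisym Psi_linear)

end

theorem theorem6p8:
  fixes E :: "'u::universally_complete_f_algebra set" and e :: 'u and T :: "'u \<Rightarrow> 'u"
  assumes "universal_completion_of E e"
    and "conditional_riesz_triple E e T"
    and "T_universally_complete E T"
  shows "(\<forall>\<mu>\<in>ba_T E e T. (\<lambda>f\<in>Linf E T. charge_integral E e T \<mu> f) \<in> Linf_dual E T) \<and>
    (\<forall>\<phi>\<in>Linf_dual E T. restrict \<phi> (components E e) \<in> ba_T E e T) \<and>
    (\<forall>\<mu>\<in>ba_T E e T. Psi E e (Phi E e T \<mu>) = \<mu>) \<and>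
    (\<forall>\<phi>\<in>Linf_dual E T. Phi E e T (Psi E e \<phi>) = \<phi>) \<and>
    module_linear (T ` E) (components E e) (ba_T E e T) (Linf E T) (Linf_dual E T) (Phi E e T) \<and>
    module_linear (T ` E) (Linf E T) (Linf_dual E T) (components E e) (ba_T E e T) (Psi E e) \<and>
    (\<forall>\<mu>\<in>ba_T E e T. dual_norm E T (Phi E e T \<mu>) = ba_norm E e T \<mu>) \<and>
    (\<forall>\<phi>\<in>Linf_dual E T. ba_norm E e T (Psi E e \<phi>) = dual_norm E T \<phi>) \<and>
    riesz_isomorphism (components E e) (ba_le E e T) (ba_T E e T)
      (Linf E T) (dual_le E T) (Linf_dual E T) (Phi E e T) \<and>
    riesz_isomorphism (Linf E T) (dual_le E T) (Linf_dual E T)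
      (components E e) (ba_le E e T) (ba_T E e T) (Psi E e)"
proof -
  interpret T_universally_complete_triple E e T
    by unfold_locales (fact assms)+
  have "ba_norm E e T (Psi E e \<phi>) = dual_norm E T \<phi>" if "\<phi> \<in> Linf_dual E T" for \<phi>
    using dual_norm_Phi[OF Psi_in_ba_T[OF that]] Phi_Psi[OF that] by simp
  then show ?thesis
    unfolding R_def[symmetric] Phi_def[symmetric] Psi_def[symmetric]
    by (intro conjI ballI Phi_in_dual Psi_in_ba_T Psi_Phi Phi_Psi dual_norm_Phi module_linear_Phi
        module_linear_Psi riesz_isomorphism_Phi riesz_isomorphism_Psi)
qed

end
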